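(* Assume $N$ is odd and let $\chi,\phi\in\mathcal{O}_1$. (1) The following eight $H_\lambda$-modules are indecomposable and pairwise non-isomorphic: $M_{3,1}^\chi\otimes M_{3,1}^\phi$, $M_{3,1}^\chi\otimes M_{3,2}^\phi$, $M_{3,1}^\chi\otimes M_{3,3}^\phi$, $M_{3,2}^\chi\otimes M_{3,2}^\phi$, $M_{3,2}^\chi\otimes M_{3,4}^\phi$, $M_{3,3}^\chi\otimes M_{3,3}^\phi$, $M_{3,3}^\chi\otimes M_{3,4}^\phi$, $M_{3,4}^\chi\otimes M_{3,4}^\phi$. Besides, $M_{3,i}^\chi\otimes M_{3,j}^\phi\simeq M_{3,j}^\chi\otimes M_{3,i}^\phi$ for $(i,j)\in\{(2,1),(3,1),(3,4),(4,2)\}$. (2) $M_{3,1}^\chi\otimes M_{3,4}^\phi\simeq P^{\chi\phi}\oplus L_1^{-\overline{\chi\phi}}\simeq M_{3,4}^\chi\otimes M_{3,1}^\phi$, and $$M_{3,2}^\chi\otimes M_{3,3}^\phi\simeq C_{2,-1}^{-\overline{\chi\phi}}\oplus C_{2,1}^{\chi\phi}\oplus L_1^{\overline{\chi\phi}},\qquad M_{3,3}^\chi\otimes M_{3,2}^\phi\simeq C_{2,1}^{-\overline{\chi\phi}}\oplus C_{2,-1}^{\chi\phi}\oplus L_1^{\overline{\chi\phi}}.$$ In the category $\underline{\mathrm{Rep}}\,H_\lambda$ the tensor products decompose as $[M_{3,1}^\chi]\otimes[M_{3,4}^\phi]\simeq[M_{3,4}^\chi]\otimes[M_{3,1}^\phi]\simeq[L_1^{-\overline{\chi\phi}}]$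 and $[M_{3,2}^\chi]\otimes[M_{3,3}^\phi]\simeq[M_{3,3}^\chi]\otimes[M_{3,2}^\phi]\simeq[L_1^{\overline{\chi\phi}}]$, while the other tensor products $[M_{3,i}^\chi]\otimes[M_{3,j}^\phi]$ give rise to new simple objects (simple objects not isomorphic to the class of a module of type $L_1^\psi$ or $M_{3,k}^\psi$).
   Context: $\Bbbk$ is an algebraically closed field of characteristic zero, $N,M\ge2$ are integers, $\lambda=(\lambda_1,\lambda_2,\lambda_3)\in\Bbbk^3$, $\Gamma=\langle g_1,g_2: g_1g_2=g_2g_1,\ g_1^{2N}=g_2^{2M}=1\rangle$. $H_\lambda$ is the algebra generated by $\Gamma$ and $a_1,a_2$ with relations $g_1a_1=-a_1g_1$, $g_1a_2=-a_2g_1$, $g_2a_1=a_1g_2$, $g_2a_2=-a_2g_2$, $a_1^2=\lambda_1(1-g_1^2)$, $a_2^2=\lambda_2(1-g_2^2)$, $a_1a_2a_1a_2+a_2a_1a_2a_1=\lambda_3(1-g_1^2g_2^2)-2\lambda_1\lambda_2(1+g_2^2)(1-g_1^2)$. It is a Hopf algebra with $g_i$ group-like and $\Delta(a_i)=a_i\otimes1+g_i\otimes a_i$. $\mathrm{Rep}\,H_\lambda$ is the category of finite-dimensional modules. $\mathcal{O}=\mathbb{G}_{2N}\times\mathbb{G}_{2M}$ ($\mathbb{G}_n$ = group of $n$th roots of 1 in $\Bbbk$), with componentwise product $\chi\phi$. For $\chi=(\chi_1,\chi_2)$: a vector $v$ is of type $\chi$ if $g_iv=\chi_iv$; $S_\chi$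 is the one-dimensional $\Gamma$-module of type $\chi$; $\bar\chi=(-\chi_1,\chi_2)$, $-\chi=(-\chi_1,-\chi_2)$, $-\bar\chi=(\chi_1,-\chi_2)$. $\mathcal{O}_1$ is the set of $\chi$ with $\lambda_1(1-\chi_1^2)=\lambda_2(1-\chi_2^2)=\lambda_3(1-\chi_1^2\chi_2^2)-2\lambda_1\lambda_2(1+\chi_2^2)(1-\chi_1^2)=0$. $P^\chi=H_\lambda\otimes_{\Bbbk\Gamma}S_\chi$. For $\chi\in\mathcal{O}_1$, $\mu\in\Bbbk^\times$, the following modules have bases among $e_1,e_2,e_3,e_4$ of types $\chi,\bar\chi,-\bar\chi,-\chi$; actions not listed are zero. $L_1^\chi$: basis $e_1$. $M_{3,1}^\chi$: basis $e_1,e_2,e_3$, $a_1e_2=e_1$, $a_2e_3=e_2$. $M_{3,2}^\chi$: basis $e_1,e_2,e_3$, $a_1e_2=e_1$, $a_2e_2=e_3$. $M_{3,3}^\chi$: basis $e_1,e_2,e_4$, $a_1e_2=e_1$, $a_2e_4=e_1$. $M_{3,4}^\chi$: basis $e_1,e_3,e_4$, $a_1e_3=e_4$, $a_2e_4=e_1$. $C_{2,\mu}^\chi$: basis $e_1,e_2,e_3,e_4$, $a_1e_2=e_1$, $a_2e_3=e_2$, $a_1e_3=e_4$, $a_2e_4=\mu e_1$. Since $N$ is odd, $(H_\lambda,\omega=g_1^N)$ is a spherical Hopf algebra. For $V\in\mathrm{Rep}\,H_\lambda$ and $\theta\in\operatorname{End}(V)$ a module map, $\operatorname{qtr}(\theta)=\operatorname{tr}(\theta\omega)$.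 The category $\underline{\mathrm{Rep}}\,H_\lambda$ has objects $[X]$, $X\in\mathrm{Rep}\,H_\lambda$, and morphisms $\underline{\operatorname{Hom}}([X],[Y])=\operatorname{Hom}(X,Y)/J(X,Y)$, where $J(X,Y)=\{f\in\operatorname{Hom}(X,Y):\operatorname{qtr}(fg)=0\ \forall g\in\operatorname{Hom}(Y,X)\}$, with tensor product $[X]\otimes[Y]=[X\otimes Y]$. It is semisimple. *)

theory Defs
  imports
    "Jordan_Normal_Form.Matrix"
    "HOL-Algebra.QuotRing"
    "HOL-Algebra.Free_Abelian_Groups"
    "HOL-Algebra.Algebraic_Closure_Type"
    "HOL-Computational_Algebra.Polynomial"
begin

section \<open>The algebra by generators and relations\<close>

datatype gen = G1 | G2 | A1 | A2

text \<open>Words in the generators form the free monoid, written additively so that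
  \<open>word \<Rightarrow>\<^sub>0 'k\<close> is its monoid algebra, i.e. the free algebra on the four generators.\<close>

datatype word = Word (letters: "gen list")

instantiation word :: monoid_add
begin
definition zero_word :: word where "zero_word = Word []"
definition plus_word :: "word \<Rightarrow> word \<Rightarrow> word" where "plus_word u v = Word (letters u @ letters v)"
instance by standard (auto simp: zero_word_def plus_word_def)
end

type_synonym 'k free_alg = "word \<Rightarrow>\<^sub>0 'k"

definition fgen :: "gen \<Rightarrow> 'k::comm_ring_1 free_alg" where
  "fgen x = Poly_Mapping.single (Word [x]) 1"

definition fscal :: "'k::comm_ring_1 \<Rightarrow> 'k free_alg" where
  "fscal c = Poly_Mapping.single 0 c"

fun relators :: "nat \<Rightarrow> nat \<Rightarrow> 'k::comm_ring_1 \<times> 'k \<times> 'k \<Rightarrow> 'k free_alg set" where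
  "relators N M (l1, l2, l3) =
    (let g1 = fgen G1; g2 = fgen G2; a1 = fgen A1; a2 = fgen A2 in
     { g1 * g2 - g2 * g1, g1 ^ (2 * N) - 1, g2 ^ (2 * M) - 1,
       g1 * a1 + a1 * g1, g1 * a2 + a2 * g1, g2 * a1 - a1 * g2, g2 * a2 + a2 * g2,
       a1 ^ 2 - fscal l1 * (1 - g1 ^ 2),
       a2 ^ 2 - fscal l2 * (1 - g2 ^ 2),
       a1 * a2 * a1 * a2 + a2 * a1 * a2 * a1
         - (fscal l3 * (1 - g1 ^ 2 * g2 ^ 2)
            - fscal (2 * l1 * l2) * (1 + g2 ^ 2) * (1 - g1 ^ 2)) })"

text \<open>\<^const>\<open>genideal\<close> is the generated two-sided ideal.\<close>

definition rel_ideal :: "nat \<Rightarrow> nat \<Rightarrow> 'k::comm_ring_1 \<times> 'k \<times> 'k \<Rightarrow> 'k free_alg set" where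
  "rel_ideal N M l = genideal ring_of_type_algebra (relators N M l)"

definition H_alg :: "nat \<Rightarrow> nat \<Rightarrow> 'k::comm_ring_1 \<times> 'k \<times> 'k \<Rightarrow> 'k free_alg set ring" where
  "H_alg N M l = ring_of_type_algebra Quot rel_ideal N M l"

definition hcls :: "nat \<Rightarrow> nat \<Rightarrow> 'k::comm_ring_1 \<times> 'k \<times> 'k \<Rightarrow> 'k free_alg \<Rightarrow> 'k free_alg set" where
  "hcls N M l f = rel_ideal N M l +>\<^bsub>ring_of_type_algebra\<^esub> f"

section \<open>Finite-dimensional modules\<close>

text \<open>A module on the coordinate space of dimension \<open>rdim\<close>, given by the matrices through which
  the generators act.  It belongs to \<open>Rep\<close> iff these matrices are the values on the generators of
  a unital algebra homomorphism from \<open>H\<close> to the matrix algebra.\<close>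

record 'k rep =
  rdim :: nat
  ract :: "gen \<Rightarrow> 'k mat"

definition Rep :: "nat \<Rightarrow> nat \<Rightarrow> 'k::comm_ring_1 \<times> 'k \<times> 'k \<Rightarrow> 'k rep set" where
  "Rep N M l = {U. \<exists>\<rho> \<in> ring_hom (H_alg N M l) (ring_mat TYPE('k) (rdim U) ()).
      (\<forall>c. \<rho> (hcls N M l (fscal c)) = c \<cdot>\<^sub>m 1\<^sub>m (rdim U)) \<and>
      (\<forall>x. \<rho> (hcls N M l (fgen x)) = ract U x)}"

definition rep_Hom :: "'k::comm_ring_1 rep \<Rightarrow> 'k rep \<Rightarrow> 'k mat set" where
  "rep_Hom U V = {F \<in> carrier_mat (rdim V) (rdim U). \<forall>x. F * ract U x = ract V x * F}"

definition rep_iso ::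
  "nat \<Rightarrow> nat \<Rightarrow> 'k::comm_ring_1 \<times> 'k \<times> 'k \<Rightarrow> 'k rep \<Rightarrow> 'k rep \<Rightarrow> bool" where
  "rep_iso N M l U V \<longleftrightarrow> U \<in> Rep N M l \<and> V \<in> Rep N M l \<and>
     (\<exists>F \<in> rep_Hom U V. \<exists>G \<in> rep_Hom V U. F * G = 1\<^sub>m (rdim V) \<and> G * F = 1\<^sub>m (rdim U))"

definition rep_sum :: "'k::comm_ring_1 rep \<Rightarrow> 'k rep \<Rightarrow> 'k rep" where
  "rep_sum U V = \<lparr> rdim = rdim U + rdim V,
     ract = (\<lambda>x. four_block_mat (ract U x) (0\<^sub>m (rdim U) (rdim V))
                                 (0\<^sub>m (rdim V) (rdim U)) (ract V x)) \<rparr>"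

definition indecomposable ::
  "nat \<Rightarrow> nat \<Rightarrow> 'k::comm_ring_1 \<times> 'k \<times> 'k \<Rightarrow> 'k rep \<Rightarrow> bool" where
  "indecomposable N M l U \<longleftrightarrow> U \<in> Rep N M l \<and> rdim U > 0 \<and>
     \<not> (\<exists>V \<in> Rep N M l. \<exists>Z \<in> Rep N M l.
          rdim V > 0 \<and> rdim Z > 0 \<and> rep_iso N M l U (rep_sum V Z))"

definition kron :: "'k::comm_ring_1 mat \<Rightarrow> 'k mat \<Rightarrow> 'k mat" where
  "kron A B = mat (dim_row A * dim_row B) (dim_col A * dim_col B)
     (\<lambda>(i, j). A $$ (i div dim_row B, j div dim_col B) * B $$ (i mod dim_row B, j mod dim_col B))"

text \<open>The action on the tensor product is through the comultiplication:
  \<open>g\<^sub>i\<close> is group-like and \<open>a\<^sub>i\<close> is sent to \<open>a\<^sub>i \<otimes> 1 + g\<^sub>i \<otimes> a\<^sub>i\<close>.  The basis vector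
  \<open>e\<^sub>i \<otimes> e\<^sub>j\<close> has index \<open>i * rdim V + j\<close>.\<close>

definition rep_tensor :: "'k::comm_ring_1 rep \<Rightarrow> 'k rep \<Rightarrow> 'k rep" where
  "rep_tensor U V = \<lparr> rdim = rdim U * rdim V,
     ract = (\<lambda>x. case x of
         G1 \<Rightarrow> kron (ract U G1) (ract V G1)
       | G2 \<Rightarrow> kron (ract U G2) (ract V G2)
       | A1 \<Rightarrow> kron (ract U A1) (1\<^sub>m (rdim V)) + kron (ract U G1) (ract V A1)
       | A2 \<Rightarrow> kron (ract U A2) (1\<^sub>m (rdim V)) + kron (ract U G2) (ract V A2)) \<rparr>"

section \<open>Characters and the basic modules\<close>

definition chars :: "nat \<Rightarrow> nat \<Rightarrow> ('k::comm_ring_1 \<times> 'k) set" where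
  "chars N M = {\<chi>. fst \<chi> ^ (2 * N) = 1 \<and> snd \<chi> ^ (2 * M) = 1}"

fun O1 :: "nat \<Rightarrow> nat \<Rightarrow> 'k::comm_ring_1 \<times> 'k \<times> 'k \<Rightarrow> ('k \<times> 'k) set" where
  "O1 N M (l1, l2, l3) = {\<chi> \<in> chars N M.
     l1 * (1 - fst \<chi> ^ 2) = 0 \<and> l2 * (1 - snd \<chi> ^ 2) = 0 \<and>
     l3 * (1 - fst \<chi> ^ 2 * snd \<chi> ^ 2) - 2 * l1 * l2 * (1 + snd \<chi> ^ 2) * (1 - fst \<chi> ^ 2) = 0}"

definition cmul :: "'k::comm_ring_1 \<times> 'k \<Rightarrow> 'k \<times> 'k \<Rightarrow> 'k \<times> 'k" where
  "cmul \<chi> \<phi> = (fst \<chi> * fst \<phi>, snd \<chi> * snd \<phi>)"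

definition cbar :: "'k::comm_ring_1 \<times> 'k \<Rightarrow> 'k \<times> 'k" where
  "cbar \<chi> = (- fst \<chi>, snd \<chi>)"

definition cneg :: "'k::comm_ring_1 \<times> 'k \<Rightarrow> 'k \<times> 'k" where
  "cneg \<chi> = (- fst \<chi>, - snd \<chi>)"

text \<open>The type of the basis vector \<open>e\<^sub>i\<close>, for \<open>i\<close> in \<open>{1, 2, 3, 4}\<close>.\<close>

definition btype :: "'k::comm_ring_1 \<times> 'k \<Rightarrow> nat \<Rightarrow> 'k \<times> 'k" where
  "btype \<chi> i = (if i = 1 then \<chi> else if i = 2 then cbar \<chi>
     else if i = 3 then cneg (cbar \<chi>) else cneg \<chi>)"

text \<open>The module with basis \<open>e\<^sub>i\<close>, \<open>i\<close> in the list \<open>es\<close>, where \<open>\<alpha> i = Some (c, j)\<close> means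
  \<open>a\<^sub>1 e\<^sub>i = c e\<^sub>j\<close> and \<open>\<alpha> i = None\<close> means \<open>a\<^sub>1 e\<^sub>i = 0\<close>; likewise \<open>\<beta>\<close> for \<open>a\<^sub>2\<close>.\<close>

definition map_mat_of :: "nat list \<Rightarrow> (nat \<rightharpoonup> 'k::comm_ring_1 \<times> nat) \<Rightarrow> 'k mat" where
  "map_mat_of es \<alpha> = mat (length es) (length es) (\<lambda>(r, s).
     case \<alpha> (es ! s) of None \<Rightarrow> 0 | Some (c, j) \<Rightarrow> if es ! r = j then c else 0)"

definition based_rep ::
  "'k::comm_ring_1 \<times> 'k \<Rightarrow> nat list \<Rightarrow> (nat \<rightharpoonup> 'k \<times> nat) \<Rightarrow> (nat \<rightharpoonup> 'k \<times> nat) \<Rightarrow> 'k rep" where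
  "based_rep \<chi> es \<alpha> \<beta> = \<lparr> rdim = length es,
     ract = (\<lambda>x. case x of
         G1 \<Rightarrow> map_mat_of es (\<lambda>i. Some (fst (btype \<chi> i), i))
       | G2 \<Rightarrow> map_mat_of es (\<lambda>i. Some (snd (btype \<chi> i), i))
       | A1 \<Rightarrow> map_mat_of es \<alpha>
       | A2 \<Rightarrow> map_mat_of es \<beta>) \<rparr>"

definition L1 :: "'k::comm_ring_1 \<times> 'k \<Rightarrow> 'k rep" where
  "L1 \<chi> = based_rep \<chi> [1] Map.empty Map.empty"

definition M31 :: "'k::comm_ring_1 \<times> 'k \<Rightarrow> 'k rep" where
  "M31 \<chi> = based_rep \<chi> [1, 2, 3] [2 \<mapsto> (1, 1)] [3 \<mapsto> (1, 2)]"

definition M32 :: "'k::comm_ring_1 \<times> 'k \<Rightarrow> 'k rep" where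
  "M32 \<chi> = based_rep \<chi> [1, 2, 3] [2 \<mapsto> (1, 1)] [2 \<mapsto> (1, 3)]"

definition M33 :: "'k::comm_ring_1 \<times> 'k \<Rightarrow> 'k rep" where
  "M33 \<chi> = based_rep \<chi> [1, 2, 4] [2 \<mapsto> (1, 1)] [4 \<mapsto> (1, 1)]"

definition M34 :: "'k::comm_ring_1 \<times> 'k \<Rightarrow> 'k rep" where
  "M34 \<chi> = based_rep \<chi> [1, 3, 4] [3 \<mapsto> (1, 4)] [4 \<mapsto> (1, 1)]"

text \<open>Only the indices 1, 2, 3, 4 are meaningful.\<close>

definition M3 :: "nat \<Rightarrow> 'k::comm_ring_1 \<times> 'k \<Rightarrow> 'k rep" where
  "M3 i = (if i = 1 then M31 else if i = 2 then M32 else if i = 3 then M33 else M34)"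

definition C2 :: "'k::comm_ring_1 \<Rightarrow> 'k \<times> 'k \<Rightarrow> 'k rep" where
  "C2 \<mu> \<chi> = based_rep \<chi> [1, 2, 3, 4]
     [2 \<mapsto> (1, 1), 3 \<mapsto> (1, 4)] [3 \<mapsto> (1, 2), 4 \<mapsto> (\<mu>, 1)]"

section \<open>The induced module\<close>

text \<open>The tensor product of \<open>H\<close> and \<open>S\<^sub>\<chi> = \<bbbk>\<close> over \<open>\<bbbk>\<Gamma>\<close>: the free abelian group on
  \<open>H \<times> \<bbbk>\<close> modulo biadditivity and \<open>\<bbbk>\<Gamma>\<close>-balancing.  As the multiples \<open>c g\<^sub>1\<^sup>a g\<^sub>2\<^sup>b\<close>
  span \<open>\<bbbk>\<Gamma>\<close> additively, balancing is imposed for these only.\<close>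

definition ind_free ::
  "nat \<Rightarrow> nat \<Rightarrow> 'k::comm_ring_1 \<times> 'k \<times> 'k \<Rightarrow> (('k free_alg set \<times> 'k) \<Rightarrow>\<^sub>0 int) monoid" where
  "ind_free N M l = free_Abelian_group (carrier (H_alg N M l) \<times> UNIV)"

definition ind_rels ::
  "nat \<Rightarrow> nat \<Rightarrow> 'k::comm_ring_1 \<times> 'k \<times> 'k \<Rightarrow> 'k \<times> 'k
     \<Rightarrow> (('k free_alg set \<times> 'k) \<Rightarrow>\<^sub>0 int) set" where
  "ind_rels N M l \<chi> =
     {frag_of (h \<oplus>\<^bsub>H_alg N M l\<^esub> h', s) - frag_of (h, s) - frag_of (h', s) | h h' s.
        h \<in> carrier (H_alg N M l) \<and> h' \<in> carrier (H_alg N M l)}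
   \<union> {frag_of (h, s + s') - frag_of (h, s) - frag_of (h, s') | h s s'.
        h \<in> carrier (H_alg N M l)}
   \<union> {frag_of (h \<otimes>\<^bsub>H_alg N M l\<^esub> hcls N M l (fscal c * fgen G1 ^ a * fgen G2 ^ b), s)
        - frag_of (h, c * fst \<chi> ^ a * snd \<chi> ^ b * s) | h c a b s.
        h \<in> carrier (H_alg N M l)}"

definition ind_sub ::
  "nat \<Rightarrow> nat \<Rightarrow> 'k::comm_ring_1 \<times> 'k \<times> 'k \<Rightarrow> 'k \<times> 'k
     \<Rightarrow> (('k free_alg set \<times> 'k) \<Rightarrow>\<^sub>0 int) set" where
  "ind_sub N M l \<chi> = generate (ind_free N M l) (ind_rels N M l \<chi>)"

text \<open>The left \<open>H\<close>-action is \<open>h (h' \<otimes> s) = h h' \<otimes> s\<close>.  The multiplicative fields of the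
  \<^typ>\<open>('a, 'b) module\<close> record are irrelevant.\<close>

definition P_mod ::
  "nat \<Rightarrow> nat \<Rightarrow> 'k::comm_ring_1 \<times> 'k \<times> 'k \<Rightarrow> 'k \<times> 'k
     \<Rightarrow> ('k free_alg set, (('k free_alg set \<times> 'k) \<Rightarrow>\<^sub>0 int) set) module" where
  "P_mod N M l \<chi> =
     (let F = ind_free N M l; K = ind_sub N M l \<chi>; Q = F Mod K in
      \<lparr> carrier = carrier Q, monoid.mult = undefined, monoid.one = undefined,
        ring.zero = \<one>\<^bsub>Q\<^esub>, ring.add = monoid.mult Q,
        module.smult = (\<lambda>h x. \<Union>c\<in>x. K #>\<^bsub>F\<^esub>
          frag_extend (\<lambda>(h', s). frag_of (h \<otimes>\<^bsub>H_alg N M l\<^esub> h', s)) c) \<rparr>)"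

text \<open>\<open>U\<close> is isomorphic, as a left \<open>H\<close>-module, to the left \<open>H\<close>-module \<open>P\<close>; linearity over \<open>H\<close>
  is tested on the scalars and generators.\<close>

definition realizes ::
  "nat \<Rightarrow> nat \<Rightarrow> 'k::comm_ring_1 \<times> 'k \<times> 'k \<Rightarrow> 'k rep
     \<Rightarrow> ('k free_alg set, 'v) module \<Rightarrow> bool" where
  "realizes N M l U P \<longleftrightarrow> U \<in> Rep N M l \<and>
     (\<exists>f. bij_betw f (carrier_vec (rdim U)) (carrier P) \<and>
        (\<forall>u \<in> carrier_vec (rdim U). \<forall>v \<in> carrier_vec (rdim U). f (u + v) = f u \<oplus>\<^bsub>P\<^esub> f v) \<and>
        (\<forall>c. \<forall>v \<in> carrier_vec (rdim U). f (c \<cdot>\<^sub>v v) = hcls N M l (fscal c) \<odot>\<^bsub>P\<^esub> f v) \<and>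
        (\<forall>x. \<forall>v \<in> carrier_vec (rdim U). f (ract U x *\<^sub>v v) = hcls N M l (fgen x) \<odot>\<^bsub>P\<^esub> f v))"

section \<open>The quotient category by negligible morphisms\<close>

text \<open>Objects are those of \<^const>\<open>Rep\<close>; the pivotal element is \<open>g\<^sub>1\<^sup>N\<close>.\<close>

definition qtr :: "nat \<Rightarrow> 'k::comm_ring_1 rep \<Rightarrow> 'k mat \<Rightarrow> 'k" where
  "qtr N U \<theta> = (let A = \<theta> * (ract U G1 ^\<^sub>m N) in \<Sum>i<rdim U. A $$ (i, i))"

definition negl :: "nat \<Rightarrow> 'k::comm_ring_1 rep \<Rightarrow> 'k rep \<Rightarrow> 'k mat set" where
  "negl N U V = {f \<in> rep_Hom U V. \<forall>g \<in> rep_Hom V U. qtr N V (f * g) = 0}"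

definition ucls :: "nat \<Rightarrow> 'k::comm_ring_1 rep \<Rightarrow> 'k rep \<Rightarrow> 'k mat \<Rightarrow> 'k mat set" where
  "ucls N U V f = {f' \<in> rep_Hom U V. f' - f \<in> negl N U V}"

definition uHom :: "nat \<Rightarrow> 'k::comm_ring_1 rep \<Rightarrow> 'k rep \<Rightarrow> 'k mat set set" where
  "uHom N U V = ucls N U V ` rep_Hom U V"

definition uid :: "nat \<Rightarrow> 'k::comm_ring_1 rep \<Rightarrow> 'k mat set" where
  "uid N U = ucls N U U (1\<^sub>m (rdim U))"

definition uzero :: "nat \<Rightarrow> 'k::comm_ring_1 rep \<Rightarrow> 'k rep \<Rightarrow> 'k mat set" where
  "uzero N U V = ucls N U V (0\<^sub>m (rdim V) (rdim U))"

text \<open>\<open>ucomp N U Z F G\<close> is the composite of \<open>F\<close>, with codomain \<open>Z\<close>, after \<open>G\<close>, with domain \<open>U\<close>.\<close>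

definition ucomp ::
  "nat \<Rightarrow> 'k::comm_ring_1 rep \<Rightarrow> 'k rep \<Rightarrow> 'k mat set \<Rightarrow> 'k mat set \<Rightarrow> 'k mat set" where
  "ucomp N U Z F G = (\<Union>f\<in>F. \<Union>g\<in>G. ucls N U Z (f * g))"

definition uis_iso :: "nat \<Rightarrow> 'k::comm_ring_1 rep \<Rightarrow> 'k rep \<Rightarrow> 'k mat set \<Rightarrow> bool" where
  "uis_iso N U V F \<longleftrightarrow> F \<in> uHom N U V \<and>
     (\<exists>G \<in> uHom N V U. ucomp N V V F G = uid N V \<and> ucomp N U U G F = uid N U)"

definition uiso ::
  "nat \<Rightarrow> nat \<Rightarrow> 'k::comm_ring_1 \<times> 'k \<times> 'k \<Rightarrow> 'k rep \<Rightarrow> 'k rep \<Rightarrow> bool" where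
  "uiso N M l U V \<longleftrightarrow> U \<in> Rep N M l \<and> V \<in> Rep N M l \<and> (\<exists>F. uis_iso N U V F)"

definition umono ::
  "nat \<Rightarrow> nat \<Rightarrow> 'k::comm_ring_1 \<times> 'k \<times> 'k \<Rightarrow> 'k rep \<Rightarrow> 'k rep \<Rightarrow> 'k mat set \<Rightarrow> bool" where
  "umono N M l U V F \<longleftrightarrow> F \<in> uHom N U V \<and>
     (\<forall>W \<in> Rep N M l. \<forall>G \<in> uHom N W U. \<forall>G' \<in> uHom N W U.
        ucomp N W V F G = ucomp N W V F G' \<longrightarrow> G = G')"

text \<open>A simple object is nonzero and has no subobjects other than zero and itself; an object is
  zero iff its identity is the zero morphism.\<close>

definition usimple ::
  "nat \<Rightarrow> nat \<Rightarrow> 'k::comm_ring_1 \<times> 'k \<times> 'k \<Rightarrow> 'k rep \<Rightarrow> bool" where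
  "usimple N M l U \<longleftrightarrow> U \<in> Rep N M l \<and> uid N U \<noteq> uzero N U U \<and>
     (\<forall>Z \<in> Rep N M l. \<forall>F. umono N M l Z U F \<longrightarrow> uid N Z = uzero N Z Z \<or> uis_iso N Z U F)"

end

theory Submission
  imports Defs "Jordan_Normal_Form.Determinant"
begin

text \<open>After rescaling a basis, each tensor product is the twist by \<open>\<chi>\<phi>\<close> of a module with integer
  matrices that does not depend on \<open>\<chi>\<close> and \<open>\<phi>\<close>.  The first eight of these are string modules
  on a path of nine vertices along which \<open>a\<^sub>1\<close> and \<open>a\<^sub>2\<close> alternate, the others split off a projective
  or two band modules, on which every quantum trace vanishes.  An endomorphism of a string module
  is a scalar plus a matrix of square zero and zero diagonal; hence it is invertible as soon as
  its quantum trace is nonzero, and idempotents are trivial.  This gives indecomposability,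
  simplicity modulo negligible morphisms (a non-negligible morphism into such a module has a
  section, so a monomorphism is an isomorphism), and excludes an isomorphism in the quotient with
  a module of smaller dimension.\<close>

section \<open>Modules as matrices satisfying the relations\<close>

text \<open>The obstacle is that the matrices involve an arbitrary field, the characters,
  \<open>N\<close>, \<open>M\<close> and the parameters, so nothing can be evaluated. If every type
  in a module is \<open>\<psi>\<close> up to signs and \<open>\<psi>\<close> lies in
  \<open>O1\<close>, then each \<open>g_i^2\<close> is scalar and all deformation terms vanish: what
  remains is \<open>a1^2 = a2^2 = 0\<close> and \<open>a1 a2 a1 a2 = - a2 a1 a2 a1\<close>, without
  parameters. As \<open>O1\<close> is closed under products, this covers the tensor products.
  Relations, base changes and vanishing patterns become finite integer computations; characteristic
  zero keeps nonzero integers nonzero in the field. Both letters anticommute with \<open>g1\<close>,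
  so its signs alternate along a path, and for odd \<open>N\<close> the signs of \<open>g1^N\<close>
  are the same. Nine vertices leave the sum 1 or -1; the eight of the projective and the four of a
  band leave 0. Hence strings survive in the quotient category and the other large summands
  disappear. The induced module is a quotient of a free abelian group whose size is not visible.
  Rewriting shows that eight monomials span it; their independence is read off from their action on
  an eight-dimensional model.\<close>

lemma ring_ring_of_type_algebra: "ring (ring_of_type_algebra :: 'a::ring_1 ring)"
proof -
  have "\<exists>y. x + y = 0" for x :: 'a
    by (rule exI[of _ "- x"]) simp
  moreover have "\<exists>y. y + x = 0 \<and> x + y = 0" for x :: 'a
    by (rule exI[of _ "- x"]) simp
  ultimately show ?thesis
    unfolding ring_of_type_algebra_def
    by unfold_locales (auto simp: algebra_simps Units_def)
qed

lemma ring_of_type_algebra_simps [simp]: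
  "carrier ring_of_type_algebra = UNIV"
  "x \<otimes>\<^bsub>ring_of_type_algebra\<^esub> y = x * y"
  "x \<oplus>\<^bsub>ring_of_type_algebra\<^esub> y = x + y"
  "\<one>\<^bsub>ring_of_type_algebra\<^esub> = 1"
  "\<zero>\<^bsub>ring_of_type_algebra\<^esub> = 0"
  by (simp_all add: ring_of_type_algebra_def)

lemma rel_ideal_ideal: "ideal (rel_ideal N M l) ring_of_type_algebra"
  unfolding rel_ideal_def by (rule ring.genideal_ideal[OF ring_ring_of_type_algebra]) simp

lemma relators_rel_ideal: "relators N M l \<subseteq> rel_ideal N M l"
  unfolding rel_ideal_def by (rule ring.genideal_self[OF ring_ring_of_type_algebra]) simp

text \<open>Negatives are products with \<open>- 1\<close>, so no separate closure under negation is
  assumed.\<close>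

lemma ideal_of_type:
  fixes I :: "'a::ring_1 set"
  assumes "0 \<in> I" "\<And>x y. x \<in> I \<Longrightarrow> y \<in> I \<Longrightarrow> x + y \<in> I"
    and "\<And>r x. x \<in> I \<Longrightarrow> r * x \<in> I" "\<And>r x. x \<in> I \<Longrightarrow> x * r \<in> I"
  shows "ideal I ring_of_type_algebra"
proof (rule idealI[OF ring_ring_of_type_algebra])
  have a: "abelian_group (ring_of_type_algebra :: 'a ring)"
    using ring_ring_of_type_algebra by (rule ring.is_abelian_group)
  then have g: "group (add_monoid (ring_of_type_algebra :: 'a ring))"
    by (rule abelian_group.a_group)
  have "- x \<in> I" if "x \<in> I" for x
    using assms(3)[OF that, of "- 1"] by simp
  moreover have "inv\<^bsub>add_monoid ring_of_type_algebra\<^esub> x = - x" for x :: 'a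
    by (rule group.inv_equality[OF g]) simp_all
  ultimately show "subgroup I (add_monoid ring_of_type_algebra)"
    by (intro group.subgroupI[OF g]) (use assms in auto)
qed (use assms in auto)

text \<open>Applied with \<open>I\<close> the kernel of an action, it reduces membership in
  \<open>Rep\<close> to the ten relators.\<close>

lemma rel_ideal_minimal:
  assumes "relators N M l \<subseteq> I" "0 \<in> I" "\<And>x y. x \<in> I \<Longrightarrow> y \<in> I \<Longrightarrow> x + y \<in> I"
    and "\<And>r x. x \<in> I \<Longrightarrow> r * x \<in> I" "\<And>r x. x \<in> I \<Longrightarrow> x * r \<in> I"
  shows "rel_ideal N M l \<subseteq> I"
  unfolding rel_ideal_def
  by (rule ring.genideal_minimal[OF ring_ring_of_type_algebra ideal_of_type]) (use assms in auto)

lemma H_alg_simps: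
  "carrier (H_alg N M l) = range (hcls N M l)"
  "hcls N M l f \<otimes>\<^bsub>H_alg N M l\<^esub> hcls N M l g = hcls N M l (f * g)"
  "hcls N M l f \<oplus>\<^bsub>H_alg N M l\<^esub> hcls N M l g = hcls N M l (f + g)"
  "\<one>\<^bsub>H_alg N M l\<^esub> = hcls N M l 1"
  using ideal.rcoset_mult_add[OF rel_ideal_ideal[of N M l], of f g]
    ideal.a_rcos_sum[OF rel_ideal_ideal[of N M l], of f g]
  by (auto simp: H_alg_def hcls_def FactRing_def A_RCOSETS_def RCOSETS_def a_r_coset_def)

lemma rel_ideal_closed:
  "0 \<in> rel_ideal N M l"
  "x \<in> rel_ideal N M l \<Longrightarrow> y \<in> rel_ideal N M l \<Longrightarrow> x + y \<in> rel_ideal N M l"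
  "x \<in> rel_ideal N M l \<Longrightarrow> r * x \<in> rel_ideal N M l"
  "x \<in> rel_ideal N M l \<Longrightarrow> x * r \<in> rel_ideal N M l"
proof -
  interpret ideal "rel_ideal N M l" ring_of_type_algebra by (rule rel_ideal_ideal)
  show "0 \<in> rel_ideal N M l" using additive_subgroup.zero_closed[OF is_additive_subgroup] by simp
  show "x \<in> rel_ideal N M l \<Longrightarrow> y \<in> rel_ideal N M l \<Longrightarrow> x + y \<in> rel_ideal N M l"
    using additive_subgroup.a_closed[OF is_additive_subgroup, of x y] by simp
  show "x \<in> rel_ideal N M l \<Longrightarrow> r * x \<in> rel_ideal N M l" using I_l_closed[of x r] by simp
  show "x \<in> rel_ideal N M l \<Longrightarrow> x * r \<in> rel_ideal N M l" using I_r_closed[of x r] by simp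
qed

lemma hcls_conv: "hcls N M l f = (\<lambda>i. i + f) ` rel_ideal N M l"
  by (auto simp: hcls_def a_r_coset_def r_coset_def)

lemma hcls_eq_iff: "hcls N M l f = hcls N M l g \<longleftrightarrow> f - g \<in> rel_ideal N M l"
proof
  assume e: "hcls N M l f = hcls N M l g"
  have "f \<in> hcls N M l f"
    unfolding hcls_conv by (rule image_eqI[of _ _ 0]) (simp_all add: rel_ideal_closed)
  then have "f \<in> hcls N M l g" by (simp only: e)
  then show "f - g \<in> rel_ideal N M l" by (auto simp: hcls_conv)
next
  have *: "hcls N M l f \<subseteq> hcls N M l g" if d: "f - g \<in> rel_ideal N M l" for f g :: "'a free_alg"
  proof
    fix x assume "x \<in> hcls N M l f"
    then obtain i where "i \<in> rel_ideal N M l" "x = i + f" by (auto simp: hcls_conv)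
    then have "x = (i + (f - g)) + g" "i + (f - g) \<in> rel_ideal N M l"
      using rel_ideal_closed(2)[OF _ d] by auto
    then show "x \<in> hcls N M l g" unfolding hcls_conv by blast
  qed
  assume d: "f - g \<in> rel_ideal N M l"
  then have "g - f \<in> rel_ideal N M l" using rel_ideal_closed(3)[of "f - g" N M l "- 1"] by simp
  with d show "hcls N M l f = hcls N M l g" using *[of f g] *[of g f] by auto
qed

section \<open>Action of the free algebra through words\<close>

definition wf_rep :: "'k::comm_ring_1 rep \<Rightarrow> bool" where
  "wf_rep U \<longleftrightarrow> (\<forall>x. ract U x \<in> carrier_mat (rdim U) (rdim U))"

lemma smult_one_mat [simp]: "1 \<cdot>\<^sub>m A = (A :: 'a::comm_ring_1 mat)"
  by (rule eq_matI) auto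

lemma smult_smult_times: "a \<cdot>\<^sub>m (b \<cdot>\<^sub>m A) = (a * b) \<cdot>\<^sub>m (A :: 'a::comm_ring_1 mat)"
  by (rule eq_matI) (auto simp: mult.assoc)

lemma wf_repD [simp]: "wf_rep U \<Longrightarrow> ract U x \<in> carrier_mat (rdim U) (rdim U)"
  by (simp add: wf_rep_def)

fun word_act :: "'k::comm_ring_1 rep \<Rightarrow> gen list \<Rightarrow> 'k mat" where
  "word_act U [] = 1\<^sub>m (rdim U)"
| "word_act U (x # xs) = ract U x * word_act U xs"

lemma word_act_carrier [simp]:
  "wf_rep U \<Longrightarrow> word_act U xs \<in> carrier_mat (rdim U) (rdim U)"
  by (induction xs) (auto intro: mult_carrier_mat[OF wf_repD])

lemma word_act_append:
  "wf_rep U \<Longrightarrow> word_act U (xs @ ys) = word_act U xs * word_act U ys"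
proof (induction xs)
  case Nil
  then show ?case by (simp add: left_mult_one_mat[OF word_act_carrier])
next
  case (Cons x xs)
  then show ?case
    by (simp add: assoc_mult_mat[OF wf_repD word_act_carrier word_act_carrier])
qed

text \<open>This is the algebra homomorphism extending the action of the generators. It is defined
  entrywise because matrices of unspecified size have no common zero over which to sum.\<close>

definition free_act :: "'k::comm_ring_1 rep \<Rightarrow> 'k free_alg \<Rightarrow> 'k mat" where
  "free_act U p = mat (rdim U) (rdim U) (\<lambda>(i, j).
     \<Sum>w\<in>Poly_Mapping.keys p. Poly_Mapping.lookup p w * word_act U (letters w) $$ (i, j))"

lemma free_act_carrier [simp]: "free_act U p \<in> carrier_mat (rdim U) (rdim U)"
  by (simp add: free_act_def)

text \<open>Allows elements with different supports to be compared over one finite set of words; the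
  support of a sum may be smaller than the union.\<close>

lemma free_act_superset:
  assumes "finite S" "Poly_Mapping.keys p \<subseteq> S" "i < rdim U" "j < rdim U"
  shows "free_act U p $$ (i, j) =
    (\<Sum>w\<in>S. Poly_Mapping.lookup p w * word_act U (letters w) $$ (i, j))"
proof -
  have "free_act U p $$ (i, j) =
    (\<Sum>w\<in>Poly_Mapping.keys p. Poly_Mapping.lookup p w * word_act U (letters w) $$ (i, j))"
    using assms by (simp add: free_act_def)
  also have "\<dots> = (\<Sum>w\<in>S. Poly_Mapping.lookup p w * word_act U (letters w) $$ (i, j))"
    by (rule sum.mono_neutral_left) (use assms in \<open>auto simp: in_keys_iff\<close>)
  finally show ?thesis .
qed

lemma free_act_add: "free_act U (p + q) = free_act U p + free_act U q"
proof (rule eq_matI)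
  fix i j assume "i < dim_row (free_act U p + free_act U q)"
    "j < dim_col (free_act U p + free_act U q)"
  then have ij: "i < rdim U" "j < rdim U" by (simp_all add: free_act_def)
  let ?S = "Poly_Mapping.keys p \<union> Poly_Mapping.keys q"
  have S: "finite ?S" by simp
  show "free_act U (p + q) $$ (i, j) = (free_act U p + free_act U q) $$ (i, j)"
    using ij free_act_superset[OF S _ ij, of p] free_act_superset[OF S _ ij, of q]
      free_act_superset[OF S _ ij, of "p + q"] Poly_Mapping.keys_add[of p q]
    by (simp add: free_act_def lookup_add algebra_simps sum.distrib)
qed (simp_all add: free_act_def)

lemma free_act_single:
  "wf_rep U \<Longrightarrow> free_act U (Poly_Mapping.single w c) = c \<cdot>\<^sub>m word_act U (letters w)"
proof (rule eq_matI)
  assume U: "wf_rep U"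
  fix i j assume "i < dim_row (c \<cdot>\<^sub>m word_act U (letters w))"
    "j < dim_col (c \<cdot>\<^sub>m word_act U (letters w))"
  then have ij: "i < rdim U" "j < rdim U"
    using word_act_carrier[OF U, of "letters w"] by (auto simp del: word_act_carrier)
  show "free_act U (Poly_Mapping.single w c) $$ (i, j) = (c \<cdot>\<^sub>m word_act U (letters w)) $$ (i, j)"
    using ij free_act_superset[of "{w}" "Poly_Mapping.single w c" i U j] word_act_carrier[OF U, of "letters w"]
    by (auto simp: free_act_def)
next
  assume "wf_rep U"
  then have "word_act U (letters w) \<in> carrier_mat (rdim U) (rdim U)" by simp
  then show "dim_row (free_act U (Poly_Mapping.single w c)) = dim_row (c \<cdot>\<^sub>m word_act U (letters w))"
    "dim_col (free_act U (Poly_Mapping.single w c)) = dim_col (c \<cdot>\<^sub>m word_act U (letters w))"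
    by (simp_all add: free_act_def)
qed

lemma free_act_0: "free_act U 0 = 0\<^sub>m (rdim U) (rdim U)"
  by (rule eq_matI) (auto simp: free_act_def)

lemma free_alg_induct [case_names single add]:
  fixes p :: "'k::comm_ring_1 free_alg"
  assumes "\<And>w c. P (Poly_Mapping.single w c)" "\<And>p q. P p \<Longrightarrow> P q \<Longrightarrow> P (p + q)"
  shows "P p"
proof (induction p rule: update_induct)
  case const
  show ?case using assms(1)[of 0 0] by simp
next
  case (update f a b)
  have "Poly_Mapping.update a b f = f + Poly_Mapping.single a b"
    using update(1)
    by (intro poly_mapping_eqI) (auto simp: lookup_update lookup_add lookup_single when_def in_keys_iff)
  then show ?case using assms update by simp
qed

lemma free_act_mult:
  assumes U: "wf_rep U"
  shows "free_act U (p * q) = free_act U p * free_act U q"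
proof (induction p rule: free_alg_induct)
  case (single w c)
  show ?case
  proof (induction q rule: free_alg_induct)
    case (single w' c')
    let ?A = "word_act U (letters w)" and ?B = "word_act U (letters w')"
    have A: "?A \<in> carrier_mat (rdim U) (rdim U)" and B: "?B \<in> carrier_mat (rdim U) (rdim U)"
      using U by simp_all
    have "letters (w + w') = letters w @ letters w'" by (simp add: plus_word_def)
    then have "free_act U (Poly_Mapping.single w c * Poly_Mapping.single w' c') = (c * c') \<cdot>\<^sub>m (?A * ?B)"
      by (simp add: mult_single free_act_single[OF U] word_act_append[OF U])
    also have "\<dots> = (c \<cdot>\<^sub>m ?A) * (c' \<cdot>\<^sub>m ?B)"
      using mult_smult_assoc_mat[OF A smult_carrier_mat[OF B], of c c'] mult_smult_distrib[OF A B, of c']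
      by (simp add: smult_smult_times)
    finally show ?case by (simp add: free_act_single[OF U])
  next
    case (add p q)
    then show ?case
      by (simp add: distrib_left free_act_add mult_add_distrib_mat[OF free_act_carrier free_act_carrier free_act_carrier])
  qed
next
  case (add p q)
  then show ?case
    by (simp add: distrib_right free_act_add add_mult_distrib_mat[OF free_act_carrier free_act_carrier free_act_carrier])
qed

lemma free_act_fscal: "wf_rep U \<Longrightarrow> free_act U (fscal c) = c \<cdot>\<^sub>m 1\<^sub>m (rdim U)"
  by (simp add: fscal_def free_act_single zero_word_def)

lemma free_act_1: "wf_rep U \<Longrightarrow> free_act U 1 = 1\<^sub>m (rdim U)"
  using free_act_fscal[of U 1] by (simp add: fscal_def)

lemma free_act_fgen: "wf_rep U \<Longrightarrow> free_act U (fgen x) = ract U x"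
  by (simp add: fgen_def free_act_single right_mult_one_mat[OF wf_repD])

lemma free_act_diff: "free_act U (p - q) = free_act U p - free_act U q"
proof -
  have e: "free_act U p = free_act U (p - q) + free_act U q"
    by (simp flip: free_act_add)
  show ?thesis
    unfolding e by (rule eq_matI) (auto simp: free_act_def)
qed

lemma free_act_power: "wf_rep U \<Longrightarrow> free_act U (p ^ k) = free_act U p ^\<^sub>m k"
proof (induction k)
  case 0
  then show ?case by (simp add: free_act_1 carrier_matD(1)[OF free_act_carrier])
next
  case (Suc k)
  then show ?case by (simp add: power_Suc2 free_act_mult del: power_Suc)
qed

lemma Rep_wf: "U \<in> Rep N M l \<Longrightarrow> wf_rep U"
  unfolding wf_rep_def
proof
  fix x assume "U \<in> Rep N M l"
  then obtain \<rho> where \<rho>: "\<rho> \<in> ring_hom (H_alg N M l) (ring_mat TYPE('a) (rdim U) ())"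
      "\<rho> (hcls N M l (fgen x)) = ract U x"
    by (auto simp: Rep_def)
  have "hcls N M l (fgen x) \<in> carrier (H_alg N M l)" by (simp add: H_alg_simps)
  from ring_hom_closed[OF \<rho>(1) this] show "ract U x \<in> carrier_mat (rdim U) (rdim U)"
    by (simp add: \<rho>(2) ring_mat_def)
qed

text \<open>A unital homomorphism on the quotient is determined on words by its values on scalars
  and generators, hence is induced by \<open>free_act\<close>; conversely \<open>free_act\<close>
  descends to classes once it kills the ideal.\<close>

theorem Rep_iff:
  "U \<in> Rep N M l \<longleftrightarrow> wf_rep U \<and> (\<forall>p \<in> rel_ideal N M l. free_act U p = 0\<^sub>m (rdim U) (rdim U))"
proof safe
  assume U: "U \<in> Rep N M l"
  then show w: "wf_rep U" by (rule Rep_wf)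
  obtain \<rho> where \<rho>: "\<rho> \<in> ring_hom (H_alg N M l) (ring_mat TYPE('a) (rdim U) ())"
      "\<And>c. \<rho> (hcls N M l (fscal c)) = c \<cdot>\<^sub>m 1\<^sub>m (rdim U)"
      "\<And>x. \<rho> (hcls N M l (fgen x)) = ract U x"
    using U by (auto simp: Rep_def)
  have m: "\<rho> (hcls N M l (p * q)) = \<rho> (hcls N M l p) * \<rho> (hcls N M l q)" for p q
    using ring_hom_mult[OF \<rho>(1), of "hcls N M l p" "hcls N M l q"]
    by (simp add: H_alg_simps ring_mat_def)
  have a: "\<rho> (hcls N M l (p + q)) = \<rho> (hcls N M l p) + \<rho> (hcls N M l q)" for p q
    using ring_hom_add[OF \<rho>(1), of "hcls N M l p" "hcls N M l q"]
    by (simp add: H_alg_simps ring_mat_def)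
  have eq: "\<rho> (hcls N M l p) = free_act U p" for p
  proof (induction p rule: free_alg_induct)
    case (single v c)
    have "\<rho> (hcls N M l (Poly_Mapping.single (Word xs) 1)) = word_act U xs" for xs
    proof (induction xs)
      case Nil
      then show ?case using \<rho>(2)[of 1] by (simp add: fscal_def zero_word_def)
    next
      case (Cons x xs)
      have "Poly_Mapping.single (Word (x # xs)) (1::'a) = fgen x * Poly_Mapping.single (Word xs) 1"
        by (simp add: fgen_def mult_single plus_word_def)
      then show ?case using Cons \<rho>(3) by (simp add: m)
    qed
    moreover have "Poly_Mapping.single v c = fscal c * Poly_Mapping.single (Word (letters v)) 1"
      by (simp add: fscal_def mult_single)
    ultimately have "\<rho> (hcls N M l (Poly_Mapping.single v c)) = (c \<cdot>\<^sub>m 1\<^sub>m (rdim U)) * word_act U (letters v)"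
      by (metis m \<rho>(2))
    also have "\<dots> = c \<cdot>\<^sub>m word_act U (letters v)"
      using word_act_carrier[OF w, of "letters v"]
      by (simp add: mult_smult_assoc_mat[of _ "rdim U" "rdim U"])
    finally show ?case by (simp add: free_act_single[OF w])
  qed (simp add: a free_act_add)
  fix p assume "p \<in> rel_ideal N M l"
  then have "hcls N M l p = hcls N M l 0" by (simp add: hcls_eq_iff)
  then show "free_act U p = 0\<^sub>m (rdim U) (rdim U)" by (metis eq free_act_0)
next
  assume w: "wf_rep U" and z: "\<forall>p \<in> rel_ideal N M l. free_act U p = 0\<^sub>m (rdim U) (rdim U)"
  \<comment> \<open>Any representative of the class will do: two of them differ by an element of the
    ideal, on which \<open>free_act\<close> vanishes.\<close>
  define \<rho> where "\<rho> h = free_act U (SOME p. hcls N M l p = h)" for h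
  have \<rho>: "\<rho> (hcls N M l p) = free_act U p" for p
  proof -
    have "hcls N M l (SOME q. hcls N M l q = hcls N M l p) = hcls N M l p" by (rule someI) simp
    then have "(SOME q. hcls N M l q = hcls N M l p) - p \<in> rel_ideal N M l" by (simp add: hcls_eq_iff)
    then have 0: "free_act U (SOME q. hcls N M l q = hcls N M l p) - free_act U p = 0\<^sub>m (rdim U) (rdim U)"
      using z by (simp flip: free_act_diff)
    show ?thesis unfolding \<rho>_def
    proof (rule eq_matI)
      fix i j assume "i < dim_row (free_act U p)" "j < dim_col (free_act U p)"
      then show "free_act U (SOME q. hcls N M l q = hcls N M l p) $$ (i, j) = free_act U p $$ (i, j)"
        using arg_cong[OF 0, of "\<lambda>A. A $$ (i, j)"] by (simp add: free_act_def)
    qed (simp_all add: free_act_def)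
  qed
  have "\<rho> \<in> ring_hom (H_alg N M l) (ring_mat TYPE('a) (rdim U) ())"
    by (rule ring_hom_memI)
      (auto simp: H_alg_simps \<rho> ring_mat_def free_act_mult[OF w] free_act_add free_act_1[OF w])
  then show "U \<in> Rep N M l"
    unfolding Rep_def using \<rho> free_act_fscal[OF w] free_act_fgen[OF w]
    by (intro CollectI bexI[of _ \<rho>]) simp_all
qed

section \<open>Homomorphisms and isomorphisms\<close>

lemma rep_Hom_carrier: "f \<in> rep_Hom U V \<Longrightarrow> f \<in> carrier_mat (rdim V) (rdim U)"
  by (simp add: rep_Hom_def)

lemma rep_Hom_commute: "f \<in> rep_Hom U V \<Longrightarrow> f * ract U x = ract V x * f"
  by (simp add: rep_Hom_def)

lemma rep_HomI:
  "f \<in> carrier_mat (rdim V) (rdim U) \<Longrightarrow> (\<And>x. f * ract U x = ract V x * f) \<Longrightarrow> f \<in> rep_Hom U V"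
  by (simp add: rep_Hom_def)

lemma rep_Hom_mult:
  assumes wf: "wf_rep U" "wf_rep V" "wf_rep W" and f: "f \<in> rep_Hom V W" and g: "g \<in> rep_Hom U V"
  shows "f * g \<in> rep_Hom U W"
proof (rule rep_HomI)
  note fc = rep_Hom_carrier[OF f] and gc = rep_Hom_carrier[OF g]
  show "f * g \<in> carrier_mat (rdim W) (rdim U)" using fc gc by simp
  fix x
  have "f * g * ract U x = f * (g * ract U x)" by (rule assoc_mult_mat[OF fc gc wf_repD[OF wf(1)]])
  also have "\<dots> = (f * ract V x) * g"
    by (simp add: rep_Hom_commute[OF g] assoc_mult_mat[OF fc wf_repD[OF wf(2)] gc])
  also have "\<dots> = ract W x * (f * g)"
    by (simp add: rep_Hom_commute[OF f] assoc_mult_mat[OF wf_repD[OF wf(3)] fc gc])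
  finally show "f * g * ract U x = ract W x * (f * g)" .
qed

lemma rep_Hom_one: "wf_rep U \<Longrightarrow> 1\<^sub>m (rdim U) \<in> rep_Hom U U"
  by (rule rep_HomI) (auto simp: left_mult_one_mat[OF wf_repD] right_mult_one_mat[OF wf_repD])

lemma rep_Hom_zero: "wf_rep U \<Longrightarrow> wf_rep V \<Longrightarrow> 0\<^sub>m (rdim V) (rdim U) \<in> rep_Hom U V"
  by (rule rep_HomI) (auto simp: left_mult_zero_mat[OF wf_repD] right_mult_zero_mat[OF wf_repD])

lemma rep_Hom_diff:
  assumes "wf_rep U" "wf_rep V" "f \<in> rep_Hom U V" "g \<in> rep_Hom U V"
  shows "f - g \<in> rep_Hom U V"
proof (rule rep_HomI)
  note fc = rep_Hom_carrier[OF assms(3)] and gc = rep_Hom_carrier[OF assms(4)]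
  show "f - g \<in> carrier_mat (rdim V) (rdim U)" using fc gc by (intro minus_carrier_mat)
  show "(f - g) * ract U x = ract V x * (f - g)" for x
    using minus_mult_distrib_mat[OF fc gc wf_repD[OF assms(1)]]
      mult_minus_distrib_mat[OF wf_repD[OF assms(2)] fc gc]
    by (simp add: rep_Hom_commute[OF assms(3)] rep_Hom_commute[OF assms(4)])
qed

text \<open>With \<open>x\<close> acting on either side,
  \<open>g x = g x f g = g f x g = x g\<close>.\<close>

lemma inverse_rep_Hom:
  assumes wf: "wf_rep U" "wf_rep V" and f: "f \<in> rep_Hom U V"
    and g: "g \<in> carrier_mat (rdim U) (rdim V)"
    and fg: "f * g = 1\<^sub>m (rdim V)" and gf: "g * f = 1\<^sub>m (rdim U)"
  shows "g \<in> rep_Hom V U"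
proof (rule rep_HomI[OF g])
  fix x
  note fc = rep_Hom_carrier[OF f]
  note U = wf_repD[OF wf(1), of x] and V = wf_repD[OF wf(2), of x]
  have "g * ract V x = g * ract V x * (f * g)" using g V by (simp add: fg)
  also have "\<dots> = g * (ract V x * (f * g))" using g V fc by (intro assoc_mult_mat) auto
  also have "ract V x * (f * g) = (f * ract U x) * g"
    using assoc_mult_mat[OF V fc g] by (simp add: rep_Hom_commute[OF f])
  also have "\<dots> = f * (ract U x * g)" using g U fc by (intro assoc_mult_mat) auto
  also have "g * (f * (ract U x * g)) = (g * f) * (ract U x * g)"
    using g U fc by (intro assoc_mult_mat[symmetric]) auto
  also have "\<dots> = ract U x * g" using g U by (simp add: gf)
  finally show "g * ract V x = ract U x * g" .
qed

text \<open>Isomorphism without membership in \<open>Rep\<close>. By \<open>mat_iso_Rep\<close> the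
  relations pass along such an isomorphism, so they are verified on the model only.\<close>

definition mat_iso :: "'k::comm_ring_1 rep \<Rightarrow> 'k rep \<Rightarrow> bool" where
  "mat_iso U V \<longleftrightarrow> wf_rep U \<and> wf_rep V \<and>
     (\<exists>F \<in> rep_Hom U V. \<exists>G \<in> rep_Hom V U. F * G = 1\<^sub>m (rdim V) \<and> G * F = 1\<^sub>m (rdim U))"

lemma mat_iso_sym: "mat_iso U V \<Longrightarrow> mat_iso V U"
  by (auto simp: mat_iso_def)

lemma mult_inverse_cancel:
  assumes "F \<in> carrier_mat n m" "G \<in> carrier_mat m n" "F' \<in> carrier_mat p n" "G' \<in> carrier_mat n p"
    and "F * G = 1\<^sub>m n" "F' * G' = (1\<^sub>m p :: 'k::comm_ring_1 mat)"
  shows "(F' * F) * (G * G') = 1\<^sub>m p"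
proof -
  have "(F' * F) * (G * G') = F' * (F * (G * G'))"
    using assms by (intro assoc_mult_mat) auto
  also have "F * (G * G') = (F * G) * G'" using assms by (intro assoc_mult_mat[symmetric]) auto
  also have "F' * ((F * G) * G') = 1\<^sub>m p" using assms by simp
  finally show ?thesis .
qed

lemma mat_iso_trans:
  assumes "mat_iso U V" "mat_iso V W"
  shows "mat_iso U W"
proof -
  obtain F G F' G' where w: "wf_rep U" "wf_rep V" "wf_rep W"
    and F: "F \<in> rep_Hom U V" and G: "G \<in> rep_Hom V U" "F * G = 1\<^sub>m (rdim V)" "G * F = 1\<^sub>m (rdim U)"
    and F': "F' \<in> rep_Hom V W" and G': "G' \<in> rep_Hom W V" "F' * G' = 1\<^sub>m (rdim W)" "G' * F' = 1\<^sub>m (rdim V)"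
    using assms unfolding mat_iso_def by metis
  note c = rep_Hom_carrier[OF F] rep_Hom_carrier[OF G(1)] rep_Hom_carrier[OF F'] rep_Hom_carrier[OF G'(1)]
  have "(F' * F) * (G * G') = 1\<^sub>m (rdim W)"
    using mult_inverse_cancel[OF c(1,2,3,4)] G G' by simp
  moreover have "(G * G') * (F' * F) = 1\<^sub>m (rdim U)"
    using mult_inverse_cancel[OF c(4,3,2,1)] G G' by simp
  ultimately show ?thesis
    unfolding mat_iso_def using w F G F' G' by (meson rep_Hom_mult)
qed

text \<open>Over a field a one-sided inverse of a square matrix is two-sided, so a single product
  has to be computed.\<close>

lemma mat_isoI:
  fixes F :: "'k::field mat"
  assumes "wf_rep U" "wf_rep V" "rdim U = rdim V" "F \<in> rep_Hom U V"
    and "G \<in> carrier_mat (rdim U) (rdim V)" "F * G = 1\<^sub>m (rdim V)"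
  shows "mat_iso U V"
proof -
  have "G * F = 1\<^sub>m (rdim U)"
    using mat_mult_left_right_inverse[OF _ _ assms(6)] assms(3,5) rep_Hom_carrier[OF assms(4)] by simp
  then show ?thesis
    unfolding mat_iso_def using assms inverse_rep_Hom by blast
qed

lemma free_act_conj:
  assumes U: "wf_rep U" and V: "wf_rep V" and F: "F \<in> rep_Hom U V"
  shows "F * free_act U p = free_act V p * F"
proof (induction p rule: free_alg_induct)
  case (single w c)
  note Fc = rep_Hom_carrier[OF F]
  have "F * word_act U xs = word_act V xs * F" for xs
  proof (induction xs)
    case Nil
    then show ?case using Fc by simp
  next
    case (Cons x xs)
    have "F * word_act U (x # xs) = (F * ract U x) * word_act U xs"
      using assoc_mult_mat[OF Fc wf_repD[OF U] word_act_carrier[OF U]] by simp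
    also have "\<dots> = ract V x * (F * word_act U xs)"
      using assoc_mult_mat[OF wf_repD[OF V] Fc word_act_carrier[OF U]]
      by (simp add: rep_Hom_commute[OF F])
    also have "\<dots> = word_act V (x # xs) * F"
      using assoc_mult_mat[OF wf_repD[OF V] word_act_carrier[OF V] Fc] Cons by simp
    finally show ?case .
  qed
  then show ?case
    using mult_smult_distrib[OF Fc word_act_carrier[OF U]] mult_smult_assoc_mat[OF word_act_carrier[OF V] Fc]
    by (simp add: free_act_single U V)
next
  case (add p q)
  note Fc = rep_Hom_carrier[OF F]
  show ?case
    using add mult_add_distrib_mat[OF Fc free_act_carrier free_act_carrier]
      add_mult_distrib_mat[OF free_act_carrier free_act_carrier Fc]
    by (simp add: free_act_add)
qed

lemma mat_iso_Rep:
  assumes "mat_iso U V" "U \<in> Rep N M l"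
  shows "V \<in> Rep N M l"
proof -
  obtain F G where w: "wf_rep U" "wf_rep V"
    and F: "F \<in> rep_Hom U V" and G: "G \<in> rep_Hom V U" "F * G = 1\<^sub>m (rdim V)" "G * F = 1\<^sub>m (rdim U)"
    using assms unfolding mat_iso_def by metis
  note c = rep_Hom_carrier[OF F] rep_Hom_carrier[OF G(1)]
  have "free_act V p = 0\<^sub>m (rdim V) (rdim V)" if "p \<in> rel_ideal N M l" for p
  proof -
    have "free_act V p = free_act V p * (F * G)" by (simp add: G(2) right_mult_one_mat[OF free_act_carrier])
    also have "\<dots> = (F * free_act U p) * G"
      by (simp add: free_act_conj[OF w F] assoc_mult_mat[OF free_act_carrier c])
    also have "free_act U p = 0\<^sub>m (rdim U) (rdim U)" using assms(2) that by (simp add: Rep_iff)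
    also have "(F * 0\<^sub>m (rdim U) (rdim U)) * G = 0\<^sub>m (rdim V) (rdim V)" using c by simp
    finally show ?thesis .
  qed
  then show ?thesis using w by (simp add: Rep_iff)
qed

lemma rep_iso_iff: "rep_iso N M l U V \<longleftrightarrow> U \<in> Rep N M l \<and> mat_iso U V"
  using mat_iso_Rep[of U V N M l] Rep_wf[of U N M l] Rep_wf[of V N M l]
  unfolding rep_iso_def by (auto simp: mat_iso_def)

section \<open>Direct sums\<close>

definition sum_inl :: "nat \<Rightarrow> nat \<Rightarrow> 'k::comm_ring_1 mat" where
  "sum_inl n m = mat (n + m) n (\<lambda>(i, j). if i = j then 1 else 0)"
definition sum_inr :: "nat \<Rightarrow> nat \<Rightarrow> 'k::comm_ring_1 mat" where
  "sum_inr n m = mat (n + m) m (\<lambda>(i, j). if i = n + j then 1 else 0)"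
definition sum_prl :: "nat \<Rightarrow> nat \<Rightarrow> 'k::comm_ring_1 mat" where
  "sum_prl n m = mat n (n + m) (\<lambda>(i, j). if i = j then 1 else 0)"
definition sum_prr :: "nat \<Rightarrow> nat \<Rightarrow> 'k::comm_ring_1 mat" where
  "sum_prr n m = mat m (n + m) (\<lambda>(i, j). if j = n + i then 1 else 0)"

lemma wf_rep_sum: "wf_rep U \<Longrightarrow> wf_rep V \<Longrightarrow> wf_rep (rep_sum U V)"
  by (auto simp: wf_rep_def rep_sum_def)

lemma rdim_rep_sum [simp]: "rdim (rep_sum U V) = rdim U + rdim V"
  by (simp add: rep_sum_def)

lemma sum_dims [simp]:
  "dim_row (sum_inl n m) = n + m" "dim_col (sum_inl n m) = n"
  "dim_row (sum_inr n m) = n + m" "dim_col (sum_inr n m) = m"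
  "dim_row (sum_prl n m) = n" "dim_col (sum_prl n m) = n + m"
  "dim_row (sum_prr n m) = m" "dim_col (sum_prr n m) = n + m"
  by (simp_all add: sum_inl_def sum_inr_def sum_prl_def sum_prr_def)

lemma sum_if_shift:
  fixes f :: "nat \<Rightarrow> 'a::comm_monoid_add"
  shows "(\<Sum>k = 0..<p. if i = n + k then f k else 0) = (if n \<le> i \<and> i < n + p then f (i - n) else 0)"
proof -
  have "(\<Sum>k = 0..<p. if i = n + k then f k else 0) =
    (\<Sum>k = 0..<p. if k = i - n then (if n \<le> i then f k else 0) else 0)"
    by (rule sum.cong) auto
  also have "\<dots> = (if n \<le> i \<and> i < n + p then f (i - n) else 0)"
    by (subst sum.delta) auto
  finally show ?thesis .
qed

lemma sum_if_less:
  fixes f :: "nat \<Rightarrow> 'a::comm_monoid_add"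
  shows "(\<Sum>k = 0..<p. if k < n then if i = k then f k else 0 else 0) = (if i < n \<and> i < p then f i else 0)"
proof -
  have "(\<Sum>k = 0..<p. if k < n then if i = k then f k else 0 else 0) =
    (\<Sum>k = 0..<p. if k = i then (if i < n then f i else 0) else 0)"
    by (rule sum.cong) auto
  then show ?thesis by (simp add: sum.delta)
qed

lemma sum_if_ge:
  fixes c :: "'a::comm_monoid_add" and n p i :: nat
  shows "(\<Sum>k = 0..<p. if k < n then 0 else if k = n + i then c else 0) = (if n + i < p then c else 0)"
proof -
  have "(\<Sum>k = 0..<p. if k < n then 0 else if k = n + i then c else 0) =
    (\<Sum>k = 0..<p. if k = n + i then c else 0)"
    by (rule sum.cong) auto
  then show ?thesis by (simp add: sum.delta)
qed

lemma sum_maps_Hom: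
  assumes "wf_rep U" "wf_rep V"
  shows "sum_inl (rdim U) (rdim V) \<in> rep_Hom U (rep_sum U V)"
    and "sum_inr (rdim U) (rdim V) \<in> rep_Hom V (rep_sum U V)"
    and "sum_prl (rdim U) (rdim V) \<in> rep_Hom (rep_sum U V) U"
    and "sum_prr (rdim U) (rdim V) \<in> rep_Hom (rep_sum U V) V"
proof -
  have c: "dim_row (ract U x) = rdim U" "dim_col (ract U x) = rdim U"
      "dim_row (ract V x) = rdim V" "dim_col (ract V x) = rdim V" for x
    using wf_repD[OF assms(1), of x] wf_repD[OF assms(2), of x] by auto
  show "sum_inl (rdim U) (rdim V) \<in> rep_Hom U (rep_sum U V)"
    by (rule rep_HomI, force,  rule eq_matI)
      (auto simp: sum_inl_def rep_sum_def c scalar_prod_def if_distrib[of "\<lambda>x. x * _"] if_distrib[of "\<lambda>x. _ * x"] cong: if_cong)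
  show "sum_inr (rdim U) (rdim V) \<in> rep_Hom V (rep_sum U V)"
    by (rule rep_HomI, force,  rule eq_matI)
      (auto simp: sum_inr_def rep_sum_def c scalar_prod_def if_distrib[of "\<lambda>x. x * _"] if_distrib[of "\<lambda>x. _ * x"] sum_if_shift cong: if_cong)
  show "sum_prl (rdim U) (rdim V) \<in> rep_Hom (rep_sum U V) U"
    by (rule rep_HomI, force,  rule eq_matI)
      (auto simp: sum_prl_def rep_sum_def c scalar_prod_def if_distrib[of "\<lambda>x. x * _"] if_distrib[of "\<lambda>x. _ * x"] sum_if_less cong: if_cong)
  show "sum_prr (rdim U) (rdim V) \<in> rep_Hom (rep_sum U V) V"
    by (rule rep_HomI, force,  rule eq_matI)
      (auto simp: sum_prr_def rep_sum_def c scalar_prod_def if_distrib[of "\<lambda>x. x * _"] if_distrib[of "\<lambda>x. _ * x"] sum_if_shift sum_if_ge cong: if_cong)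
qed

lemma sum_pr_in:
  "sum_prl n m * sum_inl n m = 1\<^sub>m n" "sum_prr n m * sum_inr n m = 1\<^sub>m m"
  by (rule eq_matI; auto simp: sum_inl_def sum_prl_def sum_inr_def sum_prr_def scalar_prod_def
    if_distrib[of "\<lambda>x. x * _"] if_distrib[of "\<lambda>x. _ * x"] cong: if_cong)+

lemma sum_in_pr:
  "sum_inl n m * sum_prl n m = mat (n + m) (n + m) (\<lambda>(i, j). if i = j \<and> i < n then 1 else 0)"
  "sum_inr n m * sum_prr n m = mat (n + m) (n + m) (\<lambda>(i, j). if i = j \<and> n \<le> i then 1 else 0)"
  by (rule eq_matI; auto simp: sum_inl_def sum_prl_def sum_inr_def sum_prr_def scalar_prod_def sum_if_shift
    if_distrib[of "\<lambda>x. x * _"] if_distrib[of "\<lambda>x. _ * x"] cong: if_cong)+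

lemma sum_in_pr_one:
  "sum_inl n m * sum_prl n m + sum_inr n m * sum_prr n m = 1\<^sub>m (n + m)"
  by (rule eq_matI) (auto simp: sum_in_pr)

section \<open>The quantum trace\<close>

lemma trace_comm:
  fixes A B :: "'k::comm_ring_1 mat"
  assumes "A \<in> carrier_mat n m" "B \<in> carrier_mat m n"
  shows "(\<Sum>i<n. (A * B) $$ (i, i)) = (\<Sum>j<m. (B * A) $$ (j, j))"
proof -
  have "(\<Sum>i<n. (A * B) $$ (i, i)) = (\<Sum>i<n. \<Sum>j<m. A $$ (i, j) * B $$ (j, i))"
    using assms by (intro sum.cong) (auto simp: scalar_prod_def lessThan_atLeast0)
  also have "\<dots> = (\<Sum>j<m. \<Sum>i<n. B $$ (j, i) * A $$ (i, j))"
    by (subst sum.swap) (simp add: mult.commute)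
  also have "\<dots> = (\<Sum>j<m. (B * A) $$ (j, j))"
    using assms by (intro sum.cong) (auto simp: scalar_prod_def lessThan_atLeast0)
  finally show ?thesis .
qed

lemma rep_Hom_commute_pow:
  assumes "wf_rep U" "wf_rep V" "f \<in> rep_Hom U V"
  shows "f * (ract U x ^\<^sub>m k) = (ract V x ^\<^sub>m k) * f"
proof (induction k)
  case 0
  then show ?case
    using rep_Hom_carrier[OF assms(3)] wf_repD[OF assms(1), of x] wf_repD[OF assms(2), of x] by simp
next
  case (Suc k)
  note c = rep_Hom_carrier[OF assms(3)]
  have p: "ract U x ^\<^sub>m k \<in> carrier_mat (rdim U) (rdim U)" "ract V x ^\<^sub>m k \<in> carrier_mat (rdim V) (rdim V)"
    using assms by (simp_all add: pow_carrier_mat)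
  have "f * (ract U x ^\<^sub>m Suc k) = (ract V x ^\<^sub>m k * f) * ract U x"
    using assoc_mult_mat[OF c p(1) wf_repD[OF assms(1)], of x] Suc by simp
  also have "\<dots> = ract V x ^\<^sub>m k * (ract V x * f)"
    using assoc_mult_mat[OF p(2) c wf_repD[OF assms(1)], of x] by (simp add: rep_Hom_commute[OF assms(3)])
  also have "\<dots> = (ract V x ^\<^sub>m Suc k) * f"
    using assoc_mult_mat[OF p(2) wf_repD[OF assms(2)] c] by simp
  finally show ?case .
qed

lemma qtr_conv: "qtr N U \<theta> = (\<Sum>i<rdim U. (\<theta> * (ract U G1 ^\<^sub>m N)) $$ (i, i))"
  by (simp add: qtr_def Let_def)

text \<open>The matrices of \<open>g1^N\<close> are intertwined by \<open>f\<close>, so the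
  cyclicity of the ordinary trace carries over.\<close>

lemma qtr_comm:
  assumes w: "wf_rep U" "wf_rep V" and f: "f \<in> rep_Hom U V" and g: "g \<in> rep_Hom V U"
  shows "qtr N V (f * g) = qtr N U (g * f)"
proof -
  note fc = rep_Hom_carrier[OF f] and gc = rep_Hom_carrier[OF g]
  have p: "ract U G1 ^\<^sub>m N \<in> carrier_mat (rdim U) (rdim U)" "ract V G1 ^\<^sub>m N \<in> carrier_mat (rdim V) (rdim V)"
    using w by (simp_all add: pow_carrier_mat)
  have "qtr N V (f * g) = (\<Sum>i<rdim V. (f * (g * (ract V G1 ^\<^sub>m N))) $$ (i, i))"
    by (simp add: qtr_conv assoc_mult_mat[OF fc gc p(2)])
  also have "\<dots> = (\<Sum>i<rdim U. ((g * (ract V G1 ^\<^sub>m N)) * f) $$ (i, i))"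
    using p gc by (intro trace_comm[OF fc]) auto
  also have "(g * (ract V G1 ^\<^sub>m N)) * f = (g * f) * (ract U G1 ^\<^sub>m N)"
    by (simp add: assoc_mult_mat[OF gc p(2) fc] assoc_mult_mat[OF gc fc p(1)] rep_Hom_commute_pow[OF w f])
  finally show ?thesis by (simp add: qtr_conv)
qed

lemma qtr_add:
  assumes "wf_rep U" "f \<in> carrier_mat (rdim U) (rdim U)" "g \<in> carrier_mat (rdim U) (rdim U)"
  shows "qtr N U (f + g) = qtr N U f + qtr N U g"
proof -
  have p: "ract U G1 ^\<^sub>m N \<in> carrier_mat (rdim U) (rdim U)" using assms by (simp add: pow_carrier_mat)
  show ?thesis
    using add_mult_distrib_mat[OF assms(2,3) p] p assms(2,3)
    unfolding qtr_conv sum.distrib[symmetric] by (intro sum.cong) auto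
qed

lemma qtr_diff:
  assumes "wf_rep U" "f \<in> carrier_mat (rdim U) (rdim U)" "g \<in> carrier_mat (rdim U) (rdim U)"
  shows "qtr N U (f - g) = qtr N U f - qtr N U g"
proof -
  have p: "ract U G1 ^\<^sub>m N \<in> carrier_mat (rdim U) (rdim U)" using assms by (simp add: pow_carrier_mat)
  show ?thesis
    using minus_mult_distrib_mat[OF assms(2,3) p] p assms(2,3)
    unfolding qtr_conv sum_subtractf[symmetric] by (intro sum.cong) auto
qed

lemma qtr_zero: "wf_rep U \<Longrightarrow> qtr N U (0\<^sub>m (rdim U) (rdim U)) = 0"
  using left_mult_zero_mat[OF pow_carrier_mat[OF wf_repD], of U "rdim U" G1 N]
  by (simp add: qtr_conv)

section \<open>The quotient by negligible morphisms\<close>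

lemma neglD: "f \<in> negl N U V \<Longrightarrow> f \<in> rep_Hom U V" "f \<in> negl N U V \<Longrightarrow> g \<in> rep_Hom V U \<Longrightarrow> qtr N V (f * g) = 0"
  by (simp_all add: negl_def)

lemma neglI: "f \<in> rep_Hom U V \<Longrightarrow> (\<And>g. g \<in> rep_Hom V U \<Longrightarrow> qtr N V (f * g) = 0) \<Longrightarrow> f \<in> negl N U V"
  by (simp add: negl_def)

lemma negl_zero: "wf_rep U \<Longrightarrow> wf_rep V \<Longrightarrow> 0\<^sub>m (rdim V) (rdim U) \<in> negl N U V"
  by (rule neglI) (auto simp: rep_Hom_zero left_mult_zero_mat[OF rep_Hom_carrier] qtr_zero)

lemma negl_diff:
  assumes "wf_rep U" "wf_rep V" "f \<in> negl N U V" "g \<in> negl N U V"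
  shows "f - g \<in> negl N U V"
proof (rule neglI)
  note F = neglD(1)[OF assms(3)] and G = neglD(1)[OF assms(4)]
  show "f - g \<in> rep_Hom U V" using rep_Hom_diff[OF assms(1,2) F G] .
  fix h assume h: "h \<in> rep_Hom V U"
  have "f * h \<in> rep_Hom V V" "g * h \<in> rep_Hom V V" using assms F G h by (auto intro: rep_Hom_mult)
  then have "qtr N V (f * h - g * h) = 0"
    using qtr_diff[OF assms(2)] rep_Hom_carrier neglD(2)[OF assms(3) h] neglD(2)[OF assms(4) h]
    by (metis diff_zero)
  then show "qtr N V ((f - g) * h) = 0"
    using minus_mult_distrib_mat[OF rep_Hom_carrier[OF F] rep_Hom_carrier[OF G] rep_Hom_carrier[OF h]] by simp
qed

lemma negl_add:
  assumes "wf_rep U" "wf_rep V" "f \<in> negl N U V" "g \<in> negl N U V"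
  shows "f + g \<in> negl N U V"
proof -
  have "f - (0\<^sub>m (rdim V) (rdim U) - g) = f + g"
    using rep_Hom_carrier[OF neglD(1)[OF assms(3)]] rep_Hom_carrier[OF neglD(1)[OF assms(4)]]
    by (auto intro!: eq_matI)
  then show ?thesis
    using negl_diff[OF assms(1-3) negl_diff[OF assms(1,2) negl_zero[OF assms(1,2)] assms(4)]] by simp
qed

text \<open>Cyclicity moves \<open>h\<close> to the other end of the test product. Together with
  composition on the right this makes negligible morphisms a two-sided ideal.\<close>

lemma negl_mult_left:
  assumes "wf_rep U" "wf_rep V" "wf_rep W" "f \<in> negl N U V" "h \<in> rep_Hom V W"
  shows "h * f \<in> negl N U W"
proof (rule neglI)
  note F = neglD(1)[OF assms(4)]
  show "h * f \<in> rep_Hom U W" using rep_Hom_mult[OF assms(1-3) assms(5) F] .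
  fix g assume g: "g \<in> rep_Hom W U"
  have fg: "f * g \<in> rep_Hom W V" using rep_Hom_mult[OF assms(3,1,2) F g] .
  have gh: "g * h \<in> rep_Hom V U" using rep_Hom_mult[OF assms(2,3,1) g assms(5)] .
  have "qtr N W (h * f * g) = qtr N V (f * g * h)"
    using qtr_comm[OF assms(2,3,5) fg] assoc_mult_mat[OF rep_Hom_carrier[OF assms(5)] rep_Hom_carrier[OF F] rep_Hom_carrier[OF g]]
    by simp
  also have "\<dots> = 0"
    using neglD(2)[OF assms(4) gh] assoc_mult_mat[OF rep_Hom_carrier[OF F] rep_Hom_carrier[OF g] rep_Hom_carrier[OF assms(5)]]
    by simp
  finally show "qtr N W (h * f * g) = 0" .
qed

lemma negl_mult_right:
  assumes "wf_rep U" "wf_rep V" "wf_rep W" "f \<in> negl N V W" "h \<in> rep_Hom U V"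
  shows "f * h \<in> negl N U W"
proof (rule neglI)
  note F = neglD(1)[OF assms(4)]
  show "f * h \<in> rep_Hom U W" using rep_Hom_mult[OF assms(1-3) F assms(5)] .
  fix g assume g: "g \<in> rep_Hom W U"
  have hg: "h * g \<in> rep_Hom W V" using rep_Hom_mult[OF assms(3,1,2) assms(5) g] .
  show "qtr N W (f * h * g) = 0"
    using neglD(2)[OF assms(4) hg] assoc_mult_mat[OF rep_Hom_carrier[OF F] rep_Hom_carrier[OF assms(5)] rep_Hom_carrier[OF g]]
    by simp
qed

lemma minus_zero_mat: "(f :: 'k::comm_ring_1 mat) \<in> carrier_mat n m \<Longrightarrow> f - 0\<^sub>m n m = f"
  by (auto intro!: eq_matI)

lemma ucls_eq_iff:
  assumes w: "wf_rep U" "wf_rep V" and f: "f \<in> rep_Hom U V" and g: "g \<in> rep_Hom U V"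
  shows "ucls N U V f = ucls N U V g \<longleftrightarrow> f - g \<in> negl N U V"
proof
  assume e: "ucls N U V f = ucls N U V g"
  have "f \<in> ucls N U V f"
    using f negl_zero[OF w] by (simp add: ucls_def minus_r_inv_mat[OF rep_Hom_carrier[OF f]])
  then show "f - g \<in> negl N U V" unfolding e by (simp add: ucls_def)
next
  have *: "ucls N U V f \<subseteq> ucls N U V g"
    if f: "f \<in> rep_Hom U V" and g: "g \<in> rep_Hom U V" and d: "g - f \<in> negl N U V" for f g
  proof
    fix h assume "h \<in> ucls N U V f"
    then have h: "h \<in> rep_Hom U V" "h - f \<in> negl N U V" by (auto simp: ucls_def)
    have "h - g = (h - f) - (g - f)"
      using rep_Hom_carrier[OF f] rep_Hom_carrier[OF g] rep_Hom_carrier[OF h(1)] by (auto intro!: eq_matI)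
    then show "h \<in> ucls N U V g" using negl_diff[OF w h(2) d] h(1) by (simp add: ucls_def)
  qed
  assume d: "f - g \<in> negl N U V"
  have "g - f = 0\<^sub>m (rdim V) (rdim U) - (f - g)"
    using rep_Hom_carrier[OF f] rep_Hom_carrier[OF g] by (auto intro!: eq_matI)
  then have "g - f \<in> negl N U V" using negl_diff[OF w negl_zero[OF w] d] by simp
  then show "ucls N U V f = ucls N U V g" using *[OF f g] *[OF g f d] by blast
qed

lemma ucls_self: "wf_rep U \<Longrightarrow> wf_rep V \<Longrightarrow> f \<in> rep_Hom U V \<Longrightarrow> f \<in> ucls N U V f"
  using negl_zero[of U V N] by (simp add: ucls_def minus_r_inv_mat[OF rep_Hom_carrier])

text \<open>The union in \<open>ucomp\<close> runs over equal sets, since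
  \<open>f' g' - f g = f' (g' - g) + (f' - f) g\<close> is negligible; it is a union over nonempty
  families because each class contains its representative.\<close>

lemma ucomp_ucls:
  assumes w: "wf_rep U" "wf_rep V" "wf_rep Z" and f: "f \<in> rep_Hom V Z" and g: "g \<in> rep_Hom U V"
  shows "ucomp N U Z (ucls N V Z f) (ucls N U V g) = ucls N U Z (f * g)"
proof -
  have "ucls N U Z (f' * g') = ucls N U Z (f * g)"
    if "f' \<in> ucls N V Z f" "g' \<in> ucls N U V g" for f' g'
  proof -
    have f': "f' \<in> rep_Hom V Z" "f' - f \<in> negl N V Z" and g': "g' \<in> rep_Hom U V" "g' - g \<in> negl N U V"
      using that by (auto simp: ucls_def)
    have fg: "f' * g' \<in> rep_Hom U Z" "f' * g \<in> rep_Hom U Z" "f * g \<in> rep_Hom U Z"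
      using f' g' f g w by (auto intro: rep_Hom_mult)
    have "f' * (g' - g) \<in> negl N U Z" using negl_mult_left[OF w g'(2) f'(1)] .
    then have 1: "ucls N U Z (f' * g') = ucls N U Z (f' * g)"
      using mult_minus_distrib_mat[OF rep_Hom_carrier[OF f'(1)] rep_Hom_carrier[OF g'(1)] rep_Hom_carrier[OF g]] fg
      by (simp add: ucls_eq_iff[OF w(1,3)])
    have "(f' - f) * g \<in> negl N U Z" using negl_mult_right[OF w f'(2) g] .
    then have "ucls N U Z (f' * g) = ucls N U Z (f * g)"
      using minus_mult_distrib_mat[OF rep_Hom_carrier[OF f'(1)] rep_Hom_carrier[OF f] rep_Hom_carrier[OF g]] fg
      by (simp add: ucls_eq_iff[OF w(1,3)])
    with 1 show ?thesis by simp
  qed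
  then have "ucomp N U Z (ucls N V Z f) (ucls N U V g) =
      (\<Union>f'\<in>ucls N V Z f. \<Union>g'\<in>ucls N U V g. ucls N U Z (f * g))"
    unfolding ucomp_def by (intro SUP_cong refl) simp
  also have "\<dots> = ucls N U Z (f * g)"
    using ucls_self[OF w(2,3) f, of N] ucls_self[OF w(1,2) g, of N] by (metis SUP_const empty_iff)
  finally show ?thesis .
qed

lemma uis_isoI:
  assumes w: "wf_rep U" "wf_rep V" and f: "f \<in> rep_Hom U V" and g: "g \<in> rep_Hom V U"
    and "f * g - 1\<^sub>m (rdim V) \<in> negl N V V" "g * f - 1\<^sub>m (rdim U) \<in> negl N U U"
  shows "uis_iso N U V (ucls N U V f)"
  unfolding uis_iso_def uHom_def
proof (intro conjI bexI)
  have "f * g \<in> rep_Hom V V" "g * f \<in> rep_Hom U U" using w f g by (auto intro: rep_Hom_mult)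
  then show "ucomp N V V (ucls N U V f) (ucls N V U g) = uid N V"
    "ucomp N U U (ucls N V U g) (ucls N U V f) = uid N U"
    using assms by (simp_all add: ucomp_ucls uid_def ucls_eq_iff rep_Hom_one)
qed (use f g in auto)

lemma uis_isoE:
  assumes "uis_iso N U V F" and w: "wf_rep U" "wf_rep V"
  obtains f g where "f \<in> rep_Hom U V" "g \<in> rep_Hom V U" "F = ucls N U V f"
    "f * g - 1\<^sub>m (rdim V) \<in> negl N V V" "g * f - 1\<^sub>m (rdim U) \<in> negl N U U"
proof -
  obtain f g where f: "f \<in> rep_Hom U V" "F = ucls N U V f" and g: "g \<in> rep_Hom V U"
      and e: "ucomp N V V (ucls N U V f) (ucls N V U g) = uid N V"
      "ucomp N U U (ucls N V U g) (ucls N U V f) = uid N U"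
    using assms unfolding uis_iso_def uHom_def by blast
  have "f * g \<in> rep_Hom V V" "g * f \<in> rep_Hom U U" using w f g by (auto intro: rep_Hom_mult)
  then have "f * g - 1\<^sub>m (rdim V) \<in> negl N V V" "g * f - 1\<^sub>m (rdim U) \<in> negl N U U"
    using e w f g by (simp_all add: ucomp_ucls uid_def ucls_eq_iff rep_Hom_one)
  with f g show thesis using that by blast
qed

lemma mat_iso_uiso:
  assumes "mat_iso U V" "U \<in> Rep N M l"
  shows "uiso N M l U V"
proof -
  obtain F G where w: "wf_rep U" "wf_rep V"
    and F: "F \<in> rep_Hom U V" and G: "G \<in> rep_Hom V U" "F * G = 1\<^sub>m (rdim V)" "G * F = 1\<^sub>m (rdim U)"
    using assms unfolding mat_iso_def by metis
  have "uis_iso N U V (ucls N U V F)"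
    using negl_zero[OF w(1,1)] negl_zero[OF w(2,2)]
    by (intro uis_isoI[OF w F G(1)]) (simp_all add: G minus_r_inv_mat[OF one_carrier_mat])
  then show ?thesis using assms mat_iso_Rep[OF assms] by (auto simp: uiso_def)
qed

lemma uiso_sym: "uiso N M l U V \<Longrightarrow> uiso N M l V U"
proof -
  assume u: "uiso N M l U V"
  then obtain F where U: "U \<in> Rep N M l" and V: "V \<in> Rep N M l" and F: "uis_iso N U V F"
    by (auto simp: uiso_def)
  note w = Rep_wf[OF U] Rep_wf[OF V]
  from uis_isoE[OF F w] obtain f g where "f \<in> rep_Hom U V" "g \<in> rep_Hom V U"
    "f * g - 1\<^sub>m (rdim V) \<in> negl N V V" "g * f - 1\<^sub>m (rdim U) \<in> negl N U U"
    by metis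
  then have "uis_iso N V U (ucls N V U g)" by (intro uis_isoI[OF w(2,1)])
  then show ?thesis using U V by (auto simp: uiso_def)
qed

text \<open>The error is \<open>f' (f g - 1) g' + (f' g' - 1)\<close>, and the first term is
  negligible by the ideal property.\<close>

lemma negl_comp_one:
  assumes w: "wf_rep U" "wf_rep V" "wf_rep W"
    and f: "f \<in> rep_Hom U V" "g \<in> rep_Hom V U" "f * g - 1\<^sub>m (rdim V) \<in> negl N V V"
    and f': "f' \<in> rep_Hom V W" "g' \<in> rep_Hom W V" "f' * g' - 1\<^sub>m (rdim W) \<in> negl N W W"
  shows "(f' * f) * (g * g') - 1\<^sub>m (rdim W) \<in> negl N W W"
proof -
  note c = rep_Hom_carrier[OF f(1)] rep_Hom_carrier[OF f(2)] rep_Hom_carrier[OF f'(1)] rep_Hom_carrier[OF f'(2)]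
  have fg: "f * g \<in> carrier_mat (rdim V) (rdim V)" using c by simp
  let ?n = "(f' * (f * g - 1\<^sub>m (rdim V))) * g'"
  have n: "?n \<in> negl N W W"
    using negl_mult_right[OF w(3,2,3) negl_mult_left[OF w(2,2,3) f(3) f'(1)] f'(2)] .
  have "?n = (f' * (f * g) - f') * g'"
    using mult_minus_distrib_mat[OF c(3) fg one_carrier_mat] c(3) by simp
  also have "\<dots> = f' * (f * g) * g' - f' * g'"
    using minus_mult_distrib_mat[OF mult_carrier_mat[OF c(3) fg] c(3,4)] .
  also have "f' * (f * g) * g' = (f' * f) * (g * g')"
    using assoc_mult_mat[OF c(3) c(1) mult_carrier_mat[OF c(2,4)]] assoc_mult_mat[OF c(1,2,4)]
      assoc_mult_mat[OF c(3) fg c(4)] by simp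
  finally have e: "?n = (f' * f) * (g * g') - f' * g'" .
  have "(f' * f) * (g * g') - 1\<^sub>m (rdim W) = ?n + (f' * g' - 1\<^sub>m (rdim W))"
    unfolding e using c by (auto intro!: eq_matI)
  then show ?thesis using negl_add[OF w(3,3) n f'(3)] by simp
qed

lemma uiso_trans: "uiso N M l U V \<Longrightarrow> uiso N M l V W \<Longrightarrow> uiso N M l U W"
proof -
  assume "uiso N M l U V" "uiso N M l V W"
  then obtain F F' where R: "U \<in> Rep N M l" "V \<in> Rep N M l" "W \<in> Rep N M l"
    and F: "uis_iso N U V F" "uis_iso N V W F'"
    by (auto simp: uiso_def)
  note w = R[THEN Rep_wf]
  from uis_isoE[OF F(1) w(1,2)] obtain f g where f: "f \<in> rep_Hom U V" "g \<in> rep_Hom V U"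
    "f * g - 1\<^sub>m (rdim V) \<in> negl N V V" "g * f - 1\<^sub>m (rdim U) \<in> negl N U U"
    by metis
  from uis_isoE[OF F(2) w(2,3)] obtain f' g' where f': "f' \<in> rep_Hom V W" "g' \<in> rep_Hom W V"
    "f' * g' - 1\<^sub>m (rdim W) \<in> negl N W W" "g' * f' - 1\<^sub>m (rdim V) \<in> negl N V V"
    by metis
  have "uis_iso N U W (ucls N U W (f' * f))"
    using negl_comp_one[OF w f(1-3) f'(1-3)] negl_comp_one[OF w(3,2,1) f'(2,1,4) f(2,1,4)]
      rep_Hom_mult[OF w f'(1) f(1)] rep_Hom_mult[OF w(3,2,1) f(2) f'(2)]
    by (intro uis_isoI[OF w(1,3)])
  then show ?thesis using R by (auto simp: uiso_def)
qed

section \<open>Local endomorphism rings\<close>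

text \<open>If \<open>m < n\<close>, padding with zeros gives square matrices with
  \<open>A' * B' = 1\<close>, hence \<open>B' * A' = 1\<close>; but row \<open>m\<close> of
  \<open>B'\<close> is zero.\<close>

lemma rank_factor_bound:
  fixes A B :: "'k::field mat"
  assumes A: "A \<in> carrier_mat n m" and B: "B \<in> carrier_mat m n" and AB: "A * B = 1\<^sub>m n"
  shows "n \<le> m"
proof (rule ccontr)
  assume "\<not> n \<le> m"
  then have mn: "m < n" by simp
  define A' where "A' = mat n n (\<lambda>(i, j). if j < m then A $$ (i, j) else 0)"
  define B' where "B' = mat n n (\<lambda>(i, j). if i < m then B $$ (i, j) else 0)"
  have "A' * B' = 1\<^sub>m n"
  proof (rule eq_matI)
    fix i j assume "i < dim_row (1\<^sub>m n :: 'k mat)" "j < dim_col (1\<^sub>m n :: 'k mat)"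
    then have ij: "i < n" "j < n" by auto
    then have "(A' * B') $$ (i, j) = (\<Sum>k = 0..<n. (if k < m then A $$ (i, k) else 0) * (if k < m then B $$ (k, j) else 0))"
      by (simp add: A'_def B'_def scalar_prod_def)
    also have "\<dots> = (\<Sum>k = 0..<m. A $$ (i, k) * B $$ (k, j))"
      using mn by (intro sum.mono_neutral_cong_right) auto
    also have "\<dots> = (A * B) $$ (i, j)" using A B ij by (simp add: scalar_prod_def)
    finally show "(A' * B') $$ (i, j) = 1\<^sub>m n $$ (i, j)" by (simp add: AB)
  qed (simp_all add: A'_def B'_def)
  moreover have "A' \<in> carrier_mat n n" "B' \<in> carrier_mat n n" by (simp_all add: A'_def B'_def)
  ultimately have "B' * A' = 1\<^sub>m n" using mat_mult_left_right_inverse by blast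
  then have "(B' * A') $$ (m, m) = 1" using mn by simp
  moreover have "(B' * A') $$ (m, m) = 0" using mn by (simp add: A'_def B'_def scalar_prod_def)
  ultimately show False by simp
qed

text \<open>Records what is used of a local endomorphism ring with nonzero quantum dimension:
  invertibility serves simplicity in the quotient, trivial idempotents serve
  indecomposability.\<close>

definition local_rep :: "nat \<Rightarrow> 'k::comm_ring_1 rep \<Rightarrow> bool" where
  "local_rep N U \<longleftrightarrow> wf_rep U \<and> qtr N U (1\<^sub>m (rdim U)) \<noteq> 0 \<and>
     (\<forall>f \<in> rep_Hom U U.
        (qtr N U f \<noteq> 0 \<longrightarrow> (\<exists>g \<in> rep_Hom U U. f * g = 1\<^sub>m (rdim U))) \<and>
        (f * f = f \<longrightarrow> f = 0\<^sub>m (rdim U) (rdim U) \<or> f = 1\<^sub>m (rdim U)))"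

text \<open>Conjugation by the isomorphism carries inverses and idempotents across, and cyclicity
  shows that it preserves \<open>qtr\<close>. The property is therefore checked on string models
  alone.\<close>

lemma local_rep_iso:
  assumes i: "mat_iso U V" and l: "local_rep N U"
  shows "local_rep N V"
proof -
  obtain F G where w: "wf_rep U" "wf_rep V"
    and F: "F \<in> rep_Hom U V" and G: "G \<in> rep_Hom V U" "F * G = 1\<^sub>m (rdim V)" "G * F = 1\<^sub>m (rdim U)"
    using i unfolding mat_iso_def by metis
  note c = rep_Hom_carrier[OF F] rep_Hom_carrier[OF G(1)]
  have q1: "qtr N V (1\<^sub>m (rdim V)) = qtr N U (1\<^sub>m (rdim U))"
    using qtr_comm[OF w F G(1), of N] by (simp add: G)
  have conj: "F * (G * f) = f" "(f * F) * G = f" if "f \<in> rep_Hom V V" for f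
    using assoc_mult_mat[OF c rep_Hom_carrier[OF that]] assoc_mult_mat[OF rep_Hom_carrier[OF that] c]
      rep_Hom_carrier[OF that] by (simp_all add: G)
  have "(qtr N V f \<noteq> 0 \<longrightarrow> (\<exists>g \<in> rep_Hom V V. f * g = 1\<^sub>m (rdim V))) \<and>
        (f * f = f \<longrightarrow> f = 0\<^sub>m (rdim V) (rdim V) \<or> f = 1\<^sub>m (rdim V))"
    if f: "f \<in> rep_Hom V V" for f
  proof -
    note fc = rep_Hom_carrier[OF f]
    define h where "h = G * (f * F)"
    have fF: "f * F \<in> rep_Hom U V" using rep_Hom_mult[OF w(1,2,2) f F] .
    have h: "h \<in> rep_Hom U U" unfolding h_def using rep_Hom_mult[OF w(1,2,1) G(1) fF] .
    note hc = rep_Hom_carrier[OF h]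
    have Fh: "F * h = f * F"
      unfolding h_def using assoc_mult_mat[OF c rep_Hom_carrier[OF fF]] left_mult_one_mat[OF rep_Hom_carrier[OF fF]] by (simp add: G)
    have qf: "qtr N V f = qtr N U h"
      using qtr_comm[OF w fF G(1), of N] conj(2)[OF f] by (simp add: h_def)
    show ?thesis
    proof (intro conjI impI)
      assume "qtr N V f \<noteq> 0"
      then obtain g where g: "g \<in> rep_Hom U U" "h * g = 1\<^sub>m (rdim U)"
        using l h by (auto simp: local_rep_def qf)
      have gG: "g * G \<in> rep_Hom V U" using rep_Hom_mult[OF w(2,1,1) g(1) G(1)] .
      have "F * (g * G) \<in> rep_Hom V V" using rep_Hom_mult[OF w(2,1,2) F gG] .
      moreover have "f * (F * (g * G)) = 1\<^sub>m (rdim V)"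
      proof -
        have "f * (F * (g * G)) = (F * h) * (g * G)"
          using assoc_mult_mat[OF fc c(1) rep_Hom_carrier[OF gG]] by (simp add: Fh)
        also have "\<dots> = F * (h * (g * G))" by (rule assoc_mult_mat[OF c(1) hc rep_Hom_carrier[OF gG]])
        also have "h * (g * G) = G"
          using assoc_mult_mat[OF hc rep_Hom_carrier[OF g(1)] c(2)] c by (simp add: g)
        finally show ?thesis by (simp add: G)
      qed
      ultimately show "\<exists>g \<in> rep_Hom V V. f * g = 1\<^sub>m (rdim V)" by blast
    next
      assume ff: "f * f = f"
      have fc': "f = F * (h * G)"
        using assoc_mult_mat[OF c(1) hc c(2)] conj(2)[OF f] by (simp add: Fh)
      have "h * h = G * (f * (F * h))"
        unfolding h_def[of] using assoc_mult_mat[OF c(2) rep_Hom_carrier[OF fF] hc] assoc_mult_mat[OF fc c(1) hc]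
        by (simp add: h_def)
      also have "\<dots> = h" using assoc_mult_mat[OF fc fc c(1)] by (simp only: Fh ff) (simp add: h_def)
      finally have "h = 0\<^sub>m (rdim U) (rdim U) \<or> h = 1\<^sub>m (rdim U)" using l h by (auto simp: local_rep_def)
      then show "f = 0\<^sub>m (rdim V) (rdim V) \<or> f = 1\<^sub>m (rdim V)"
        using c by (auto simp: fc' G)
    qed
  qed
  then show ?thesis unfolding local_rep_def using w q1 l by (simp add: local_rep_def)
qed

text \<open>The projector onto a proper nonzero summand is an idempotent with both 1 and 0 on its
  diagonal.\<close>

lemma local_rep_indecomposable:
  assumes l: "local_rep N U" and U: "U \<in> Rep N M l"
  shows "indecomposable N M l U"
  unfolding indecomposable_def
proof (intro conjI notI U)
  show "rdim U > 0" using l by (cases "rdim U = 0") (auto simp: local_rep_def qtr_conv)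
  assume "\<exists>V \<in> Rep N M l. \<exists>Z \<in> Rep N M l. rdim V > 0 \<and> rdim Z > 0 \<and> rep_iso N M l U (rep_sum V Z)"
  then obtain V Z where w: "wf_rep V" "wf_rep Z" and d: "rdim V > 0" "rdim Z > 0"
    and i: "mat_iso U (rep_sum V Z)"
    by (auto simp: rep_iso_iff dest: Rep_wf)
  let ?S = "rep_sum V Z" and ?n = "rdim V" and ?m = "rdim Z"
  have S: "local_rep N ?S" using local_rep_iso[OF i l] .
  define e :: "'a mat" where "e = sum_inl ?n ?m * sum_prl ?n ?m"
  have e: "e \<in> rep_Hom ?S ?S"
    unfolding e_def using rep_Hom_mult[OF _ w(1) _ sum_maps_Hom(1)[OF w] sum_maps_Hom(3)[OF w]] wf_rep_sum[OF w] by simp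
  have ec: "e = mat (?n + ?m) (?n + ?m) (\<lambda>(i, j). if i = j \<and> i < ?n then 1 else 0)"
    unfolding e_def by (rule sum_in_pr)
  have "e * e = sum_inl ?n ?m * ((sum_prl ?n ?m * sum_inl ?n ?m) * sum_prl ?n ?m)"
    unfolding e_def
    by (simp add: assoc_mult_mat[of _ "?n + ?m" ?n _ "?n + ?m" _ "?n + ?m"]
        assoc_mult_mat[of _ ?n "?n + ?m" _ ?n _ "?n + ?m"] carrier_matI)
  also have "\<dots> = e" by (simp add: sum_pr_in e_def left_mult_one_mat carrier_matI)
  finally have "e * e = e" .
  then consider "e = 0\<^sub>m (?n + ?m) (?n + ?m)" | "e = 1\<^sub>m (?n + ?m)" using S e by (auto simp: local_rep_def)
  then show False
  proof cases
    case 1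
    then have "e $$ (0, 0) = 0" using d by simp
    then show False using d by (simp add: ec)
  next
    case 2
    then have "e $$ (?n, ?n) = 1" using d by simp
    then show False using d by (simp add: ec)
  qed
qed

lemma local_rep_usimple:
  assumes l: "local_rep N U" and U: "U \<in> Rep N M l"
  shows "usimple N M l U"
  unfolding usimple_def
proof (intro conjI ballI allI impI U)
  note wU = Rep_wf[OF U]
  show "uid N U \<noteq> uzero N U U"
  proof
    assume "uid N U = uzero N U U"
    then have "1\<^sub>m (rdim U) - 0\<^sub>m (rdim U) (rdim U) \<in> negl N U U"
      using ucls_eq_iff[OF wU wU rep_Hom_one[OF wU] rep_Hom_zero[OF wU wU]] by (simp add: uid_def uzero_def)
    then have "qtr N U (1\<^sub>m (rdim U) * 1\<^sub>m (rdim U)) = 0"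
      using neglD(2)[OF _ rep_Hom_one[OF wU]] minus_zero_mat[OF one_carrier_mat]
      by metis
    then show False using l right_mult_one_mat[OF one_carrier_mat] by (simp add: local_rep_def)
  qed
  fix Z F assume Z: "Z \<in> Rep N M l" and m: "umono N M l Z U F"
  note wZ = Rep_wf[OF Z]
  obtain f where f: "f \<in> rep_Hom Z U" "F = ucls N Z U f" using m by (auto simp: umono_def uHom_def)
  note fc = rep_Hom_carrier[OF f(1)]
  have can: "ucls N Z Z g = ucls N Z Z g'"
    if "g \<in> rep_Hom Z Z" "g' \<in> rep_Hom Z Z" "ucls N Z U (f * g) = ucls N Z U (f * g')" for g g'
    using m that Z unfolding umono_def
    by (metis (no_types, lifting) f ucomp_ucls wU wZ uHom_def imageI)
  show "uid N Z = uzero N Z Z \<or> uis_iso N Z U F"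
  proof (cases "f \<in> negl N Z U")
    \<comment> \<open>A negligible monomorphism has the same composite with the identity and with
      zero, so cancellation makes the source a zero object.\<close>
    case True
    have "ucls N Z Z (1\<^sub>m (rdim Z)) = ucls N Z Z (0\<^sub>m (rdim Z) (rdim Z))"
    proof (rule can[OF rep_Hom_one[OF wZ] rep_Hom_zero[OF wZ wZ]])
      show "ucls N Z U (f * 1\<^sub>m (rdim Z)) = ucls N Z U (f * 0\<^sub>m (rdim Z) (rdim Z))"
        using True fc ucls_eq_iff[OF wZ wU f(1) rep_Hom_zero[OF wZ wU], of N]
        by (simp add: minus_zero_mat[OF fc])
    qed
    then show ?thesis by (simp add: uid_def uzero_def)
  next
    case False
    then obtain g where g: "g \<in> rep_Hom U Z" "qtr N U (f * g) \<noteq> 0" using f(1) by (auto simp: negl_def)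
    have fg: "f * g \<in> rep_Hom U U" using rep_Hom_mult[OF wU wZ wU f(1) g(1)] .
    then obtain h where h: "h \<in> rep_Hom U U" "(f * g) * h = 1\<^sub>m (rdim U)"
      using l g by (auto simp: local_rep_def)
    define s where "s = g * h"
    have s: "s \<in> rep_Hom U Z" unfolding s_def using rep_Hom_mult[OF wU wU wZ g(1) h(1)] .
    have fs: "f * s = 1\<^sub>m (rdim U)"
      using h(2) assoc_mult_mat[OF fc rep_Hom_carrier[OF g(1)] rep_Hom_carrier[OF h(1)]] by (simp add: s_def)
    have sf: "s * f \<in> rep_Hom Z Z" using rep_Hom_mult[OF wZ wU wZ s f(1)] .
    \<comment> \<open>A section of a monomorphism is a two-sided inverse:
      \<open>f (s f) = f\<close>, and \<open>f\<close> can be cancelled in the quotient.\<close>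
    have "f * (s * f) = f * 1\<^sub>m (rdim Z)"
      using assoc_mult_mat[OF fc rep_Hom_carrier[OF s] fc] fc by (simp add: fs)
    then have "ucls N Z Z (s * f) = ucls N Z Z (1\<^sub>m (rdim Z))"
      by (intro can[OF sf rep_Hom_one[OF wZ]]) simp
    then have "s * f - 1\<^sub>m (rdim Z) \<in> negl N Z Z" using ucls_eq_iff[OF wZ wZ sf rep_Hom_one[OF wZ]] by simp
    moreover have "f * s - 1\<^sub>m (rdim U) \<in> negl N U U"
      using negl_zero[OF wU wU] by (simp add: fs minus_r_inv_mat[OF one_carrier_mat])
    ultimately show ?thesis using uis_isoI[OF wZ wU f(1) s] f(2) by simp
  qed
qed

text \<open>An inverse in the quotient gives only that \<open>g f\<close> and the identity have
  equal quantum trace. As this is nonzero, \<open>g f\<close> is invertible as a matrix, so the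
  identity of \<open>U\<close> would factor through a smaller space.\<close>

lemma local_rep_not_uiso:
  fixes U V :: "'k::field rep"
  assumes l: "local_rep N U" and d: "rdim V < rdim U"
  shows "\<not> uiso N M l U V"
proof
  assume "uiso N M l U V"
  then obtain F where w: "wf_rep U" "wf_rep V" and F: "uis_iso N U V F"
    by (auto simp: uiso_def dest: Rep_wf)
  obtain f g where f: "f \<in> rep_Hom U V" and g: "g \<in> rep_Hom V U"
    and n: "g * f - 1\<^sub>m (rdim U) \<in> negl N U U"
    using uis_isoE[OF F w] by metis
  note fc = rep_Hom_carrier[OF f] and gc = rep_Hom_carrier[OF g]
  have gf: "g * f \<in> rep_Hom U U" using rep_Hom_mult[OF w(1,2,1) g f] .
  have "qtr N U ((g * f - 1\<^sub>m (rdim U)) * 1\<^sub>m (rdim U)) = 0"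
    using neglD(2)[OF n rep_Hom_one[OF w(1)]] .
  then have "qtr N U (g * f) = qtr N U (1\<^sub>m (rdim U))"
    using qtr_diff[OF w(1) rep_Hom_carrier[OF gf] one_carrier_mat] rep_Hom_carrier[OF neglD(1)[OF n]] by simp
  then obtain h where h: "h \<in> rep_Hom U U" "(g * f) * h = 1\<^sub>m (rdim U)"
    using l gf by (auto simp: local_rep_def)
  have fh: "f * h \<in> carrier_mat (rdim V) (rdim U)" using fc rep_Hom_carrier[OF h(1)] by simp
  have "g * (f * h) = 1\<^sub>m (rdim U)"
    using h(2) assoc_mult_mat[OF gc fc rep_Hom_carrier[OF h(1)]] by simp
  then show False using rank_factor_bound[OF gc fh] d by simp
qed

text \<open>These become zero objects: each composite that tests an endomorphism for negligibility
  is again an endomorphism.\<close>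

definition qtr_null :: "nat \<Rightarrow> 'k::comm_ring_1 rep \<Rightarrow> bool" where
  "qtr_null N U \<longleftrightarrow> wf_rep U \<and> (\<forall>f \<in> rep_Hom U U. qtr N U f = 0)"

text \<open>Insert the sum of the two projectors in front of \<open>f\<close> and rotate each term:
  it becomes the quantum trace of an endomorphism of a single summand.\<close>

lemma qtr_null_sum:
  assumes "qtr_null N U" "qtr_null N V"
  shows "qtr_null N (rep_sum U V)"
  unfolding qtr_null_def
proof (intro conjI ballI)
  have w: "wf_rep U" "wf_rep V" using assms by (simp_all add: qtr_null_def)
  let ?S = "rep_sum U V" and ?n = "rdim U" and ?m = "rdim V"
  show wS: "wf_rep ?S" using wf_rep_sum[OF w] .
  fix f assume f: "f \<in> rep_Hom ?S ?S"
  note fc = rep_Hom_carrier[OF f]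
  note h = sum_maps_Hom[OF w]
  note c = rep_Hom_carrier[OF h(1)] rep_Hom_carrier[OF h(2)] rep_Hom_carrier[OF h(3)] rep_Hom_carrier[OF h(4)]
  have p: "sum_prl ?n ?m * f \<in> rep_Hom ?S U" "sum_prr ?n ?m * f \<in> rep_Hom ?S V"
    using rep_Hom_mult[OF wS wS w(1) h(3) f] rep_Hom_mult[OF wS wS w(2) h(4) f] .
  note pc = rep_Hom_carrier[OF p(1)] rep_Hom_carrier[OF p(2)]
  have "f = (sum_inl ?n ?m * sum_prl ?n ?m + sum_inr ?n ?m * sum_prr ?n ?m) * f"
    using fc by (simp add: sum_in_pr_one)
  also have "\<dots> = (sum_inl ?n ?m * sum_prl ?n ?m) * f + (sum_inr ?n ?m * sum_prr ?n ?m) * f"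
    using c fc by (intro add_mult_distrib_mat) auto
  also have "\<dots> = sum_inl ?n ?m * (sum_prl ?n ?m * f) + sum_inr ?n ?m * (sum_prr ?n ?m * f)"
    using assoc_mult_mat[OF c(1,3) fc] assoc_mult_mat[OF c(2,4) fc] by simp
  finally have "qtr N ?S f = qtr N ?S (sum_inl ?n ?m * (sum_prl ?n ?m * f)) + qtr N ?S (sum_inr ?n ?m * (sum_prr ?n ?m * f))"
    using qtr_add[OF wS mult_carrier_mat[OF c(1) pc(1)] mult_carrier_mat[OF c(2) pc(2)], of N] by simp
  also have "qtr N ?S (sum_inl ?n ?m * (sum_prl ?n ?m * f)) = 0"
    using qtr_comm[OF w(1) wS h(1) p(1)] assms(1) rep_Hom_mult[OF w(1) wS w(1) p(1) h(1)]
    by (simp add: qtr_null_def)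
  also have "qtr N ?S (sum_inr ?n ?m * (sum_prr ?n ?m * f)) = 0"
    using qtr_comm[OF w(2) wS h(2) p(2)] assms(2) rep_Hom_mult[OF w(2) wS w(2) p(2) h(2)]
    by (simp add: qtr_null_def)
  finally show "qtr N ?S f = 0" by simp
qed

text \<open>The identity of \<open>T\<close> is \<open>a b + g f\<close>, where \<open>a b\<close>
  factors through \<open>P\<close>. Tested against any endomorphism, \<open>a b\<close> rotates to
  an endomorphism of \<open>P\<close>, so it is negligible.\<close>

lemma uiso_sum_null:
  assumes i: "mat_iso T (rep_sum P L)" and T: "T \<in> Rep N M l" and L: "L \<in> Rep N M l"
    and P: "qtr_null N P"
  shows "uiso N M l T L"
proof -
  let ?S = "rep_sum P L" and ?n = "rdim P" and ?m = "rdim L"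
  obtain F G where wT: "wf_rep T" and wS: "wf_rep ?S"
    and F: "F \<in> rep_Hom T ?S" and G: "G \<in> rep_Hom ?S T" "F * G = 1\<^sub>m (rdim ?S)" "G * F = 1\<^sub>m (rdim T)"
    using i unfolding mat_iso_def by metis
  have w: "wf_rep P" "wf_rep L" using P Rep_wf[OF L] by (simp_all add: qtr_null_def)
  note h = sum_maps_Hom[OF w]
  note c = rep_Hom_carrier[OF h(1)] rep_Hom_carrier[OF h(2)] rep_Hom_carrier[OF h(3)] rep_Hom_carrier[OF h(4)]
  note Fc = rep_Hom_carrier[OF F] and Gc = rep_Hom_carrier[OF G(1)]
  define f where "f = sum_prr ?n ?m * F"
  define g where "g = G * sum_inr ?n ?m"
  define a where "a = G * sum_inl ?n ?m"
  define b where "b = sum_prl ?n ?m * F"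
  have f: "f \<in> rep_Hom T L" unfolding f_def using rep_Hom_mult[OF wT wS w(2) h(4) F] .
  have g: "g \<in> rep_Hom L T" unfolding g_def using rep_Hom_mult[OF w(2) wS wT G(1) h(2)] .
  have a: "a \<in> rep_Hom P T" unfolding a_def using rep_Hom_mult[OF w(1) wS wT G(1) h(1)] .
  have b: "b \<in> rep_Hom T P" unfolding b_def using rep_Hom_mult[OF wT wS w(1) h(3) F] .
  have fg: "f * g = 1\<^sub>m ?m"
    unfolding f_def g_def
    using assoc_mult_mat[OF c(4) Fc mult_carrier_mat[OF Gc c(2)]] assoc_mult_mat[OF Fc Gc c(2)] c(2)
    by (simp add: G sum_pr_in)
  have ab: "a * b \<in> negl N T T"
  proof (rule neglI)
    show "a * b \<in> rep_Hom T T" using rep_Hom_mult[OF wT w(1) wT a b] .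
    fix k assume k: "k \<in> rep_Hom T T"
    have bk: "b * k \<in> rep_Hom T P" using rep_Hom_mult[OF wT wT w(1) b k] .
    have "qtr N T (a * (b * k)) = qtr N P ((b * k) * a)" using qtr_comm[OF w(1) wT a bk] .
    also have "\<dots> = 0" using P rep_Hom_mult[OF w(1) wT w(1) bk a] by (simp add: qtr_null_def)
    finally show "qtr N T (a * b * k) = 0"
      using assoc_mult_mat[OF rep_Hom_carrier[OF a] rep_Hom_carrier[OF b] rep_Hom_carrier[OF k]] by simp
  qed
  have "1\<^sub>m (rdim T) = G * ((sum_inl ?n ?m * sum_prl ?n ?m + sum_inr ?n ?m * sum_prr ?n ?m) * F)"
    using Fc by (simp add: sum_in_pr_one G)
  also have "(sum_inl ?n ?m * sum_prl ?n ?m + sum_inr ?n ?m * sum_prr ?n ?m) * F =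
      sum_inl ?n ?m * b + sum_inr ?n ?m * f"
    unfolding b_def f_def using assoc_mult_mat[OF c(1,3) Fc] assoc_mult_mat[OF c(2,4) Fc]
      add_mult_distrib_mat[OF mult_carrier_mat[OF c(1,3)] mult_carrier_mat[OF c(2,4)] Fc] by simp
  also have "G * (sum_inl ?n ?m * b + sum_inr ?n ?m * f) = a * b + g * f"
    unfolding a_def g_def
    using assoc_mult_mat[OF Gc c(1) rep_Hom_carrier[OF b]] assoc_mult_mat[OF Gc c(2) rep_Hom_carrier[OF f]]
      mult_add_distrib_mat[OF Gc mult_carrier_mat[OF c(1) rep_Hom_carrier[OF b]] mult_carrier_mat[OF c(2) rep_Hom_carrier[OF f]]]
    by simp
  finally have e: "g * f - 1\<^sub>m (rdim T) = 0\<^sub>m (rdim T) (rdim T) - a * b"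
    using rep_Hom_carrier[OF a] rep_Hom_carrier[OF b] rep_Hom_carrier[OF f] rep_Hom_carrier[OF g]
    by (auto intro!: eq_matI)
  have "uis_iso N T L (ucls N T L f)"
  proof (rule uis_isoI[OF wT w(2) f g])
    show "f * g - 1\<^sub>m ?m \<in> negl N L L" using negl_zero[OF w(2,2)] by (simp add: fg minus_r_inv_mat[OF one_carrier_mat])
    show "g * f - 1\<^sub>m (rdim T) \<in> negl N T T"
      unfolding e using negl_diff[OF wT wT negl_zero[OF wT wT] ab] .
  qed
  then show ?thesis using T L by (auto simp: uiso_def)
qed

section \<open>Integer matrices as lists of rows\<close>

text \<open>Integer lists can be evaluated, and identities between them hold over every commutative
  ring through \<open>of_int\<close>.\<close>

definition list_mat :: "nat \<Rightarrow> int list list \<Rightarrow> 'k::comm_ring_1 mat" where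
  "list_mat n Z = mat n n (\<lambda>(i, j). of_int ((Z ! i) ! j))"

definition sq_list :: "nat \<Rightarrow> int list list \<Rightarrow> bool" where
  "sq_list n Z \<longleftrightarrow> length Z = n \<and> list_all (\<lambda>r. length r = n) Z"

definition list_mult :: "nat \<Rightarrow> int list list \<Rightarrow> int list list \<Rightarrow> int list list" where
  "list_mult n Z Y = (let C = map (\<lambda>j. map (\<lambda>r. r ! j) Y) [0..<n] in
     map (\<lambda>r. map (\<lambda>c. sum_list (map2 (*) r c)) C) Z)"

definition list_scal :: "nat \<Rightarrow> int \<Rightarrow> int list list" where
  "list_scal n c = map (\<lambda>i. map (\<lambda>j. if i = j then c else 0) [0..<n]) [0..<n]"

definition list_neg :: "int list list \<Rightarrow> int list list" where
  "list_neg Z = map (map uminus) Z"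

lemma list_mat_carrier [simp]: "list_mat n Z \<in> carrier_mat n n"
  by (simp add: list_mat_def)

lemma list_mat_dim [simp]: "dim_row (list_mat n Z) = n" "dim_col (list_mat n Z) = n"
  by (simp_all add: list_mat_def)

lemma sq_listD: "sq_list n Z \<Longrightarrow> length Z = n" "sq_list n Z \<Longrightarrow> i < n \<Longrightarrow> length (Z ! i) = n"
  by (auto simp: sq_list_def list_all_length)

lemma list_mult_nth:
  assumes "sq_list n Z" "sq_list n Y" "i < n" "j < n"
  shows "(list_mult n Z Y ! i) ! j = (\<Sum>k<n. (Z ! i) ! k * (Y ! k) ! j)"
proof -
  have "(list_mult n Z Y ! i) ! j = sum_list (map2 (*) (Z ! i) (map (\<lambda>r. r ! j) Y))"
    using assms sq_listD(1)[OF assms(1)] by (simp add: list_mult_def)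
  also have "\<dots> = (\<Sum>k<n. (Z ! i) ! k * (Y ! k) ! j)"
    using assms sq_listD[OF assms(1)] sq_listD[OF assms(2)]
    by (simp add: sum_list_sum_nth lessThan_atLeast0)
  finally show ?thesis .
qed

lemma list_mat_mult:
  assumes "sq_list n Z" "sq_list n Y"
  shows "list_mat n Z * list_mat n Y = list_mat n (list_mult n Z Y)"
  by (rule eq_matI)
    (use assms in \<open>auto simp: list_mat_def scalar_prod_def list_mult_nth lessThan_atLeast0\<close>)

lemma list_mat_scal: "list_mat n (list_scal n c) = of_int c \<cdot>\<^sub>m 1\<^sub>m n"
  by (rule eq_matI) (auto simp: list_mat_def list_scal_def)

lemma list_mat_neg: "sq_list n Z \<Longrightarrow> list_mat n (list_neg Z) = - list_mat n Z"
  by (rule eq_matI) (auto simp: list_mat_def list_neg_def sq_listD)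

lemma sq_list_mult: "sq_list n Z \<Longrightarrow> sq_list n (list_mult n Z Y)"
  by (auto simp: sq_list_def list_mult_def list_all_length)

definition gen_scale :: "'k::comm_ring_1 \<times> 'k \<Rightarrow> gen \<Rightarrow> 'k" where
  "gen_scale \<psi> x = (case x of G1 \<Rightarrow> fst \<psi> | G2 \<Rightarrow> snd \<psi> | A1 \<Rightarrow> 1 | A2 \<Rightarrow> 1)"

text \<open>The integral module with all its types multiplied by \<open>\<psi>\<close>. An
  intertwiner of integral data serves every twist, because both sides are scaled alike.\<close>

definition int_rep :: "nat \<Rightarrow> (gen \<Rightarrow> int list list) \<Rightarrow> 'k::comm_ring_1 \<times> 'k \<Rightarrow> 'k rep" where
  "int_rep n D \<psi> = \<lparr> rdim = n, ract = (\<lambda>x. gen_scale \<psi> x \<cdot>\<^sub>m list_mat n (D x)) \<rparr>"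

lemma int_rep_simps [simp]:
  "rdim (int_rep n D \<psi>) = n" "ract (int_rep n D \<psi>) x = gen_scale \<psi> x \<cdot>\<^sub>m list_mat n (D x)"
  by (simp_all add: int_rep_def)

lemma wf_int_rep [simp]: "wf_rep (int_rep n D \<psi>)"
  by (simp add: wf_rep_def)

definition sq_data :: "nat \<Rightarrow> (gen \<Rightarrow> int list list) \<Rightarrow> bool" where
  "sq_data n D \<longleftrightarrow> list_all (\<lambda>x. sq_list n (D x)) [G1, G2, A1, A2]"

lemma sq_dataD: "sq_data n D \<Longrightarrow> sq_list n (D x)"
  by (cases x) (auto simp: sq_data_def)

text \<open>The inverse of \<open>Z\<close> is \<open>Y / d\<close>, so that all matrices remain integral.\<close>

definition iso_check ::
  "nat \<Rightarrow> int \<Rightarrow> int list list \<Rightarrow> int list list \<Rightarrow> (gen \<Rightarrow> int list list) \<Rightarrow> (gen \<Rightarrow> int list list) \<Rightarrow> bool"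
  where
  "iso_check n d Z Y D D' \<longleftrightarrow> d \<noteq> 0 \<and> sq_list n Z \<and> sq_list n Y \<and> sq_data n D \<and> sq_data n D' \<and>
     list_mult n Z Y = list_scal n d \<and>
     list_all (\<lambda>x. list_mult n Z (D x) = list_mult n (D' x) Z) [G1, G2, A1, A2]"

lemma iso_check_mat_iso:
  fixes \<psi> :: "'k::{field, ring_char_0} \<times> 'k"
  assumes "iso_check n d Z Y D D'"
  shows "mat_iso (int_rep n D \<psi>) (int_rep n D' \<psi>)"
proof (rule mat_isoI)
  have Z: "sq_list n Z" and Y: "sq_list n Y" and d: "(of_int d :: 'k) \<noteq> 0"
    and D: "\<And>x. sq_list n (D x)" "\<And>x. sq_list n (D' x)"
    using assms by (auto simp: iso_check_def intro: sq_dataD)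
  have e: "list_mult n Z (D x) = list_mult n (D' x) Z" for x
    using assms by (cases x) (auto simp: iso_check_def)
  show "list_mat n Z \<in> rep_Hom (int_rep n D \<psi>) (int_rep n D' \<psi>)"
  proof (rule rep_HomI)
    fix x
    show "list_mat n Z * ract (int_rep n D \<psi>) x = ract (int_rep n D' \<psi>) x * list_mat n Z"
      using mult_smult_distrib[OF list_mat_carrier list_mat_carrier, of n Z "gen_scale \<psi> x" "D x"]
        mult_smult_assoc_mat[OF list_mat_carrier list_mat_carrier, of "gen_scale \<psi> x" n "D' x" Z]
      by (simp add: list_mat_mult Z D e)
  qed simp
  have "list_mat n Z * ((1 / of_int d) \<cdot>\<^sub>m list_mat n Y) = (1 / of_int d) \<cdot>\<^sub>m (of_int d \<cdot>\<^sub>m (1\<^sub>m n :: 'k mat))"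
    using assms mult_smult_distrib[OF list_mat_carrier list_mat_carrier, of n Z "1 / of_int d" Y]
    by (simp add: list_mat_mult Z Y iso_check_def list_mat_scal)
  then show "list_mat n Z * ((1 / of_int d) \<cdot>\<^sub>m list_mat n Y) = (1\<^sub>m (rdim (int_rep n D' \<psi>)) :: 'k mat)"
    using d by (simp add: smult_smult_times)
qed simp_all

text \<open>The defining relations with all deformation terms set to zero and
  \<open>g_i^2 = 1\<close>; for twists by \<open>O1\<close> nothing more is needed, whence the
  absence of \<open>N\<close>, \<open>M\<close> and \<open>l\<close>.\<close>

definition rep_check :: "nat \<Rightarrow> (gen \<Rightarrow> int list list) \<Rightarrow> bool" where
  "rep_check n D \<longleftrightarrow> sq_data n D \<and>
     (let g = D G1; h = D G2; a = D A1; b = D A2; m = list_mult n in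
       m g g = list_scal n 1 \<and> m h h = list_scal n 1 \<and> m g h = m h g \<and>
       m g a = list_neg (m a g) \<and> m g b = list_neg (m b g) \<and>
       m h a = m a h \<and> m h b = list_neg (m b h) \<and>
       m a a = list_scal n 0 \<and> m b b = list_scal n 0 \<and>
       m (m a b) (m a b) = list_neg (m (m b a) (m b a)))"

lemma scalar_mat_simps:
  fixes a b :: "'k::comm_ring_1"
  shows "a \<cdot>\<^sub>m 1\<^sub>m n + b \<cdot>\<^sub>m 1\<^sub>m n = (a + b) \<cdot>\<^sub>m 1\<^sub>m n"
    "a \<cdot>\<^sub>m 1\<^sub>m n - b \<cdot>\<^sub>m 1\<^sub>m n = (a - b) \<cdot>\<^sub>m 1\<^sub>m n"
    "(a \<cdot>\<^sub>m 1\<^sub>m n) * (b \<cdot>\<^sub>m 1\<^sub>m n) = (a * b) \<cdot>\<^sub>m 1\<^sub>m n"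
    "0 \<cdot>\<^sub>m 1\<^sub>m n = (0\<^sub>m n n :: 'k mat)"
  by (auto intro!: eq_matI simp: algebra_simps mult_smult_assoc_mat[of _ n n])

lemma rep_check_Rep:
  fixes \<psi> :: "'k::comm_ring_1 \<times> 'k"
  assumes chk: "rep_check n D" and \<psi>: "\<psi> \<in> O1 N M l"
  shows "int_rep n D \<psi> \<in> Rep N M l"
proof -
  obtain l1 l2 l3 where l: "l = (l1, l2, l3)" by (cases l)
  let ?U = "int_rep n D \<psi>" and ?I = "1\<^sub>m n :: 'k mat"
  let ?L = "list_mat n :: int list list \<Rightarrow> 'k mat"
  let ?p = "fst \<psi>" and ?q = "snd \<psi>"
  have \<psi>1: "?p ^ (2 * N) = 1" "?q ^ (2 * M) = 1" "l1 * (1 - ?p\<^sup>2) = 0" "l2 * (1 - ?q\<^sup>2) = 0"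
    "l3 * (1 - ?p\<^sup>2 * ?q\<^sup>2) - 2 * l1 * l2 * (1 + ?q\<^sup>2) * (1 - ?p\<^sup>2) = 0"
    using \<psi> by (auto simp: l chars_def)
  have D: "sq_list n (D x)" for x using chk sq_dataD by (auto simp: rep_check_def)
  have m: "(c \<cdot>\<^sub>m ?L Z) * (d \<cdot>\<^sub>m ?L Y) = (c * d) \<cdot>\<^sub>m ?L (list_mult n Z Y)"
    if "sq_list n Z" "sq_list n Y" for c d Z Y
    using mult_smult_distrib[OF list_mat_carrier list_mat_carrier, of n Z d Y]
      mult_smult_assoc_mat[OF list_mat_carrier smult_carrier_mat[OF list_mat_carrier], of c n Z d Y]
    by (simp add: list_mat_mult that smult_smult_times)
  have m12: "(c \<cdot>\<^sub>m ?L Z) * ?L Y = c \<cdot>\<^sub>m ?L (list_mult n Z Y)"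
      "?L Z * (c \<cdot>\<^sub>m ?L Y) = c \<cdot>\<^sub>m ?L (list_mult n Z Y)"
    if "sq_list n Z" "sq_list n Y" for c Z Y
    using m[OF that, of c 1] m[OF that, of 1 c] by simp_all
  note A = free_act_mult[OF wf_int_rep] free_act_add free_act_diff free_act_1[OF wf_int_rep]
    free_act_fgen[OF wf_int_rep] free_act_fscal[OF wf_int_rep] power2_eq_square
  have sg: "(?p \<cdot>\<^sub>m ?L (D G1)) * (?p \<cdot>\<^sub>m ?L (D G1)) = (?p * ?p) \<cdot>\<^sub>m ?I"
    "(?q \<cdot>\<^sub>m ?L (D G2)) * (?q \<cdot>\<^sub>m ?L (D G2)) = (?q * ?q) \<cdot>\<^sub>m ?I"
    using chk by (simp_all add: m D rep_check_def Let_def list_mat_scal)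
  \<comment> \<open>Scalar matrices form a copy of the field. Written through \<open>s\<close>, the
    right-hand sides of the last three relators collapse to the scalars that vanish on
    \<open>O1\<close>.\<close>
  define s where "s c = c \<cdot>\<^sub>m ?I" for c
  have s: "s a + s b = s (a + b)" "s a - s b = s (a - b)" "s a * s b = s (a * b)" for a b
    by (simp_all add: s_def scalar_mat_simps)
  have s01: "0\<^sub>m n n = s 0" "?I = s 1" by (simp_all add: s_def scalar_mat_simps)
  \<comment> \<open>The group relations involve even powers only, and these depend only on the
    scalar square.\<close>
  have pow: "A ^\<^sub>m (2 * k) = c ^ (2 * k) \<cdot>\<^sub>m ?I" if A: "A \<in> carrier_mat n n" "A * A = (c * c) \<cdot>\<^sub>m ?I" for A c k
  proof (induction k)
    case 0 then show ?case using A by simp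
  next
    case (Suc k)
    have "A ^\<^sub>m (2 * Suc k) = A ^\<^sub>m (2 * k) * (A * A)"
      using assoc_mult_mat[OF pow_carrier_mat[OF A(1)] A(1) A(1)] by simp
    also have "\<dots> = (c ^ (2 * k) * (c * c)) \<cdot>\<^sub>m ?I" unfolding Suc A by (rule scalar_mat_simps)
    finally show ?case by (simp add: mult_ac)
  qed
  have neg: "c \<cdot>\<^sub>m (- ?L Z) + c \<cdot>\<^sub>m ?L Z = 0\<^sub>m n n" "c \<cdot>\<^sub>m (- ?L Z) - d \<cdot>\<^sub>m (- ?L Z) = c \<cdot>\<^sub>m (- ?L Z) + d \<cdot>\<^sub>m ?L Z" for c d Z
    by (auto intro!: eq_matI)
  have z: "free_act ?U r = 0\<^sub>m n n" if r: "r \<in> relators N M l" for r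
  proof -
    have LN: "?L (list_neg (list_mult n Z Y)) = - ?L (list_mult n Z Y)" if "sq_list n Z" for Z Y
      using list_mat_neg[OF sq_list_mult[OF that]] .
    have L0: "?L (list_scal n 0) = 0\<^sub>m n n"
      unfolding list_mat_scal by (auto intro!: eq_matI)
    note chk' = chk[unfolded rep_check_def Let_def]
    have prod: "free_act ?U (fgen x * fgen y) = (gen_scale \<psi> x * gen_scale \<psi> y) \<cdot>\<^sub>m ?L (list_mult n (D x) (D y))" for x y
      by (simp only: A int_rep_simps m[OF D D])
    have anti: "free_act ?U (fgen x * fgen y + fgen y * fgen x) = 0\<^sub>m n n"
      if "list_mult n (D x) (D y) = list_neg (list_mult n (D y) (D x))" for x y
      unfolding free_act_add prod that LN[OF D] mult.commute[of "gen_scale \<psi> y"] by (rule neg)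
    have comm: "free_act ?U (fgen x * fgen y - fgen y * fgen x) = 0\<^sub>m n n"
      if "list_mult n (D x) (D y) = list_mult n (D y) (D x)" for x y
      unfolding free_act_diff prod that mult.commute[of "gen_scale \<psi> y"]
      by (rule minus_r_inv_mat) simp
    consider "r = fgen G1 * fgen G2 - fgen G2 * fgen G1"
      | "r = fgen G1 ^ (2 * N) - 1"
      | "r = fgen G2 ^ (2 * M) - 1"
      | "r = fgen G1 * fgen A1 + fgen A1 * fgen G1"
      | "r = fgen G1 * fgen A2 + fgen A2 * fgen G1"
      | "r = fgen G2 * fgen A1 - fgen A1 * fgen G2"
      | "r = fgen G2 * fgen A2 + fgen A2 * fgen G2"
      | "r = fgen A1 ^ 2 - fscal l1 * (1 - fgen G1 ^ 2)"
      | "r = fgen A2 ^ 2 - fscal l2 * (1 - fgen G2 ^ 2)"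
      | "r = fgen A1 * fgen A2 * fgen A1 * fgen A2 + fgen A2 * fgen A1 * fgen A2 * fgen A1
         - (fscal l3 * (1 - fgen G1 ^ 2 * fgen G2 ^ 2) - fscal (2 * l1 * l2) * (1 + fgen G2 ^ 2) * (1 - fgen G1 ^ 2))"
      using r by (auto simp: l Let_def)
    then show ?thesis
    proof cases
      case 1
      then show ?thesis using chk' comm by blast
    next
      case 2
      then show ?thesis
        using pow[OF _ sg(1), of N] \<psi>1(1) by (simp add: A free_act_power gen_scale_def minus_r_inv_mat[OF one_carrier_mat])
    next
      case 3
      then show ?thesis
        using pow[OF _ sg(2), of M] \<psi>1(2) by (simp add: A free_act_power gen_scale_def minus_r_inv_mat[OF one_carrier_mat])
    next
      case 4
      then show ?thesis using chk' anti by blast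
    next
      case 5
      then show ?thesis using chk' anti by blast
    next
      case 6
      then show ?thesis using chk' comm by blast
    next
      case 7
      then show ?thesis using chk' anti by blast
    next
      case 8
      have "free_act ?U r = 0\<^sub>m n n - (l1 \<cdot>\<^sub>m ?I) * (1\<^sub>m n - (?p * ?p) \<cdot>\<^sub>m ?I)"
        unfolding 8 using chk' sg by (simp add: A gen_scale_def list_mat_mult D L0)
      also have "\<dots> = s 0 - s l1 * (s 1 - s (?p * ?p))" by (simp only: s01(1) s01(2)[symmetric] s_def[of l1] s_def[of "?p * ?p"])
      also have "\<dots> = s (0 - l1 * (1 - ?p\<^sup>2))" by (simp only: s power2_eq_square)
      finally show ?thesis using \<psi>1 by (simp add: s01)
    next
      case 9
      have "free_act ?U r = 0\<^sub>m n n - (l2 \<cdot>\<^sub>m ?I) * (1\<^sub>m n - (?q * ?q) \<cdot>\<^sub>m ?I)"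
        unfolding 9 using chk' sg by (simp add: A gen_scale_def list_mat_mult D L0)
      also have "\<dots> = s 0 - s l2 * (s 1 - s (?q * ?q))" by (simp only: s01(1) s01(2)[symmetric] s_def[of l2] s_def[of "?q * ?q"])
      also have "\<dots> = s (0 - l2 * (1 - ?q\<^sup>2))" by (simp only: s power2_eq_square)
      finally show ?thesis using \<psi>1 by (simp add: s01)
    next
      case 10
      have 4: "free_act ?U (fgen x * fgen y * fgen x * fgen y) =
          ?L (list_mult n (list_mult n (D x) (D y)) (list_mult n (D x) (D y)))"
        if "x \<in> {A1, A2}" "y \<in> {A1, A2}" for x y
      proof -
        have e: "fgen x * fgen y * fgen x * fgen y = (fgen x * fgen y) * (fgen x * fgen y :: 'k free_alg)"
          by (simp add: mult.assoc)
        show ?thesis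
          unfolding e free_act_mult[OF wf_int_rep, of n D \<psi> "fgen x * fgen y" "fgen x * fgen y"] prod
          using that by (auto simp: gen_scale_def list_mat_mult D sq_list_mult)
      qed
      have "free_act ?U (fgen A1 * fgen A2 * fgen A1 * fgen A2 + fgen A2 * fgen A1 * fgen A2 * fgen A1) = 0\<^sub>m n n"
        using chk' by (simp add: free_act_add 4 LN sq_list_mult D)
      then have "free_act ?U r = 0\<^sub>m n n -
         ((l3 \<cdot>\<^sub>m ?I) * (1\<^sub>m n - ((?p * ?p) \<cdot>\<^sub>m ?I) * ((?q * ?q) \<cdot>\<^sub>m ?I))
          - ((2 * l1 * l2) \<cdot>\<^sub>m ?I) * (1\<^sub>m n + (?q * ?q) \<cdot>\<^sub>m ?I) * (1\<^sub>m n - (?p * ?p) \<cdot>\<^sub>m ?I))"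
        unfolding 10 free_act_diff[of _ "fgen A1 * fgen A2 * fgen A1 * fgen A2 + _"] using sg by (simp add: A gen_scale_def)
      also have "\<dots> = s 0 - (s l3 * (s 1 - s (?p * ?p) * s (?q * ?q)) - s (2 * l1 * l2) * (s 1 + s (?q * ?q)) * (s 1 - s (?p * ?p)))"
        by (simp only: s01(1) s01(2)[symmetric] s_def[of l3] s_def[of "?p * ?p"] s_def[of "?q * ?q"] s_def[of "2 * l1 * l2"])
      also have "\<dots> = s (0 - (l3 * (1 - ?p\<^sup>2 * ?q\<^sup>2) - 2 * l1 * l2 * (1 + ?q\<^sup>2) * (1 - ?p\<^sup>2)))"
        by (simp only: s power2_eq_square)
      finally show ?thesis using \<psi>1 by (simp add: s01)
    qed
  qed
  have "rel_ideal N M l \<subseteq> {p. free_act ?U p = 0\<^sub>m n n}"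
    by (rule rel_ideal_minimal)
      (use z in \<open>auto simp: free_act_0 free_act_add free_act_mult[OF wf_int_rep]
        right_mult_zero_mat[OF free_act_carrier[of ?U, simplified]] left_mult_zero_mat[OF free_act_carrier[of ?U, simplified]]\<close>)
  then show ?thesis by (auto simp: Rep_iff)
qed

section \<open>Endomorphisms of monomial modules\<close>

definition out_arrow :: "nat \<Rightarrow> int list list \<Rightarrow> nat \<Rightarrow> nat option" where
  "out_arrow n A s = find (\<lambda>t. (A ! t) ! s \<noteq> 0) [0..<n]"

definition in_arrow :: "nat \<Rightarrow> int list list \<Rightarrow> nat \<Rightarrow> nat option" where
  "in_arrow n A t = find (\<lambda>s. (A ! t) ! s \<noteq> 0) [0..<n]"

text \<open>The pattern of a weighted partial injection on vertices: \<open>out_arrow\<close> and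
  \<open>in_arrow\<close> are its two directions.\<close>

definition monomial :: "nat \<Rightarrow> int list list \<Rightarrow> bool" where
  "monomial n A \<longleftrightarrow> list_all (\<lambda>s. list_all (\<lambda>t. (A ! t) ! s \<noteq> 0 \<longrightarrow>
     out_arrow n A s = Some t \<and> in_arrow n A t = Some s) [0..<n]) [0..<n]"

definition sign_diag :: "nat \<Rightarrow> int list list \<Rightarrow> bool" where
  "sign_diag n A \<longleftrightarrow> list_all (\<lambda>i. list_all (\<lambda>j.
     if i = j then (A ! i) ! j = 1 \<or> (A ! i) ! j = - 1 else (A ! i) ! j = 0) [0..<n]) [0..<n]"

definition monomial_data :: "nat \<Rightarrow> (gen \<Rightarrow> int list list) \<Rightarrow> bool" where
  "monomial_data n D \<longleftrightarrow> sign_diag n (D G1) \<and> sign_diag n (D G2) \<and> monomial n (D A1) \<and> monomial n (D A2)"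

lemma out_arrow_Some: "out_arrow n A s = Some t \<Longrightarrow> t < n \<and> (A ! t) ! s \<noteq> 0"
  by (auto simp: out_arrow_def find_Some_iff)

lemma in_arrow_Some: "in_arrow n A t = Some s \<Longrightarrow> s < n \<and> (A ! t) ! s \<noteq> 0"
  by (auto simp: in_arrow_def find_Some_iff)

lemma monomialD:
  assumes "monomial n A" "s < n" "t < n" "(A ! t) ! s \<noteq> 0"
  shows "out_arrow n A s = Some t" "in_arrow n A t = Some s"
  using assms by (auto simp: monomial_def list_all_iff)

lemma sum_unique:
  fixes g :: "nat \<Rightarrow> 'a::comm_monoid_add"
  assumes "t < n" "\<And>k. k < n \<Longrightarrow> k \<noteq> t \<Longrightarrow> g k = 0"
  shows "(\<Sum>k<n. g k) = g t"
  using sum.mono_neutral_right[of "{..<n}" "{t}" g] assms by auto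

lemma monomial_col_sum:
  fixes h :: "nat \<Rightarrow> 'k::comm_ring_1"
  assumes "monomial n A" "s < n"
  shows "(\<Sum>k<n. h k * of_int ((A ! k) ! s)) =
    (case out_arrow n A s of None \<Rightarrow> 0 | Some t \<Rightarrow> h t * of_int ((A ! t) ! s))"
proof (cases "out_arrow n A s")
  case None
  then have "k < n \<Longrightarrow> (A ! k) ! s = 0" for k by (auto simp: out_arrow_def find_None_iff)
  then show ?thesis using None by simp
next
  case (Some t)
  then have "k < n \<Longrightarrow> k \<noteq> t \<Longrightarrow> (A ! k) ! s = 0" for k
    using monomialD(1)[OF assms] by fastforce
  then show ?thesis using out_arrow_Some[OF Some] Some by (simp add: sum_unique[of t])
qed

lemma monomial_row_sum:
  fixes h :: "nat \<Rightarrow> 'k::comm_ring_1"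
  assumes "monomial n A" "r < n"
  shows "(\<Sum>k<n. of_int ((A ! r) ! k) * h k) =
    (case in_arrow n A r of None \<Rightarrow> 0 | Some s \<Rightarrow> of_int ((A ! r) ! s) * h s)"
proof (cases "in_arrow n A r")
  case None
  then have "k < n \<Longrightarrow> (A ! r) ! k = 0" for k by (auto simp: in_arrow_def find_None_iff)
  then show ?thesis using None by simp
next
  case (Some t)
  then have "k < n \<Longrightarrow> k \<noteq> t \<Longrightarrow> (A ! r) ! k = 0" for k
    using monomialD(2)[OF assms(1) _ assms(2)] by fastforce
  then show ?thesis using in_arrow_Some[OF Some] Some by (simp add: sum_unique[of t])
qed

lemma int_rep_Hom_commute:
  assumes f: "f \<in> rep_Hom (int_rep n D \<psi>) (int_rep n D' \<psi>)" and rs: "r < n" "s < n"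
  shows "gen_scale \<psi> x * (\<Sum>k<n. f $$ (r, k) * of_int ((D x ! k) ! s)) =
    gen_scale \<psi> x * (\<Sum>k<n. of_int ((D' x ! r) ! k) * f $$ (k, s))"
proof -
  have fc: "f \<in> carrier_mat n n" using rep_Hom_carrier[OF f] by simp
  have "(f * ract (int_rep n D \<psi>) x) $$ (r, s) = (ract (int_rep n D' \<psi>) x * f) $$ (r, s)"
    using rep_Hom_commute[OF f] by simp
  then show ?thesis
    using fc rs by (simp add: scalar_prod_def list_mat_def sum_distrib_left lessThan_atLeast0 mult_ac)
qed

text \<open>One entry of the identity \<open>f a = a f\<close>: since both arrow matrices are
  monomial, each of its two sums has at most one term.\<close>

lemma arrow_eq:
  assumes f: "f \<in> rep_Hom (int_rep n D \<psi>) (int_rep n D' \<psi>)" and rs: "r < n" "s < n"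
    and m: "monomial_data n D" "monomial_data n D'" and x: "x = A1 \<or> x = A2"
  shows "(case out_arrow n (D x) s of None \<Rightarrow> 0 | Some t \<Rightarrow> f $$ (r, t) * of_int ((D x ! t) ! s)) =
    (case in_arrow n (D' x) r of None \<Rightarrow> 0 | Some q \<Rightarrow> of_int ((D' x ! r) ! q) * f $$ (q, s))"
proof -
  have m': "monomial n (D x)" "monomial n (D' x)" and g: "gen_scale \<psi> x = 1"
    using m x by (auto simp: monomial_data_def gen_scale_def)
  show ?thesis
    using int_rep_Hom_commute[OF f rs, of x] monomial_col_sum[OF m'(1) rs(2), of "\<lambda>k. f $$ (r, k)"]
      monomial_row_sum[OF m'(2) rs(1), of "\<lambda>k. f $$ (k, s)"]
    by (simp add: g)
qed

text \<open>Commuting with \<open>a\<^sub>1\<close> and \<open>a\<^sub>2\<close> identifies, up to units, the entries of a homomorphism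
  along diagonals; such a diagonal vanishes once an arrow exists on one side only.  At each
  vertex the arrows of the two letters alternate, so that the walk never turns back.\<close>

fun zero_walk ::
  "nat \<Rightarrow> (gen \<Rightarrow> int list list) \<Rightarrow> (gen \<Rightarrow> int list list) \<Rightarrow> nat \<Rightarrow> gen \<Rightarrow> nat \<Rightarrow> nat \<Rightarrow> bool" where
  "zero_walk n D' D 0 x r s = False"
| "zero_walk n D' D (Suc k) x r s =
    (case out_arrow n (D' x) r of
       Some r' \<Rightarrow> (case out_arrow n (D x) s of None \<Rightarrow> True
         | Some t \<Rightarrow> zero_walk n D' D k (if x = A1 then A2 else A1) r' t)
     | None \<Rightarrow> (case in_arrow n (D x) s of None \<Rightarrow> False
         | Some s' \<Rightarrow> (case in_arrow n (D' x) r of None \<Rightarrow> True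
            | Some r' \<Rightarrow> zero_walk n D' D k (if x = A1 then A2 else A1) r' s')))"

text \<open>Different types under the group force zero at once; otherwise the walk may start with
  either letter. The bound \<open>n\<close> is fuel only: when it runs out, no vanishing is
  claimed.\<close>

definition zero_pair ::
  "nat \<Rightarrow> (gen \<Rightarrow> int list list) \<Rightarrow> (gen \<Rightarrow> int list list) \<Rightarrow> nat \<Rightarrow> nat \<Rightarrow> bool" where
  "zero_pair n D' D r s \<longleftrightarrow> (D' G1 ! r) ! r \<noteq> (D G1 ! s) ! s \<or> (D' G2 ! r) ! r \<noteq> (D G2 ! s) ! s \<or>
     zero_walk n D' D n A1 r s \<or> zero_walk n D' D n A2 r s"

lemma zero_walk_sound:
  fixes \<psi> :: "'k::{field, ring_char_0} \<times> 'k"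
  assumes f: "f \<in> rep_Hom (int_rep n D \<psi>) (int_rep n D' \<psi>)"
    and m: "monomial_data n D" "monomial_data n D'"
  shows "zero_walk n D' D k x r s \<Longrightarrow> x = A1 \<or> x = A2 \<Longrightarrow> r < n \<Longrightarrow> s < n \<Longrightarrow> f $$ (r, s) = 0"
proof (induction k arbitrary: x r s)
  case (Suc k)
  note x = Suc.prems(2) and rs = Suc.prems(3,4)
  have m': "monomial n (D x)" "monomial n (D' x)"
    using m x by (auto simp: monomial_data_def)
  have IH: "zero_walk n D' D k (if x = A1 then A2 else A1) r' s' \<Longrightarrow> r' < n \<Longrightarrow> s' < n \<Longrightarrow> f $$ (r', s') = 0" for r' s'
    using Suc.IH[of "if x = A1 then A2 else A1" r' s'] by (auto split: if_splits)
  show ?case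
  proof (cases "out_arrow n (D' x) r")
    case (Some r')
    \<comment> \<open>Use position \<open>(r', s)\<close> of the intertwining identity: the side of
      \<open>D'\<close> is \<open>f $$ (r, s)\<close> times a nonzero weight, and the side of
      \<open>D\<close> vanishes, for lack of an arrow or by induction.\<close>
    have r': "r' < n" "(D' x ! r') ! r \<noteq> 0" using out_arrow_Some[OF Some] by auto
    have i: "in_arrow n (D' x) r' = Some r" using monomialD(2)[OF m'(2) rs(1) r'] .
    have "(case out_arrow n (D x) s of None \<Rightarrow> 0 | Some t \<Rightarrow> f $$ (r', t) * of_int ((D x ! t) ! s)) = 0"
      using Suc.prems(1) Some IH[OF _ r'(1)] out_arrow_Some[of n "D x" s] by (auto split: option.splits)
    then show ?thesis using arrow_eq[OF f r'(1) rs(2) m x] r'(2) by (simp add: i)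
  next
    case None
    then obtain s' where s: "in_arrow n (D x) s = Some s'"
      using Suc.prems(1) by (auto split: option.splits)
    \<comment> \<open>The mirror image at position \<open>(r, s')\<close>: now the side of
      \<open>D\<close> contains \<open>f $$ (r, s)\<close> and the side of \<open>D'\<close>
      vanishes.\<close>
    have s': "s' < n" "(D x ! s) ! s' \<noteq> 0" using in_arrow_Some[OF s] by auto
    have o: "out_arrow n (D x) s' = Some s" using monomialD(1)[OF m'(1) s'(1) rs(2) s'(2)] .
    have "(case in_arrow n (D' x) r of None \<Rightarrow> 0 | Some q \<Rightarrow> of_int ((D' x ! r) ! q) * f $$ (q, s')) = 0"
      using Suc.prems(1) None s IH[OF _ _ s'(1)] in_arrow_Some[of n "D' x" r] by (auto split: option.splits)
    then show ?thesis using arrow_eq[OF f rs(1) s'(1) m x] s'(2) by (simp add: o)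
  qed
qed simp

lemma sign_diagD:
  assumes "sign_diag n A" "i < n" "j < n"
  shows "i \<noteq> j \<Longrightarrow> (A ! i) ! j = 0" "(A ! i) ! i = 1 \<or> (A ! i) ! i = - 1"
  using assms by (auto simp: sign_diag_def list_all_iff)

lemma zero_pair_sound:
  fixes \<psi> :: "'k::{field, ring_char_0} \<times> 'k"
  assumes f: "f \<in> rep_Hom (int_rep n D \<psi>) (int_rep n D' \<psi>)"
    and m: "monomial_data n D" "monomial_data n D'" and \<psi>: "fst \<psi> \<noteq> 0" "snd \<psi> \<noteq> 0"
    and z: "zero_pair n D' D r s" and rs: "r < n" "s < n"
  shows "f $$ (r, s) = 0"
proof -
  have g: "f $$ (r, s) = 0" if x: "x = G1 \<or> x = G2" and ne: "(D' x ! r) ! r \<noteq> (D x ! s) ! s" for x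
  proof -
    have d: "sign_diag n (D x)" "sign_diag n (D' x)" and c: "gen_scale \<psi> x \<noteq> 0"
      using m x \<psi> by (auto simp: monomial_data_def gen_scale_def)
    have "(\<Sum>k<n. f $$ (r, k) * of_int ((D x ! k) ! s)) =
        (\<Sum>k<n. if k = s then f $$ (r, s) * of_int ((D x ! s) ! s) else 0)"
      using sign_diagD(1)[OF d(1) _ rs(2)] by (intro sum.cong) auto
    moreover have "(\<Sum>k<n. of_int ((D' x ! r) ! k) * f $$ (k, s)) =
        (\<Sum>k<n. if k = r then of_int ((D' x ! r) ! r) * f $$ (r, s) else 0)"
      using sign_diagD(1)[OF d(2) rs(1)] by (intro sum.cong) auto
    ultimately have "f $$ (r, s) * of_int ((D x ! s) ! s) = of_int ((D' x ! r) ! r) * f $$ (r, s)"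
      using int_rep_Hom_commute[OF f rs, of x] c rs by simp
    then have "f $$ (r, s) * of_int ((D x ! s) ! s - (D' x ! r) ! r) = 0"
      by (simp add: algebra_simps)
    then show ?thesis using ne by simp
  qed
  show ?thesis
    using z zero_walk_sound[OF f m, of _ _ r s] g[of G1] g[of G2] rs unfolding zero_pair_def by blast
qed

definition linked :: "nat \<Rightarrow> (gen \<Rightarrow> int list list) \<Rightarrow> bool" where
  "linked n D \<longleftrightarrow> list_all (\<lambda>k. list_ex (\<lambda>x. out_arrow n (D x) k = Some (Suc k) \<or>
     out_arrow n (D x) (Suc k) = Some k) [A1, A2]) [0..<n - 1]"

text \<open>An arrow from \<open>s\<close> to \<open>t\<close> with weight \<open>c\<close> gives
  \<open>f_tt c = c f_ss\<close>, and \<open>c\<close> is nonzero. Consecutive vertices are joined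
  by arrows, so the equality spreads from vertex 0.\<close>

lemma linked_diag:
  fixes \<psi> :: "'k::{field, ring_char_0} \<times> 'k"
  assumes f: "f \<in> rep_Hom (int_rep n D \<psi>) (int_rep n D \<psi>)"
    and m: "monomial_data n D" and l: "linked n D" and i: "i < n"
  shows "f $$ (i, i) = f $$ (0, 0)"
  using i
proof (induction i)
  case (Suc i)
  have e: "f $$ (t, t) = f $$ (s, s)"
    if x: "x = A1 \<or> x = A2" and o: "out_arrow n (D x) s = Some t" and s: "s < n" for x s t
  proof -
    have t: "t < n" "(D x ! t) ! s \<noteq> 0" using out_arrow_Some[OF o] by auto
    have "monomial n (D x)" using m x by (auto simp: monomial_data_def)
    then have "in_arrow n (D x) t = Some s" using monomialD(2) s t by blast
    then show ?thesis using arrow_eq[OF f t(1) s m m x] o t(2) by simp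
  qed
  have "\<exists>x. (x = A1 \<or> x = A2) \<and> (out_arrow n (D x) i = Some (Suc i) \<or> out_arrow n (D x) (Suc i) = Some i)"
    using l Suc.prems by (auto simp: linked_def list_all_iff)
  then obtain x where "x = A1 \<or> x = A2" "out_arrow n (D x) i = Some (Suc i) \<or> out_arrow n (D x) (Suc i) = Some i"
    by blast
  then have "f $$ (Suc i, Suc i) = f $$ (i, i)"
    using e[of x i "Suc i"] e[of x "Suc i" i] Suc.prems by auto
  then show ?case using Suc by simp
qed simp

definition sign_sum :: "nat \<Rightarrow> (gen \<Rightarrow> int list list) \<Rightarrow> int" where
  "sign_sum n D = sum_list (map (\<lambda>i. (D G1 ! i) ! i) [0..<n])"

lemma mat_diag_pow: "mat_diag n f ^\<^sub>m k = mat_diag n (\<lambda>i. f i ^ k :: 'k::comm_ring_1)"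
proof (induction k)
  case 0
  show ?case by (rule eq_matI) (auto simp: mat_diag_def)
next
  case (Suc k)
  then show ?case by (simp add: mult.commute)
qed

text \<open>The matrix of \<open>g1^N\<close> is diagonal, so only the constant diagonal of
  \<open>f\<close> counts. A sign satisfies \<open>s^N = s\<close> for odd \<open>N\<close>, which
  leaves a number that is computed once for all \<open>N\<close>.\<close>

lemma qtr_linked:
  fixes \<psi> :: "'k::{field, ring_char_0} \<times> 'k"
  assumes f: "f \<in> rep_Hom (int_rep n D \<psi>) (int_rep n D \<psi>)"
    and m: "monomial_data n D" and l: "linked n D" and N: "odd N"
  shows "qtr N (int_rep n D \<psi>) f = f $$ (0, 0) * (fst \<psi> ^ N * of_int (sign_sum n D))"
proof -
  have fc: "f \<in> carrier_mat n n" using rep_Hom_carrier[OF f] by simp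
  have d: "sign_diag n (D G1)" using m by (simp add: monomial_data_def)
  have "ract (int_rep n D \<psi>) G1 = mat_diag n (\<lambda>i. fst \<psi> * of_int ((D G1 ! i) ! i))"
    using sign_diagD(1)[OF d] by (intro eq_matI) (auto simp: mat_diag_def gen_scale_def list_mat_def)
  then have "qtr N (int_rep n D \<psi>) f =
      (\<Sum>i<n. (f * mat_diag n (\<lambda>i. (fst \<psi> * of_int ((D G1 ! i) ! i)) ^ N)) $$ (i, i))"
    by (simp add: qtr_conv mat_diag_pow del: int_rep_simps(2))
  also have "\<dots> = (\<Sum>i<n. f $$ (0, 0) * (fst \<psi> ^ N * of_int ((D G1 ! i) ! i)))"
  proof (rule sum.cong)
    fix i assume i: "i \<in> {..<n}"
    have "((of_int ((D G1 ! i) ! i)) :: 'k) ^ N = of_int ((D G1 ! i) ! i)"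
      using sign_diagD(2)[OF d, of i i] i N by auto
    then show "(f * mat_diag n (\<lambda>i. (fst \<psi> * of_int ((D G1 ! i) ! i)) ^ N)) $$ (i, i) =
        f $$ (0, 0) * (fst \<psi> ^ N * of_int ((D G1 ! i) ! i))"
      using i linked_diag[OF f m l, of i] by (simp add: mat_diag_mult_right[OF fc] power_mult_distrib)
  qed simp
  also have "\<dots> = f $$ (0, 0) * (fst \<psi> ^ N * of_int (sign_sum n D))"
    by (simp add: sign_sum_def sum_list_sum_nth lessThan_atLeast0 sum_distrib_left)
  finally show ?thesis .
qed

definition null_check :: "nat \<Rightarrow> (gen \<Rightarrow> int list list) \<Rightarrow> bool" where
  "null_check n D \<longleftrightarrow> monomial_data n D \<and> linked n D \<and> sign_sum n D = 0"

lemma null_check_qtr_null: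
  fixes \<psi> :: "'k::{field, ring_char_0} \<times> 'k"
  assumes "null_check n D" "odd N"
  shows "qtr_null N (int_rep n D \<psi>)"
  using assms by (auto simp: qtr_null_def null_check_def qtr_linked)

text \<open>\<open>Z\<close> lists the off-diagonal positions that may be nonzero. That no column
  index in it is also a row index makes every product of two off-diagonal entries vanish, a termwise
  form of square zero.\<close>

definition local_check :: "nat \<Rightarrow> (gen \<Rightarrow> int list list) \<Rightarrow> bool" where
  "local_check n D \<longleftrightarrow> n > 0 \<and> monomial_data n D \<and> linked n D \<and> sign_sum n D \<noteq> 0 \<and>
     (let Z = filter (\<lambda>(r, s). r \<noteq> s \<and> \<not> zero_pair n D D r s) (List.product [0..<n] [0..<n])
      in list_all (\<lambda>p. list_all (\<lambda>q. snd p \<noteq> fst q) Z) Z)"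

lemma local_check_local_rep:
  fixes \<psi> :: "'k::{field, ring_char_0} \<times> 'k"
  assumes chk: "local_check n D" and N: "odd N" and \<psi>: "fst \<psi> \<noteq> 0" "snd \<psi> \<noteq> 0"
  shows "local_rep N (int_rep n D \<psi>)"
proof -
  let ?U = "int_rep n D \<psi>"
  have n: "n > 0" and m: "monomial_data n D" and l: "linked n D" and ss: "sign_sum n D \<noteq> 0"
    using chk by (auto simp: local_check_def)
  have one: "1\<^sub>m n \<in> rep_Hom ?U ?U" using rep_Hom_one[OF wf_int_rep, of n D \<psi>] by simp
  have q: "qtr N ?U f = f $$ (0, 0) * (fst \<psi> ^ N * of_int (sign_sum n D))" if "f \<in> rep_Hom ?U ?U" for f
    using qtr_linked[OF that m l N] .
  have q1: "qtr N ?U (1\<^sub>m n) \<noteq> 0" using q[OF one] n ss \<psi> by simp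
  have "(qtr N ?U f \<noteq> 0 \<longrightarrow> (\<exists>g \<in> rep_Hom ?U ?U. f * g = 1\<^sub>m n)) \<and>
        (f * f = f \<longrightarrow> f = 0\<^sub>m n n \<or> f = 1\<^sub>m n)" if f: "f \<in> rep_Hom ?U ?U" for f
  proof -
    have fc: "f \<in> carrier_mat n n" using rep_Hom_carrier[OF f] by simp
    define c where "c = f $$ (0, 0)"
    define h where "h r s = (if r = s then 0 else f $$ (r, s))" for r s
    have fh: "f $$ (r, s) = (if r = s then c else 0) + h r s" if "r < n" "s < n" for r s
      using linked_diag[OF f m l, of r] that by (auto simp: c_def h_def)
    have hh: "h r k * h k s = 0" if "r < n" "k < n" "s < n" for r k s
    proof -
      define Z where "Z = filter (\<lambda>(r, s). r \<noteq> s \<and> \<not> zero_pair n D D r s) (List.product [0..<n] [0..<n])"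
      have Z: "\<forall>p \<in> set Z. \<forall>q \<in> set Z. snd p \<noteq> fst q"
        using chk unfolding local_check_def Let_def Z_def list_all_iff by blast
      have "(a, b) \<in> set Z" if "a < n" "b < n" "a \<noteq> b" "\<not> zero_pair n D D a b" for a b
        using that by (simp add: Z_def)
      then have "\<not> (r \<noteq> k \<and> \<not> zero_pair n D D r k \<and> k \<noteq> s \<and> \<not> zero_pair n D D k s)"
        using Z that by (metis fst_conv snd_conv)
      then show ?thesis using zero_pair_sound[OF f m m \<psi>] that by (auto simp: h_def)
    qed
    show ?thesis
    proof (intro conjI impI)
      assume "qtr N ?U f \<noteq> 0"
      then have c: "c \<noteq> 0" using q[OF f] by (auto simp: c_def)
      \<comment> \<open>For \<open>f = c + h\<close> with \<open>h^2 = 0\<close> the inverse is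
        \<open>(c - h) / c^2\<close>.\<close>
      define g where "g = mat n n (\<lambda>(r, s). ((if r = s then c else 0) - h r s) / (c * c))"
      have gc: "g \<in> carrier_mat n n" by (simp add: g_def)
      have fg: "f * g = 1\<^sub>m n"
      proof (rule eq_matI)
        fix r s assume "r < dim_row (1\<^sub>m n :: 'k mat)" "s < dim_col (1\<^sub>m n :: 'k mat)"
        then have rs: "r < n" "s < n" by auto
        have "(f * g) $$ (r, s) = (\<Sum>k = 0..<n. f $$ (r, k) * g $$ (k, s))"
          using fc gc rs by (simp add: scalar_prod_def)
        also have "\<dots> = (\<Sum>k = 0..<n. (if k = r then c * (((if r = s then c else 0) - h r s) / (c * c)) else 0)
            + (if k = s then h r s * (c / (c * c)) else 0))"
        proof (rule sum.cong)
          fix k assume "k \<in> {0..<n}"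
          then have k: "k < n" by simp
          show "f $$ (r, k) * g $$ (k, s) = (if k = r then c * (((if r = s then c else 0) - h r s) / (c * c)) else 0)
            + (if k = s then h r s * (c / (c * c)) else 0)"
            using hh[OF rs(1) k rs(2)] k rs by (auto simp: fh g_def distrib_right right_diff_distrib diff_divide_distrib)
        qed simp
        also have "\<dots> = 1\<^sub>m n $$ (r, s)"
          using rs c by (auto simp: sum.distrib diff_divide_distrib right_diff_distrib)
        finally show "(f * g) $$ (r, s) = 1\<^sub>m n $$ (r, s)" .
      qed (use fc gc in auto)
      have gf: "g * f = 1\<^sub>m n" using mat_mult_left_right_inverse[OF fc gc fg] .
      have "g \<in> rep_Hom ?U ?U"
        using inverse_rep_Hom[OF wf_int_rep wf_int_rep f] gc fg gf by simp
      with fg show "\<exists>g \<in> rep_Hom ?U ?U. f * g = 1\<^sub>m n" by blast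
    next
      assume ff: "f * f = f"
      \<comment> \<open>This is \<open>f^2 = c^2 + 2 c h\<close>. Comparison with
        \<open>f = c + h\<close> leaves \<open>c = 0\<close> or \<open>c = 1\<close>, and in either
        case \<open>h = 0\<close>.\<close>
      have e: "f $$ (r, s) = (if r = s then c * c else 0) + 2 * c * h r s" if rs: "r < n" "s < n" for r s
      proof -
        have "f $$ (r, s) = (\<Sum>k = 0..<n. f $$ (r, k) * f $$ (k, s))"
          using arg_cong[OF ff, of "\<lambda>A. A $$ (r, s)"] fc rs by (simp add: scalar_prod_def)
        also have "\<dots> = (\<Sum>k = 0..<n. (if k = r then c * ((if r = s then c else 0) + h r s) else 0)
            + (if k = s then h r s * c else 0))"
        proof (rule sum.cong)
          fix k assume "k \<in> {0..<n}"
          then have k: "k < n" by simp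
          show "f $$ (r, k) * f $$ (k, s) = (if k = r then c * ((if r = s then c else 0) + h r s) else 0)
            + (if k = s then h r s * c else 0)"
            using hh[OF rs(1) k rs(2)] k rs by (auto simp: fh algebra_simps)
        qed simp
        also have "\<dots> = (if r = s then c * c else 0) + 2 * c * h r s"
          using rs by (auto simp: sum.distrib algebra_simps)
        finally show ?thesis .
      qed
      have "c * c = c" using e[OF n n] by (simp add: c_def h_def)
      then consider "c = 0" | "c = 1" by auto
      then show "f = 0\<^sub>m n n \<or> f = 1\<^sub>m n"
      proof cases
        case 1
        then have "f = 0\<^sub>m n n" using fc e by (intro eq_matI) auto
        then show ?thesis ..
      next
        case 2
        have "h r s = 0" if "r < n" "s < n" for r s
          using e[OF that] fh[OF that] 2 by (simp split: if_splits)
        then have "f = 1\<^sub>m n" using fc fh 2 by (intro eq_matI) auto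
        then show ?thesis ..
      qed
    qed
  qed
  then show ?thesis using q1 by (simp add: local_rep_def)
qed

text \<open>For inverse maps \<open>f\<close> and \<open>g\<close> the entry of \<open>f g\<close>
  at \<open>(0, 0)\<close> is 1; the check asks that every summand \<open>f_0s g_s0\<close> have a
  factor that must vanish.\<close>

definition noniso_check :: "nat \<Rightarrow> (gen \<Rightarrow> int list list) \<Rightarrow> (gen \<Rightarrow> int list list) \<Rightarrow> bool" where
  "noniso_check n D D' \<longleftrightarrow> n > 0 \<and> list_all (\<lambda>s. zero_pair n D' D 0 s \<or> zero_pair n D D' s 0) [0..<n]"

lemma noniso_check_not_iso:
  fixes \<psi> :: "'k::{field, ring_char_0} \<times> 'k"
  assumes chk: "noniso_check n D D'" and m: "monomial_data n D" "monomial_data n D'" and \<psi>: "fst \<psi> \<noteq> 0" "snd \<psi> \<noteq> 0"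
  shows "\<not> mat_iso (int_rep n D \<psi>) (int_rep n D' \<psi>)"
proof
  assume "mat_iso (int_rep n D \<psi>) (int_rep n D' \<psi>)"
  then obtain f g where f: "f \<in> rep_Hom (int_rep n D \<psi>) (int_rep n D' \<psi>)"
    and g: "g \<in> rep_Hom (int_rep n D' \<psi>) (int_rep n D \<psi>)" and fg: "f * g = 1\<^sub>m n"
    by (auto simp: mat_iso_def)
  have n: "n > 0" using chk by (auto simp: noniso_check_def)
  have c: "f \<in> carrier_mat n n" "g \<in> carrier_mat n n"
    using rep_Hom_carrier[OF f] rep_Hom_carrier[OF g] by simp_all
  have "f $$ (0, k) * g $$ (k, 0) = 0" if "k < n" for k
  proof -
    have "zero_pair n D' D 0 k \<or> zero_pair n D D' k 0"
      using chk that by (simp add: noniso_check_def list_all_iff)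
    then show ?thesis
      using zero_pair_sound[OF f m \<psi> _ n that] zero_pair_sound[OF g m(2,1) \<psi> _ that n] by auto
  qed
  then have "(f * g) $$ (0, 0) = 0" using c n by (auto simp: scalar_prod_def intro!: sum.neutral)
  then show False using fg n by simp
qed

section \<open>Sums and tensor products of integer data\<close>

definition list_sum :: "nat \<Rightarrow> nat \<Rightarrow> (gen \<Rightarrow> int list list) \<Rightarrow> (gen \<Rightarrow> int list list) \<Rightarrow> gen \<Rightarrow> int list list"
  where
  "list_sum n m D D' x = map (\<lambda>r. r @ replicate m 0) (D x) @ map (\<lambda>r. replicate n 0 @ r) (D' x)"

lemma rep_sum_int_rep:
  assumes "sq_data n D" "sq_data m D'"
  shows "rep_sum (int_rep n D \<psi>) (int_rep m D' \<psi>) = int_rep (n + m) (list_sum n m D D') \<psi>"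
proof -
  have "four_block_mat (gen_scale \<psi> x \<cdot>\<^sub>m list_mat n (D x)) (0\<^sub>m n m) (0\<^sub>m m n) (gen_scale \<psi> x \<cdot>\<^sub>m list_mat m (D' x)) =
      gen_scale \<psi> x \<cdot>\<^sub>m list_mat (n + m) (list_sum n m D D' x)" for x
    using sq_listD[OF sq_dataD[OF assms(1)]] sq_listD[OF sq_dataD[OF assms(2)]]
    by (intro eq_matI) (auto simp: list_mat_def list_sum_def nth_append)
  then show ?thesis by (simp add: rep_sum_def int_rep_def)
qed

text \<open>The lexicographic order of \<open>List.product\<close> is the index order
  \<open>i * m + k\<close> of \<open>kron\<close>.\<close>

definition list_kron :: "nat \<Rightarrow> nat \<Rightarrow> int list list \<Rightarrow> int list list \<Rightarrow> int list list" where
  "list_kron n m A B = (let P = List.product [0..<n] [0..<m] in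
     map (\<lambda>(i, k). map (\<lambda>(j, l). (A ! i) ! j * (B ! k) ! l) P) P)"

definition list_add :: "int list list \<Rightarrow> int list list \<Rightarrow> int list list" where
  "list_add A B = map2 (map2 (+)) A B"

definition list_tensor ::
  "nat \<Rightarrow> nat \<Rightarrow> (gen \<Rightarrow> int list list) \<Rightarrow> (gen \<Rightarrow> int list list) \<Rightarrow> gen \<Rightarrow> int list list" where
  "list_tensor n m D D' x = (case x of
      G1 \<Rightarrow> list_kron n m (D G1) (D' G1)
    | G2 \<Rightarrow> list_kron n m (D G2) (D' G2)
    | A1 \<Rightarrow> list_add (list_kron n m (D A1) (list_scal m 1)) (list_kron n m (D G1) (D' A1))
    | A2 \<Rightarrow> list_add (list_kron n m (D A2) (list_scal m 1)) (list_kron n m (D G2) (D' A2)))"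

lemma list_kron_nth:
  assumes "p < n * m" "q < n * m"
  shows "list_kron n m A B ! p ! q = (A ! (p div m)) ! (q div m) * (B ! (p mod m)) ! (q mod m)"
proof -
  have "0 < m" using assms by (cases "m = 0") auto
  then have "p mod m < m" "q mod m < m" by simp_all
  with assms show ?thesis
    by (auto simp: list_kron_def Let_def product_nth less_mult_imp_div_less mult.commute[of m] split: prod.splits)
qed

lemma list_kron_length:
  "length (list_kron n m A B) = n * m" "p < n * m \<Longrightarrow> length (list_kron n m A B ! p) = n * m"
  by (auto simp: list_kron_def Let_def split: prod.splits)

text \<open>The factors \<open>\<chi>\<^sub>1\<close> and \<open>\<chi>\<^sub>2\<close> that enter the tensor product through \<open>g\<^sub>i \<otimes> a\<^sub>i\<close> are absorbed by
  rescaling the basis \<open>e\<^sub>j\<close> of the second tensorand by \<open>d j\<close>.\<close>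

lemma rep_tensor_int_rep:
  fixes \<chi> \<phi> :: "'k::field \<times> 'k"
  assumes D: "sq_data n D" "sq_data m D'"
    and d: "\<And>j. j < m \<Longrightarrow> d j \<noteq> 0"
    and d0: "\<And>i j. i < m \<Longrightarrow> j < m \<Longrightarrow> i \<noteq> j \<Longrightarrow> (D' G1 ! i) ! j = 0 \<and> (D' G2 ! i) ! j = 0"
    and d1: "\<And>i j. i < m \<Longrightarrow> j < m \<Longrightarrow> (D' A1 ! i) ! j \<noteq> 0 \<Longrightarrow> fst \<chi> * d i = d j"
    and d2: "\<And>i j. i < m \<Longrightarrow> j < m \<Longrightarrow> (D' A2 ! i) ! j \<noteq> 0 \<Longrightarrow> snd \<chi> * d i = d j"
  shows "mat_iso (rep_tensor (int_rep n D \<chi>) (int_rep m D' \<phi>)) (int_rep (n * m) (list_tensor n m D D') (cmul \<chi> \<phi>))"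
proof -
  let ?U = "rep_tensor (int_rep n D \<chi>) (int_rep m D' \<phi>)"
  let ?V = "int_rep (n * m) (list_tensor n m D D') (cmul \<chi> \<phi>)"
  let ?K = "mat_diag (n * m) (\<lambda>p. d (p mod m))"
  have rU: "rdim ?U = n * m" by (simp add: rep_tensor_def)
  have wU: "wf_rep ?U"
    unfolding wf_rep_def by (auto simp: rep_tensor_def kron_def split: gen.splits)
  have "?K * ract ?U x = ract ?V x * ?K" for x
  proof (rule eq_matI)
    have Uc: "ract ?U x \<in> carrier_mat (n * m) (n * m)" using wf_repD[OF wU, of x] by (simp add: rU)
    have Vc: "ract ?V x \<in> carrier_mat (n * m) (n * m)" by simp
    fix p q assume "p < dim_row (ract ?V x * ?K)" "q < dim_col (ract ?V x * ?K)"
    then have pq: "p < n * m" "q < n * m" by (auto simp: mat_diag_def)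
    then have m: "m > 0" by (cases "m = 0") auto
    have ij: "p div m < n" "q div m < n" "p mod m < m" "q mod m < m"
      using pq m by (auto simp: less_mult_imp_div_less)
    have "d (p mod m) * ract ?U x $$ (p, q) = ract ?V x $$ (p, q) * d (q mod m)"
      using pq ij m d0[OF ij(3,4)] d1[OF ij(3,4)] d2[OF ij(3,4)]
      by (cases x; cases "(D' x ! (p mod m)) ! (q mod m) = 0"; cases "p mod m = q mod m")
        (auto simp: rep_tensor_def kron_def list_tensor_def list_mat_def list_kron_nth list_kron_length gen_scale_def cmul_def
          list_add_def list_scal_def algebra_simps)
    then show "(?K * ract ?U x) $$ (p, q) = (ract ?V x * ?K) $$ (p, q)"
      using pq by (simp only: mat_diag_mult_left[OF Uc] mat_diag_mult_right[OF Vc] index_mat(1) prod.case)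
  qed (use wf_repD[OF wU, of x] rU in \<open>auto simp: mat_diag_def\<close>)
  then have K: "?K \<in> rep_Hom ?U ?V" by (intro rep_HomI) (simp_all add: rU)
  have "?K * mat_diag (n * m) (\<lambda>p. inverse (d (p mod m))) = mat_diag (n * m) (\<lambda>p. d (p mod m) * inverse (d (p mod m)))"
    by simp
  also have "\<dots> = 1\<^sub>m (n * m)"
  proof (rule eq_matI)
    fix p q assume "p < dim_row (1\<^sub>m (n * m) :: 'k mat)" "q < dim_col (1\<^sub>m (n * m) :: 'k mat)"
    then have pq: "p < n * m" "q < n * m" by auto
    then have "m > 0" by (cases "m = 0") auto
    then show "mat_diag (n * m) (\<lambda>p. d (p mod m) * inverse (d (p mod m))) $$ (p, q) = 1\<^sub>m (n * m) $$ (p, q)"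
      using pq d by (simp add: mat_diag_def)
  qed (simp_all add: mat_diag_def)
  finally show ?thesis
    using mat_isoI[OF wU wf_int_rep _ K, of "mat_diag (n * m) (\<lambda>p. inverse (d (p mod m)))"] by (simp add: rU)
qed

section \<open>The modules of the theorem\<close>

definition m3_data :: "nat \<Rightarrow> gen \<Rightarrow> int list list" where
  "m3_data i x =
    (if i = 1 then (case x of G1 \<Rightarrow> [[1, 0, 0], [0, - 1, 0], [0, 0, 1]]
       | G2 \<Rightarrow> [[1, 0, 0], [0, 1, 0], [0, 0, - 1]]
       | A1 \<Rightarrow> [[0, 1, 0], [0, 0, 0], [0, 0, 0]] | A2 \<Rightarrow> [[0, 0, 0], [0, 0, 1], [0, 0, 0]])
     else if i = 2 then (case x of G1 \<Rightarrow> [[1, 0, 0], [0, - 1, 0], [0, 0, 1]]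
       | G2 \<Rightarrow> [[1, 0, 0], [0, 1, 0], [0, 0, - 1]]
       | A1 \<Rightarrow> [[0, 1, 0], [0, 0, 0], [0, 0, 0]] | A2 \<Rightarrow> [[0, 0, 0], [0, 0, 0], [0, 1, 0]])
     else if i = 3 then (case x of G1 \<Rightarrow> [[1, 0, 0], [0, - 1, 0], [0, 0, - 1]]
       | G2 \<Rightarrow> [[1, 0, 0], [0, 1, 0], [0, 0, - 1]]
       | A1 \<Rightarrow> [[0, 1, 0], [0, 0, 0], [0, 0, 0]] | A2 \<Rightarrow> [[0, 0, 1], [0, 0, 0], [0, 0, 0]])
     else (case x of G1 \<Rightarrow> [[1, 0, 0], [0, 1, 0], [0, 0, - 1]]
       | G2 \<Rightarrow> [[1, 0, 0], [0, - 1, 0], [0, 0, - 1]]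
       | A1 \<Rightarrow> [[0, 0, 0], [0, 0, 0], [0, 1, 0]] | A2 \<Rightarrow> [[0, 0, 1], [0, 0, 0], [0, 0, 0]]))"

definition point_data :: "int \<Rightarrow> int \<Rightarrow> gen \<Rightarrow> int list list" where
  "point_data s t x = (case x of G1 \<Rightarrow> [[s]] | G2 \<Rightarrow> [[t]] | A1 \<Rightarrow> [[0]] | A2 \<Rightarrow> [[0]])"

text \<open>The module \<open>C2\<close> with \<open>\<mu> = c\<close>. The sign
  \<open>t = - 1\<close> encodes the type \<open>cneg (cbar \<psi>)\<close>, which differs from
  \<open>\<psi>\<close> only in \<open>g2\<close>.\<close>

definition band_data :: "int \<Rightarrow> int \<Rightarrow> gen \<Rightarrow> int list list" where
  "band_data c t x = (case x of
      G1 \<Rightarrow> [[1, 0, 0, 0], [0, - 1, 0, 0], [0, 0, 1, 0], [0, 0, 0, - 1]]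
    | G2 \<Rightarrow> [[t, 0, 0, 0], [0, t, 0, 0], [0, 0, - t, 0], [0, 0, 0, - t]]
    | A1 \<Rightarrow> [[0, 1, 0, 0], [0, 0, 0, 0], [0, 0, 0, 0], [0, 0, 1, 0]]
    | A2 \<Rightarrow> [[0, 0, 0, c], [0, 0, 1, 0], [0, 0, 0, 0], [0, 0, 0, 0]])"

lemma less_3_cases: "i < 3 \<Longrightarrow> i = 0 \<or> i = 1 \<or> i = (2::nat)"
  by auto

lemma less_4_cases: "i < 4 \<Longrightarrow> i = 0 \<or> i = 1 \<or> i = 2 \<or> i = (3::nat)"
  by auto

lemma based_rep_int_rep:
  assumes "length es = n"
    and "\<And>r s. r < n \<Longrightarrow> s < n \<Longrightarrow> (if r = s then fst (btype \<chi> (es ! s)) else 0) = fst \<psi> * of_int ((D G1 ! r) ! s)"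
    and "\<And>r s. r < n \<Longrightarrow> s < n \<Longrightarrow> (if r = s then snd (btype \<chi> (es ! s)) else 0) = snd \<psi> * of_int ((D G2 ! r) ! s)"
    and "\<And>r s. r < n \<Longrightarrow> s < n \<Longrightarrow>
      (case \<alpha> (es ! s) of None \<Rightarrow> 0 | Some (c, j) \<Rightarrow> if es ! r = j then c else 0) = of_int ((D A1 ! r) ! s)"
    and "\<And>r s. r < n \<Longrightarrow> s < n \<Longrightarrow>
      (case \<beta> (es ! s) of None \<Rightarrow> 0 | Some (c, j) \<Rightarrow> if es ! r = j then c else 0) = of_int ((D A2 ! r) ! s)"
    and "distinct es"
  shows "based_rep \<chi> es \<alpha> \<beta> = int_rep n D \<psi>"
proof -
  have "ract (based_rep \<chi> es \<alpha> \<beta>) x = ract (int_rep n D \<psi>) x" for x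
    using assms
    by (cases x; intro eq_matI)
      (auto simp: based_rep_def map_mat_of_def list_mat_def gen_scale_def nth_eq_iff_index_eq)
  then show ?thesis by (intro rep.equality) (auto simp: based_rep_def assms(1))
qed

lemma M3_int_rep: "M3 i \<chi> = int_rep 3 (m3_data i) \<chi>"
proof -
  consider "i = 1" | "i = 2" | "i = 3" | "i \<noteq> 1" "i \<noteq> 2" "i \<noteq> 3" by blast
  then show ?thesis
    by cases (auto simp: M3_def M31_def M32_def M33_def M34_def m3_data_def btype_def cbar_def cneg_def
      intro!: based_rep_int_rep dest!: less_3_cases)
qed

lemma L1_int_rep:
  "L1 \<chi> = int_rep 1 (point_data 1 1) \<chi>"
  "L1 (cbar \<chi>) = int_rep 1 (point_data (- 1) 1) \<chi>"
  "L1 (cneg (cbar \<chi>)) = int_rep 1 (point_data 1 (- 1)) \<chi>"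
  by (auto simp: L1_def point_data_def btype_def cbar_def cneg_def intro!: based_rep_int_rep)

lemma C2_int_rep:
  "C2 (of_int c) \<chi> = int_rep 4 (band_data c 1) \<chi>"
  "C2 (of_int c) (cneg (cbar \<chi>)) = int_rep 4 (band_data c (- 1)) \<chi>"
  by (auto simp: C2_def band_data_def btype_def cbar_def cneg_def
      intro!: based_rep_int_rep dest!: less_4_cases)

lemma sq_m3_data: "sq_data 3 (m3_data i)"
  by (auto simp: sq_data_def sq_list_def m3_data_def)

lemma M3_tensor:
  fixes \<chi> \<phi> :: "'k::field \<times> 'k"
  assumes "fst \<chi> \<noteq> 0" "snd \<chi> \<noteq> 0"
  shows "mat_iso (rep_tensor (M3 i \<chi>) (M3 j \<phi>)) (int_rep 9 (list_tensor 3 3 (m3_data i) (m3_data j)) (cmul \<chi> \<phi>))"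
proof -
  let ?p = "fst \<chi>" and ?q = "snd \<chi>"
  \<comment> \<open>An arrow from \<open>e_j\<close> to \<open>e_i\<close> requires
    \<open>d j = \<chi>_1 d i\<close> for \<open>a1\<close> and \<open>d j = \<chi>_2 d i\<close>
    for \<open>a2\<close>. The arrows form a path, so these conditions are consistent and fix
    \<open>d\<close> up to a common factor.\<close>
  define d where "d = (\<lambda>k. (if j = 1 then [1, ?p, ?p * ?q] else if j = 2 then [?q, ?p * ?q, ?p]
    else if j = 3 then [1, ?p, ?q] else [1, ?p * ?q, ?q]) ! k)"
  have "mat_iso (rep_tensor (int_rep 3 (m3_data i) \<chi>) (int_rep 3 (m3_data j) \<phi>))
      (int_rep (3 * 3) (list_tensor 3 3 (m3_data i) (m3_data j)) (cmul \<chi> \<phi>))"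
    by (rule rep_tensor_int_rep[OF sq_m3_data sq_m3_data, of d])
      (use assms in \<open>auto simp: d_def m3_data_def split: if_splits dest!: less_3_cases\<close>)
  then show ?thesis by (simp add: M3_int_rep)
qed

definition entry_list :: "nat \<Rightarrow> (nat \<times> nat \<times> int) list \<Rightarrow> int list list" where
  "entry_list n es = map (\<lambda>r. map (\<lambda>s. sum_list (map (\<lambda>(r', s', c). if r' = r \<and> s' = s then c else 0) es)) [0..<n]) [0..<n]"

text \<open>The tensor product of \<open>M\<^sub>3\<^sub>,\<^sub>i\<close> and \<open>M\<^sub>3\<^sub>,\<^sub>j\<close> is isomorphic to \<open>string_ij\<close>, where the basis is listed along
  the path; the base changes below were found by solving the linear equations of an isomorphism.\<close>

abbreviation (input) "uz \<equiv> [0,0,0,0,0,0,0,0,0] :: int list"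
abbreviation (input) "u0 \<equiv> [1,0,0,0,0,0,0,0,0] :: int list"
abbreviation (input) "u1 \<equiv> [0,1,0,0,0,0,0,0,0] :: int list"
abbreviation (input) "u2 \<equiv> [0,0,1,0,0,0,0,0,0] :: int list"
abbreviation (input) "u3 \<equiv> [0,0,0,1,0,0,0,0,0] :: int list"
abbreviation (input) "u4 \<equiv> [0,0,0,0,1,0,0,0,0] :: int list"
abbreviation (input) "u5 \<equiv> [0,0,0,0,0,1,0,0,0] :: int list"
abbreviation (input) "u6 \<equiv> [0,0,0,0,0,0,1,0,0] :: int list"
abbreviation (input) "u7 \<equiv> [0,0,0,0,0,0,0,1,0] :: int list"
abbreviation (input) "u8 \<equiv> [0,0,0,0,0,0,0,0,1] :: int list"

text \<open>Both letters anticommute with \<open>g1\<close>, so its signs alternate along a path;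
  over nine vertices they add up to 1.\<close>

definition path_sign_1 :: "int list list" where
  "path_sign_1 =
     [[1,0,0,0,0,0,0,0,0], [0,- 1,0,0,0,0,0,0,0], [0,0,1,0,0,0,0,0,0], [0,0,0,- 1,0,0,0,0,0],
       [0,0,0,0,1,0,0,0,0], [0,0,0,0,0,- 1,0,0,0], [0,0,0,0,0,0,1,0,0], [0,0,0,0,0,0,0,- 1,0],
       [0,0,0,0,0,0,0,0,1]]"

text \<open>Only \<open>a2\<close> changes the sign of \<open>g2\<close>. The pattern of period four
  reflects that every path below begins with an \<open>a1\<close> edge.\<close>

definition path_sign_2 :: "int list list" where
  "path_sign_2 =
     [[1,0,0,0,0,0,0,0,0], [0,1,0,0,0,0,0,0,0], [0,0,- 1,0,0,0,0,0,0], [0,0,0,- 1,0,0,0,0,0],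
       [0,0,0,0,1,0,0,0,0], [0,0,0,0,0,1,0,0,0], [0,0,0,0,0,0,- 1,0,0], [0,0,0,0,0,0,0,- 1,0],
       [0,0,0,0,0,0,0,0,1]]"

text \<open>A row \<open>t\<close> equal to the \<open>s\<close>-th unit row is an arrow from vertex
  \<open>s\<close> to vertex \<open>t\<close>. The edges of the path are \<open>a1\<close>,
  \<open>a2\<close>, \<open>a1\<close>, ... in all eight strings, which differ in the directions of
  the arrows and in the type at the start.\<close>

definition string_11 :: "gen \<Rightarrow> int list list" where
  "string_11 x = (case x of
      G1 \<Rightarrow> path_sign_1
    | G2 \<Rightarrow> path_sign_2
    | A1 \<Rightarrow> [u1, uz, u3, uz, uz, u4, u7, uz, uz]
    | A2 \<Rightarrow> [uz, u2, uz, uz, u3, u6, uz, u8, uz])"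

definition string_12 :: "gen \<Rightarrow> int list list" where
  "string_12 x = (case x of
      G1 \<Rightarrow> path_sign_1
    | G2 \<Rightarrow> path_sign_2
    | A1 \<Rightarrow> [u1, uz, u3, uz, uz, u4, u7, uz, uz]
    | A2 \<Rightarrow> [uz, u2, uz, uz, u3, uz, u5, u8, uz])"

definition string_13 :: "gen \<Rightarrow> int list list" where
  "string_13 x = (case x of
      G1 \<Rightarrow> list_neg path_sign_1
    | G2 \<Rightarrow> path_sign_2
    | A1 \<Rightarrow> [u1, uz, uz, u2, uz, u4, u7, uz, uz]
    | A2 \<Rightarrow> [uz, u2, uz, uz, u3, u6, uz, u8, uz])"

definition string_22 :: "gen \<Rightarrow> int list list" where
  "string_22 x = (case x of
      G1 \<Rightarrow> path_sign_1
    | G2 \<Rightarrow> path_sign_2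
    | A1 \<Rightarrow> [u1, uz, u3, uz, uz, u4, u7, uz, uz]
    | A2 \<Rightarrow> [uz, uz, u1, u4, uz, uz, u5, uz, u7])"

definition string_24 :: "gen \<Rightarrow> int list list" where
  "string_24 x = (case x of
      G1 \<Rightarrow> path_sign_1
    | G2 \<Rightarrow> list_neg path_sign_2
    | A1 \<Rightarrow> [uz, u0, u3, uz, u5, uz, uz, u6, uz]
    | A2 \<Rightarrow> [uz, uz, u1, u4, uz, uz, u5, uz, u7])"

definition string_33 :: "gen \<Rightarrow> int list list" where
  "string_33 x = (case x of
      G1 \<Rightarrow> path_sign_1
    | G2 \<Rightarrow> path_sign_2
    | A1 \<Rightarrow> [uz, u0, uz, u2, u5, uz, uz, u6, uz]
    | A2 \<Rightarrow> [uz, u2, uz, uz, u3, u6, uz, u8, uz])"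

definition string_34 :: "gen \<Rightarrow> int list list" where
  "string_34 x = (case x of
      G1 \<Rightarrow> list_neg path_sign_1
    | G2 \<Rightarrow> list_neg path_sign_2
    | A1 \<Rightarrow> [uz, u0, uz, u2, u5, uz, uz, u6, uz]
    | A2 \<Rightarrow> [uz, uz, u1, u4, uz, u6, uz, uz, u7])"

definition string_44 :: "gen \<Rightarrow> int list list" where
  "string_44 x = (case x of
      G1 \<Rightarrow> path_sign_1
    | G2 \<Rightarrow> path_sign_2
    | A1 \<Rightarrow> [uz, u0, uz, u2, u5, uz, uz, u6, uz]
    | A2 \<Rightarrow> [uz, uz, u1, u4, uz, uz, u5, uz, u7])"

text \<open>The basis is 1, a, ba, aba, abab, bab, ab, b with \<open>a = a1\<close> and
  \<open>b = a2\<close>, read around a cycle. The entry -1 of \<open>A2\<close> is the relation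
  \<open>baba = - abab\<close>.\<close>

definition proj_data :: "gen \<Rightarrow> int list list" where
  "proj_data x = (case x of
      G1 \<Rightarrow>
       [[1,0,0,0,0,0,0,0], [0,- 1,0,0,0,0,0,0], [0,0,1,0,0,0,0,0], [0,0,0,- 1,0,0,0,0],
       [0,0,0,0,1,0,0,0], [0,0,0,0,0,- 1,0,0], [0,0,0,0,0,0,1,0], [0,0,0,0,0,0,0,- 1]]
    | G2 \<Rightarrow>
       [[1,0,0,0,0,0,0,0], [0,1,0,0,0,0,0,0], [0,0,- 1,0,0,0,0,0], [0,0,0,- 1,0,0,0,0],
       [0,0,0,0,1,0,0,0], [0,0,0,0,0,1,0,0], [0,0,0,0,0,0,- 1,0], [0,0,0,0,0,0,0,- 1]]
    | A1 \<Rightarrow>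
       [[0,0,0,0,0,0,0,0], [1,0,0,0,0,0,0,0], [0,0,0,0,0,0,0,0], [0,0,1,0,0,0,0,0],
       [0,0,0,0,0,1,0,0], [0,0,0,0,0,0,0,0], [0,0,0,0,0,0,0,1], [0,0,0,0,0,0,0,0]]
    | A2 \<Rightarrow>
       [[0,0,0,0,0,0,0,0], [0,0,0,0,0,0,0,0], [0,1,0,0,0,0,0,0], [0,0,0,0,0,0,0,0],
       [0,0,0,- 1,0,0,0,0], [0,0,0,0,0,0,1,0], [0,0,0,0,0,0,0,0], [1,0,0,0,0,0,0,0]])"

definition proj_sum_data :: "gen \<Rightarrow> int list list" where
  "proj_sum_data = list_sum 8 1 proj_data (point_data 1 (- 1))"

definition band_sum_data :: "int \<Rightarrow> int \<Rightarrow> gen \<Rightarrow> int list list" where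
  "band_sum_data b c = list_sum 8 1 (list_sum 4 4 (band_data b (- 1)) (band_data c 1)) (point_data (- 1) 1)"

abbreviation (input) "m3_tensor i j \<equiv> list_tensor 3 3 (m3_data i) (m3_data j)"

text \<open>In this and the following checks, column \<open>k\<close> of the first matrix is the
  image of the \<open>k\<close>-th basis vector of the model in the rescaled tensor basis.\<close>

lemma tensor_iso_11:
  "iso_check 9 1
    (entry_list 9 [(0,0,1), (1,1,1), (1,5,1), (2,2,1), (2,6,1), (3,5,- 1), (4,4,1), (5,3,1),
      (5,7,1), (6,6,- 1), (7,7,- 1), (8,8,1)])
    (entry_list 9 [(0,0,1), (1,1,1), (1,3,1), (2,2,1), (2,6,1), (3,5,1), (3,7,1), (4,4,1),
      (5,3,- 1), (6,6,- 1), (7,7,- 1), (8,8,1)])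
    string_11 (m3_tensor 1 1)"
  by code_simp

lemma tensor_iso_12:
  "iso_check 9 1
    (entry_list 9 [(0,0,- 1), (1,5,- 1), (2,6,- 1), (3,1,- 1), (3,5,1), (4,4,- 1), (5,7,- 1),
      (6,2,- 1), (7,3,- 1), (8,4,1), (8,8,- 1)])
    (entry_list 9 [(0,0,- 1), (1,1,- 1), (1,3,- 1), (2,6,- 1), (3,7,- 1), (4,4,- 1), (5,1,- 1),
      (6,2,- 1), (7,5,- 1), (8,4,- 1), (8,8,- 1)])
    string_12 (m3_tensor 1 2)"
  by code_simp

lemma tensor_iso_13:
  "iso_check 9 1
    (entry_list 9 [(0,5,1), (1,0,1), (2,6,1), (3,0,- 1), (3,4,1), (4,1,1), (5,7,1), (6,3,1),
      (6,7,- 1), (7,2,1), (8,8,1)])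
    (entry_list 9 [(0,1,1), (1,4,1), (2,7,1), (3,5,1), (3,6,1), (4,1,1), (4,3,1), (5,0,1),
      (6,2,1), (7,5,1), (8,8,1)])
    string_13 (m3_tensor 1 3)"
  by code_simp

text \<open>The generator of the projective goes to the product of the generators \<open>e_3\<close>
  of both factors. Column 8 is
  \<open>e_1 \<otimes> e_3 - e_2 \<otimes> e_4 + e_3 \<otimes> e_1\<close>, killed by both letters,
  which spans the one-dimensional summand.\<close>

lemma tensor_iso_14:
  "iso_check 9 1
    (entry_list 9 [(0,4,- 1), (1,6,1), (1,8,1), (2,3,1), (3,5,- 1), (4,7,1), (5,2,1), (5,6,- 1),
      (5,8,- 1), (6,2,- 1), (6,8,1), (7,0,1), (8,1,1)])
    (entry_list 9 [(0,7,1), (1,8,1), (2,1,1), (2,5,1), (3,2,1), (4,0,- 1), (5,3,- 1), (6,5,- 1),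
      (6,6,- 1), (7,4,1), (8,1,1), (8,5,1), (8,6,1)])
    proj_sum_data (m3_tensor 1 4)"
  by code_simp

lemma tensor_iso_21:
  "iso_check 9 1
    (entry_list 9 [(0,0,- 1), (1,1,- 1), (1,5,- 1), (2,2,- 1), (3,5,1), (4,4,- 1), (5,3,- 1),
      (6,6,1), (7,7,1), (8,4,- 1), (8,8,- 1)])
    (entry_list 9 [(0,0,- 1), (1,1,- 1), (1,3,- 1), (2,2,- 1), (3,5,- 1), (4,4,- 1), (5,3,1),
      (6,6,1), (7,7,1), (8,4,1), (8,8,- 1)])
    string_12 (m3_tensor 2 1)"
  by code_simp

text \<open>With equal factors the path uses sums and differences of vectors such as
  \<open>e_1 \<otimes> e_2\<close> and \<open>e_2 \<otimes> e_1\<close>. Inverting them costs a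
  factor 1/2, whence the denominator 2.\<close>

lemma tensor_iso_22:
  "iso_check 9 2
    (entry_list 9 [(0,0,- 2), (1,1,- 1), (1,5,- 1), (2,2,- 1), (2,6,- 1), (3,1,- 1), (3,5,1),
      (4,4,- 1), (5,3,- 1), (5,7,- 1), (6,2,- 1), (6,6,1), (7,3,- 1), (7,7,1), (8,8,- 2)])
    (entry_list 9 [(0,0,- 1), (1,1,- 1), (1,3,- 1), (2,2,- 1), (2,6,- 1), (3,5,- 1), (3,7,- 1),
      (4,4,- 2), (5,1,- 1), (5,3,1), (6,2,- 1), (6,6,1), (7,5,- 1), (7,7,1), (8,8,- 1)])
    string_22 (m3_tensor 2 2)"
  by code_simp

text \<open>Columns 0 to 3 and 4 to 7 span the two bands. Column 8 is
  \<open>- e_1 \<otimes> e_2 + e_2 \<otimes> e_1 + e_3 \<otimes> e_4\<close>, killed by both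
  letters.\<close>

lemma tensor_iso_23:
  "iso_check 9 1
    (entry_list 9 [(0,4,1), (1,3,1), (1,8,- 1), (2,7,1), (3,3,- 1), (3,5,1), (3,8,1), (4,2,1),
      (5,6,1), (6,0,1), (7,1,1), (8,5,1), (8,8,1)])
    (entry_list 9 [(0,6,1), (1,7,1), (2,4,1), (3,3,- 1), (3,8,1), (4,0,1), (5,1,1), (5,3,1),
      (6,5,1), (7,2,1), (8,1,- 1), (8,3,- 1), (8,8,1)])
    (band_sum_data (- 1) 1) (m3_tensor 2 3)"
  by code_simp

lemma tensor_iso_24:
  "iso_check 9 1
    (entry_list 9 [(0,2,- 1), (1,0,- 1), (1,4,1), (2,1,- 1), (3,3,- 1), (4,5,1), (5,4,- 1),
      (6,8,- 1), (7,6,1), (8,3,- 1), (8,7,1)])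
    (entry_list 9 [(0,1,- 1), (0,5,- 1), (1,2,- 1), (2,0,- 1), (3,3,- 1), (4,5,- 1), (5,4,1),
      (6,7,1), (7,3,- 1), (7,8,1), (8,6,- 1)])
    string_24 (m3_tensor 2 4)"
  by code_simp

lemma tensor_iso_31:
  "iso_check 9 1
    (entry_list 9 [(0,5,1), (1,0,1), (1,4,1), (2,3,1), (2,7,1), (3,0,- 1), (4,1,1), (5,2,1),
      (6,6,1), (7,7,- 1), (8,8,1)])
    (entry_list 9 [(0,3,- 1), (1,4,1), (2,5,1), (3,2,1), (3,7,1), (4,1,1), (4,3,1), (5,0,1),
      (6,6,1), (7,7,- 1), (8,8,1)])
    string_13 (m3_tensor 3 1)"
  by code_simp

lemma tensor_iso_32:
  "iso_check 9 1
    (entry_list 9 [(0,4,- 1), (1,3,1), (1,5,- 1), (1,8,1), (2,0,1), (3,3,- 1), (3,8,- 1),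
      (4,2,1), (5,1,1), (6,7,1), (7,6,- 1), (8,5,1), (8,8,- 1)])
    (entry_list 9 [(0,2,1), (1,5,1), (2,4,1), (3,1,1), (3,8,1), (4,0,- 1), (5,1,- 1), (5,3,- 1),
      (6,7,- 1), (7,6,1), (8,1,- 1), (8,3,- 1), (8,8,- 1)])
    (band_sum_data 1 (- 1)) (m3_tensor 3 2)"
  by code_simp

lemma tensor_iso_33:
  "iso_check 9 2
    (entry_list 9 [(0,4,2), (1,1,- 1), (1,5,1), (2,3,1), (2,7,1), (3,1,1), (3,5,1), (4,0,- 1),
      (5,2,1), (5,6,1), (6,3,1), (6,7,- 1), (7,2,- 1), (7,6,1), (8,8,1)])
    (entry_list 9 [(0,4,- 2), (1,1,- 1), (1,3,1), (2,5,1), (2,7,- 1), (3,2,1), (3,6,1), (4,0,1),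
      (5,1,1), (5,3,1), (6,5,1), (6,7,1), (7,2,1), (7,6,- 1), (8,8,2)])
    string_33 (m3_tensor 3 3)"
  by code_simp

lemma tensor_iso_34:
  "iso_check 9 1
    (entry_list 9 [(0,3,- 1), (1,1,1), (1,5,- 1), (2,4,- 1), (2,8,1), (3,2,- 1), (4,0,1), (5,1,-
      1), (6,8,- 1), (7,6,- 1), (8,7,1)])
    (entry_list 9 [(0,4,1), (1,5,- 1), (2,3,- 1), (3,0,- 1), (4,2,- 1), (4,6,- 1), (5,1,- 1),
      (5,5,- 1), (6,7,- 1), (7,8,1), (8,6,- 1)])
    string_34 (m3_tensor 3 4)"
  by code_simp

lemma tensor_iso_41:
  "iso_check 9 1
    (entry_list 9 [(0,4,- 1), (1,5,- 1), (2,2,1), (2,8,- 1), (3,6,- 1), (3,8,1), (4,7,- 1),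
      (5,0,1), (6,3,1), (7,2,- 1), (7,6,- 1), (7,8,1), (8,1,1)])
    (entry_list 9 [(0,5,1), (1,8,1), (2,3,1), (2,7,- 1), (3,6,1), (4,0,- 1), (5,1,- 1), (6,2,-
      1), (6,7,- 1), (7,4,- 1), (8,2,- 1), (8,3,1), (8,7,- 1)])
    proj_sum_data (m3_tensor 4 1)"
  by code_simp

lemma tensor_iso_42:
  "iso_check 9 1
    (entry_list 9 [(0,2,1), (1,3,1), (2,8,- 1), (3,0,1), (3,4,1), (4,5,1), (5,6,- 1), (6,1,1),
      (7,4,1), (8,3,- 1), (8,7,- 1)])
    (entry_list 9 [(0,3,1), (0,7,- 1), (1,6,1), (2,0,1), (3,1,1), (4,7,1), (5,4,1), (6,5,- 1),
      (7,1,- 1), (7,8,- 1), (8,2,- 1)])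
    string_24 (m3_tensor 4 2)"
  by code_simp

lemma tensor_iso_43:
  "iso_check 9 1
    (entry_list 9 [(0,3,1), (1,2,1), (2,8,- 1), (3,1,1), (3,5,1), (4,0,1), (5,6,- 1), (6,4,1),
      (6,8,1), (7,1,1), (8,7,- 1)])
    (entry_list 9 [(0,4,1), (1,7,1), (2,1,1), (3,0,1), (4,2,1), (4,6,1), (5,3,1), (5,7,- 1),
      (6,5,- 1), (7,8,- 1), (8,2,- 1)])
    string_34 (m3_tensor 4 3)"
  by code_simp

lemma tensor_iso_44:
  "iso_check 9 1
    (entry_list 9 [(0,8,- 1), (1,2,1), (2,3,1), (3,2,- 1), (3,6,- 1), (4,0,1), (5,1,1), (5,5,1),
      (6,3,- 1), (6,7,- 1), (7,1,1), (8,4,1)])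
    (entry_list 9 [(0,4,1), (1,7,1), (2,1,1), (3,2,1), (4,8,1), (5,5,1), (5,7,- 1), (6,1,- 1),
      (6,3,- 1), (7,2,- 1), (7,6,- 1), (8,0,- 1)])
    string_44 (m3_tensor 4 4)"
  by code_simp

section \<open>Evaluated properties of the integral models\<close>

lemma summand_rep_checks:
  "rep_check 8 proj_data" "rep_check 9 proj_sum_data" "rep_check 9 (band_sum_data (- 1) 1)"
  "rep_check 9 (band_sum_data 1 (- 1))" "rep_check 1 (point_data 1 (- 1))" "rep_check 1 (point_data (- 1) 1)"
  by code_simp+

lemma null_checks: "null_check 8 proj_data"
    "null_check 4 (band_data 1 1)" "null_check 4 (band_data 1 (- 1))"
    "null_check 4 (band_data (- 1) 1)" "null_check 4 (band_data (- 1) (- 1))"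
  by code_simp+

lemma sq_data_summands: "sq_data 8 proj_data" "sq_data 4 (band_data b t)" "sq_data 1 (point_data s t)"
  "sq_data 8 (list_sum 4 4 (band_data b t) (band_data b' t'))"
  by (simp_all add: sq_data_def sq_list_def band_data_def point_data_def proj_data_def list_sum_def)

lemma string_rep_check:
  "list_all (rep_check 9) [string_11, string_12, string_13, string_22, string_24, string_33, string_34, string_44]"
  by code_simp

lemma string_local_check:
  "list_all (local_check 9) [string_11, string_12, string_13, string_22, string_24, string_33, string_34, string_44]"
  by code_simp

text \<open>Each unordered pair is tested once, in list order; symmetry of isomorphism supplies the
  other order.\<close>

fun all_noniso :: "nat \<Rightarrow> (gen \<Rightarrow> int list list) list \<Rightarrow> bool" where
  "all_noniso n [] = True"
| "all_noniso n (D # Ds) = (list_all (noniso_check n D) Ds \<and> all_noniso n Ds)"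

lemma string_noniso_check: 
  "all_noniso 9 [string_11, string_12, string_13, string_22, string_24, string_33, string_34, string_44]"
  by code_simp

section \<open>The induced module\<close>

lemma fscal_commute: "fscal c * p = p * fscal c"
  by (induction p rule: free_alg_induct)
    (simp_all add: fscal_def mult_single mult.commute distrib_left distrib_right)

lemma fscal_simps:
  "fscal c + fscal d = fscal (c + d)" "fscal c - fscal d = fscal (c - d)" "fscal c - fscal c = 0"
  "fscal c * fscal d = fscal (c * d)" "fscal 0 = 0" "fscal 1 = 1"
  by (simp_all add: fscal_def mult_single single_add single_diff)

lemma fscal_minus: "fscal (- c) = - fscal c"
  by (simp add: fscal_def single_uminus)

lemma fscal_shift: "p * (fscal c * q) = fscal c * (p * q)"
  by (simp only: mult.assoc[symmetric] fscal_commute[of c p])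

lemma fscal_merge: "fscal c * (fscal d * q) = fscal (c * d) * q"
  by (simp only: mult.assoc[symmetric] fscal_simps)

text \<open>The monomials that span the induced module, listed along a path in which consecutive ones
  differ by one letter on the left.\<close>

definition proj_basis :: "nat \<Rightarrow> 'k::comm_ring_1 free_alg" where
  "proj_basis i = (let a = fgen A1; b = fgen A2 in
     [1, a, b * a, a * (b * a), a * (b * (a * b)), b * (a * b), a * b, b] ! i)"

definition proj_elem :: "'k::comm_ring_1 vec \<Rightarrow> 'k free_alg" where
  "proj_elem v = (\<Sum>i<8. fscal (v $ i) * proj_basis i)"

text \<open>Every generator sends a basis monomial to a multiple of one basis monomial. A zero
  column is recorded by the dummy values \<open>k = 0\<close> and \<open>s = 0\<close>.\<close>

definition proj_column :: "gen \<Rightarrow> nat \<Rightarrow> nat \<Rightarrow> int \<Rightarrow> bool" where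
  "proj_column x i k s \<longleftrightarrow> (proj_data x ! k) ! i = s \<and>
     list_all (\<lambda>j. if j = k then True else (proj_data x ! j) ! i = 0) [0..<8]"

lemma proj_columns:
  "proj_column G1 0 0 1" "proj_column G1 1 1 (- 1)" "proj_column G1 2 2 1" "proj_column G1 3 3 (- 1)"
  "proj_column G1 4 4 1" "proj_column G1 5 5 (- 1)" "proj_column G1 6 6 1" "proj_column G1 7 7 (- 1)"
  "proj_column G2 0 0 1" "proj_column G2 1 1 1" "proj_column G2 2 2 (- 1)" "proj_column G2 3 3 (- 1)"
  "proj_column G2 4 4 1" "proj_column G2 5 5 1" "proj_column G2 6 6 (- 1)" "proj_column G2 7 7 (- 1)"
  "proj_column A1 0 1 1" "proj_column A1 1 0 0" "proj_column A1 2 3 1" "proj_column A1 3 0 0"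
  "proj_column A1 4 0 0" "proj_column A1 5 4 1" "proj_column A1 6 0 0" "proj_column A1 7 6 1"
  "proj_column A2 0 7 1" "proj_column A2 1 2 1" "proj_column A2 2 0 0" "proj_column A2 3 4 (- 1)"
  "proj_column A2 4 0 0" "proj_column A2 5 0 0" "proj_column A2 6 5 1" "proj_column A2 7 0 0"
  by code_simp+

lemma proj_basis_simps:
  "proj_basis 0 = 1" "proj_basis 1 = fgen A1" "proj_basis 2 = fgen A2 * fgen A1"
  "proj_basis 3 = fgen A1 * (fgen A2 * fgen A1)" "proj_basis 4 = fgen A1 * (fgen A2 * (fgen A1 * fgen A2))"
  "proj_basis 5 = fgen A2 * (fgen A1 * fgen A2)" "proj_basis 6 = fgen A1 * fgen A2" "proj_basis 7 = fgen A2"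
  by (simp_all add: proj_basis_def Let_def)

lemma less_8_cases: "i < 8 \<Longrightarrow> i = 0 \<or> i = 1 \<or> i = 2 \<or> i = 3 \<or> i = 4 \<or> i = 5 \<or> i = 6 \<or> i = (7::nat)"
  by auto

text \<open>\<open>I\<close> plays the role of the annihilator of \<open>1 \<otimes> 1\<close> in the induced module.\<close>

locale weight_left_ideal =
  fixes N M :: nat and l1 l2 l3 :: "'k::field" and \<psi> :: "'k \<times> 'k" and I :: "'k free_alg set"
  assumes psi: "\<psi> \<in> O1 N M (l1, l2, l3)"
    and zero: "0 \<in> I" and add: "p \<in> I \<Longrightarrow> q \<in> I \<Longrightarrow> p + q \<in> I" and mult: "p \<in> I \<Longrightarrow> r * p \<in> I"
    and rel: "rel_ideal N M (l1, l2, l3) \<subseteq> I"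
    and G1: "fgen G1 - fscal (fst \<psi>) \<in> I" and G2: "fgen G2 - fscal (snd \<psi>) \<in> I"
begin

section \<open>Rewriting modulo the left ideal\<close>

definition eqv (infix "\<asymp>" 50) where "p \<asymp> q \<longleftrightarrow> p - q \<in> I"

lemma eqv_refl [simp]: "p \<asymp> p"
  by (simp add: eqv_def zero)

lemma eqv_sym: "p \<asymp> q \<Longrightarrow> q \<asymp> p"
  using mult[of "p - q" "- 1"] by (simp add: eqv_def)

lemma eqv_trans [trans]: "p \<asymp> q \<Longrightarrow> q \<asymp> r \<Longrightarrow> p \<asymp> r"
  using add[of "p - q" "q - r"] by (simp add: eqv_def)

lemma eqv_add: "p \<asymp> p' \<Longrightarrow> q \<asymp> q' \<Longrightarrow> p + q \<asymp> p' + q'"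
  using add[of "p - p'" "q - q'"] by (simp add: eqv_def algebra_simps)

lemma eqv_mult: "p \<asymp> q \<Longrightarrow> r * p \<asymp> r * q"
  using mult[of "p - q" r] by (simp add: eqv_def algebra_simps)

lemma eqv_uminus: "p \<asymp> q \<Longrightarrow> - p \<asymp> - q"
  using eqv_mult[of p q "- 1"] by simp

lemma eqv_diff: "p \<asymp> p' \<Longrightarrow> q \<asymp> q' \<Longrightarrow> p - q \<asymp> p' - q'"
  using eqv_add[OF _ eqv_uminus] by fastforce

lemma eqv_sum: "(\<And>i. i \<in> S \<Longrightarrow> f i \<asymp> g i) \<Longrightarrow> sum f S \<asymp> sum g S"
  by (induction S rule: infinite_finite_induct) (auto intro: eqv_add)

text \<open>The congruence is compatible with left multiplication only. Relators may still be
  multiplied on the right, because they lie in the two-sided ideal contained in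
  \<open>I\<close>.\<close>

lemma eqv_rel:
  assumes "p - q \<in> relators N M (l1, l2, l3)"
  shows "p * r \<asymp> q * r"
proof -
  have "(p - q) * r \<in> rel_ideal N M (l1, l2, l3)"
    by (rule rel_ideal_closed(4)[OF subsetD[OF relators_rel_ideal assms]])
  with rel show ?thesis unfolding eqv_def left_diff_distrib by (rule subsetD)
qed

definition weight where
  "weight w c d \<longleftrightarrow> fgen G1 * w \<asymp> fscal c * w \<and> fgen G2 * w \<asymp> fscal d * w"

lemma weight_one: "weight 1 (fst \<psi>) (snd \<psi>)"
  using G1 G2 by (simp add: weight_def eqv_def)

lemma weight_step:
  assumes e: "fgen x * fgen y - fscal \<epsilon> * (fgen y * fgen x) \<in> relators N M (l1, l2, l3)"
    and w: "fgen x * w \<asymp> fscal c * w"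
  shows "fgen x * (fgen y * w) \<asymp> fscal (\<epsilon> * c) * (fgen y * w)"
proof -
  have "fgen x * (fgen y * w) \<asymp> fscal \<epsilon> * (fgen y * (fgen x * w))"
    using eqv_rel[OF e, of w] by (simp add: mult.assoc)
  also have "\<dots> \<asymp> fscal \<epsilon> * (fgen y * (fscal c * w))" by (intro eqv_mult w)
  also have "fscal \<epsilon> * (fgen y * (fscal c * w)) = fscal (\<epsilon> * c) * (fgen y * w)"
    by (simp only: fscal_shift[of "fgen y"] fscal_merge)
  finally show ?thesis .
qed

lemma weight_A1: "weight w c d \<Longrightarrow> weight (fgen A1 * w) (- c) d"
  and weight_A2: "weight w c d \<Longrightarrow> weight (fgen A2 * w) (- c) (- d)"
proof -
  have m1: "fscal (- 1) = (- 1 :: 'k free_alg)" by (simp add: fscal_minus fscal_simps)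
  have "fgen G1 * fgen A1 - fscal (- 1) * (fgen A1 * fgen G1) \<in> relators N M (l1, l2, l3)"
    "fgen G2 * fgen A1 - fscal 1 * (fgen A1 * fgen G2) \<in> relators N M (l1, l2, l3)"
    "fgen G1 * fgen A2 - fscal (- 1) * (fgen A2 * fgen G1) \<in> relators N M (l1, l2, l3)"
    "fgen G2 * fgen A2 - fscal (- 1) * (fgen A2 * fgen G2) \<in> relators N M (l1, l2, l3)"
    by (simp_all add: Let_def m1 fscal_simps(6))
  from this[THEN weight_step] show "weight w c d \<Longrightarrow> weight (fgen A1 * w) (- c) d"
    "weight w c d \<Longrightarrow> weight (fgen A2 * w) (- c) (- d)"
    unfolding weight_def by (metis mult_1_left mult_minus1)+
qed

lemma weight_square:
  assumes "fgen x * w \<asymp> fscal c * w"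
  shows "(fgen x)\<^sup>2 * w \<asymp> fscal (c\<^sup>2) * w"
proof -
  have "(fgen x)\<^sup>2 * w \<asymp> fgen x * (fscal c * w)"
    using eqv_mult[OF assms] by (simp add: power2_eq_square mult.assoc)
  also have "fgen x * (fscal c * w) = fscal c * (fgen x * w)" by (rule fscal_shift)
  also have "fscal c * (fgen x * w) \<asymp> fscal c * (fscal c * w)" by (intro eqv_mult assms)
  also have "fscal c * (fscal c * w) = fscal (c\<^sup>2) * w"
    by (simp only: power2_eq_square fscal_merge)
  finally show ?thesis .
qed

lemma psi_eqs:
  "l1 * (1 - fst \<psi> ^ 2) = 0" "l2 * (1 - snd \<psi> ^ 2) = 0"
  "l3 * (1 - fst \<psi> ^ 2 * snd \<psi> ^ 2) - 2 * l1 * l2 * (1 + snd \<psi> ^ 2) * (1 - fst \<psi> ^ 2) = 0"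
  using psi by auto

text \<open>On a weight vector the deformation term acts by the scalar \<open>m * (1 - c^2)\<close>,
  which is zero by hypothesis. All basis monomials have weights \<open>\<psi>\<close> up to sign, so
  the condition on \<open>O1\<close> applies to each of them.\<close>

lemma square_zero:
  assumes r: "(fgen x)\<^sup>2 - fscal m * (1 - (fgen y)\<^sup>2) \<in> relators N M (l1, l2, l3)"
    and w: "fgen y * w \<asymp> fscal c * w" and m: "m * (1 - c\<^sup>2) = 0"
  shows "fgen x * (fgen x * w) \<asymp> 0"
proof -
  have "fgen x * (fgen x * w) \<asymp> (fscal m * (1 - (fgen y)\<^sup>2)) * w"
    using eqv_rel[OF r, of w] by (simp add: power2_eq_square mult.assoc)
  also have "(fscal m * (1 - (fgen y)\<^sup>2)) * w = fscal m * (w - (fgen y)\<^sup>2 * w)"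
    by (simp add: algebra_simps)
  also have "\<dots> \<asymp> fscal m * (w - fscal (c\<^sup>2) * w)"
    by (intro eqv_mult eqv_diff eqv_refl weight_square w)
  also have "fscal m * (w - fscal (c\<^sup>2) * w) = fscal (m * (1 - c\<^sup>2)) * w"
    by (simp add: algebra_simps fscal_simps(4)[symmetric] fscal_simps(2)[symmetric])
  also have "\<dots> = 0" by (simp only: m fscal_simps(5) mult_zero_left)
  finally show ?thesis .
qed

lemma A1_A1: "weight w c d \<Longrightarrow> c\<^sup>2 = (fst \<psi>)\<^sup>2 \<Longrightarrow> fgen A1 * (fgen A1 * w) \<asymp> 0"
  and A2_A2: "weight w c d \<Longrightarrow> d\<^sup>2 = (snd \<psi>)\<^sup>2 \<Longrightarrow> fgen A2 * (fgen A2 * w) \<asymp> 0"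
  using square_zero[of A1 l1 G1 w c] square_zero[of A2 l2 G2 w d] psi_eqs(1,2)
  unfolding weight_def by (simp_all add: Let_def del: mult_eq_0_iff)

text \<open>The right-hand side of the long relator acts on \<open>w\<close> by the scalar of the
  third condition in \<open>O1\<close>, so the relator degenerates to a sign rule.\<close>

lemma A2_A1_A2_A1:
  assumes w: "weight w c d" and c: "c\<^sup>2 = (fst \<psi>)\<^sup>2" and d: "d\<^sup>2 = (snd \<psi>)\<^sup>2"
  shows "fgen A2 * (fgen A1 * (fgen A2 * (fgen A1 * w))) \<asymp> - (fgen A1 * (fgen A2 * (fgen A1 * (fgen A2 * w))))"
proof -
  let ?a = "fgen A1 :: 'k free_alg" and ?b = "fgen A2 :: 'k free_alg"
  let ?g = "(fgen G1)\<^sup>2 :: 'k free_alg" and ?h = "(fgen G2)\<^sup>2 :: 'k free_alg"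
  have g: "?g * w \<asymp> fscal (c\<^sup>2) * w" and h: "?h * w \<asymp> fscal (d\<^sup>2) * w"
    using w weight_square by (auto simp: weight_def)
  have prod: "p * (q * w) \<asymp> fscal (a * b) * w"
    if "p * w \<asymp> fscal a * w" "q * w \<asymp> fscal b * w" for p q a b
  proof -
    have "p * (q * w) \<asymp> fscal b * (p * w)"
      using eqv_mult[OF that(2), of p] by (simp only: fscal_shift)
    also have "\<dots> \<asymp> fscal b * (fscal a * w)" by (intro eqv_mult that)
    also have "fscal b * (fscal a * w) = fscal (a * b) * w" by (simp only: fscal_merge mult.commute)
    finally show ?thesis .
  qed
  let ?R = "fscal l3 * (1 - ?g * ?h) - fscal (2 * l1 * l2) * (1 + ?h) * (1 - ?g)"
  have "?R * w = fscal l3 * (w - ?g * (?h * w)) - fscal (2 * l1 * l2) * ((w - ?g * w) + (?h * w - ?h * (?g * w)))"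
    by (simp add: algebra_simps)
  also have "\<dots> \<asymp> fscal l3 * (w - fscal (c\<^sup>2 * d\<^sup>2) * w)
      - fscal (2 * l1 * l2) * ((w - fscal (c\<^sup>2) * w) + (fscal (d\<^sup>2) * w - fscal (d\<^sup>2 * c\<^sup>2) * w))"
    by (intro eqv_mult eqv_diff eqv_add eqv_refl prod g h)
  also have "fscal l3 * (w - fscal (c\<^sup>2 * d\<^sup>2) * w)
      - fscal (2 * l1 * l2) * ((w - fscal (c\<^sup>2) * w) + (fscal (d\<^sup>2) * w - fscal (d\<^sup>2 * c\<^sup>2) * w))
    = fscal (l3 * (1 - c\<^sup>2 * d\<^sup>2) - (2 * l1 * l2) * ((1 - c\<^sup>2) + (d\<^sup>2 - d\<^sup>2 * c\<^sup>2))) * w"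
    by (simp only: fscal_simps(1,2,4,6)[symmetric] left_diff_distrib right_diff_distrib distrib_left distrib_right mult.assoc mult_1_left mult_1_right)
  also have "l3 * (1 - c\<^sup>2 * d\<^sup>2) - (2 * l1 * l2) * ((1 - c\<^sup>2) + (d\<^sup>2 - d\<^sup>2 * c\<^sup>2)) = 0"
    using psi_eqs(3) by (simp add: c d algebra_simps)
  finally have R: "?R * w \<asymp> 0" by (simp add: fscal_simps)
  have "(?a * ?b * ?a * ?b + ?b * ?a * ?b * ?a) * w \<asymp> ?R * w"
    by (rule eqv_rel) (simp add: Let_def)
  also note R
  finally have "?a * (?b * (?a * (?b * w))) + ?b * (?a * (?b * (?a * w))) \<asymp> 0"
    by (simp add: algebra_simps)
  then show ?thesis by (simp add: eqv_def algebra_simps)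
qed

lemma proj_weight:
  "weight (proj_basis 0) (fst \<psi>) (snd \<psi>)" "weight (proj_basis 1) (- fst \<psi>) (snd \<psi>)"
  "weight (proj_basis 2) (fst \<psi>) (- snd \<psi>)" "weight (proj_basis 3) (- fst \<psi>) (- snd \<psi>)"
  "weight (proj_basis 4) (fst \<psi>) (snd \<psi>)" "weight (proj_basis 5) (- fst \<psi>) (snd \<psi>)"
  "weight (proj_basis 6) (fst \<psi>) (- snd \<psi>)" "weight (proj_basis 7) (- fst \<psi>) (- snd \<psi>)"
  unfolding proj_basis_simps
  using weight_one weight_A1[OF weight_one] weight_A2[OF weight_A1[OF weight_one]]
    weight_A1[OF weight_A2[OF weight_A1[OF weight_one]]]
    weight_A1[OF weight_A2[OF weight_A1[OF weight_A2[OF weight_one]]]]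
    weight_A2[OF weight_A1[OF weight_A2[OF weight_one]]]
    weight_A1[OF weight_A2[OF weight_one]] weight_A2[OF weight_one]
  by simp_all

lemma proj_action:
  assumes "i < 8"
  shows "fgen x * proj_basis i \<asymp>
    (\<Sum>j<8. fscal (gen_scale \<psi> x * of_int ((proj_data x ! j) ! i)) * proj_basis j)"
proof -
  note W = proj_weight[unfolded weight_def]
  note a2 = A1_A1[OF proj_weight(1), unfolded proj_basis_simps] A1_A1[OF proj_weight(8), unfolded proj_basis_simps]
    A1_A1[OF proj_weight(3), unfolded proj_basis_simps] A1_A1[OF proj_weight(6), unfolded proj_basis_simps]
    A2_A2[OF proj_weight(1), unfolded proj_basis_simps] A2_A2[OF proj_weight(2), unfolded proj_basis_simps]
    A2_A2[OF proj_weight(7), unfolded proj_basis_simps]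
  note br = A2_A1_A2_A1[OF proj_weight(1), unfolded proj_basis_simps]
  \<comment> \<open>With \<open>a = a1\<close> and \<open>b = a2\<close>:
    \<open>b abab = (baba) b = - (abab) b\<close>, and the last word ends in \<open>b b\<close>,
    which is zero modulo the ideal.\<close>
  have top: "fgen A2 * (fgen A1 * (fgen A2 * (fgen A1 * fgen A2))) \<asymp> 0"
  proof -
    have "fgen A2 * (fgen A1 * (fgen A2 * (fgen A1 * fgen A2))) \<asymp> - (fgen A1 * (fgen A2 * (fgen A1 * (fgen A2 * fgen A2))))"
      using A2_A1_A2_A1[OF proj_weight(8)] by (simp add: proj_basis_simps)
    also have "fgen A1 * (fgen A2 * (fgen A1 * (fgen A2 * fgen A2))) \<asymp> fgen A1 * (fgen A2 * (fgen A1 * 0))"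
      using a2(5) by (intro eqv_mult) simp
    then have "- (fgen A1 * (fgen A2 * (fgen A1 * (fgen A2 * fgen A2)))) \<asymp> - 0"
      using eqv_uminus by fastforce
    finally show ?thesis by simp
  qed
  have col: "fgen x * proj_basis i \<asymp>
      (\<Sum>j<8. fscal (gen_scale \<psi> x * of_int ((proj_data x ! j) ! i)) * proj_basis j)"
    if c: "proj_column x i k s" and k: "k < 8"
      and e: "fgen x * proj_basis i \<asymp> fscal (gen_scale \<psi> x * of_int s) * proj_basis k" for x i k s
  proof -
    have "(\<Sum>j<8. fscal (gen_scale \<psi> x * of_int ((proj_data x ! j) ! i)) * proj_basis j) =
        (\<Sum>j<8. if j = k then fscal (gen_scale \<psi> x * of_int s) * proj_basis k else 0)"
      using c by (intro sum.cong) (auto simp: proj_column_def list_all_iff fscal_simps)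
    then show ?thesis using e k by simp
  qed
  note C = proj_columns[THEN col]
  show ?thesis
  proof (cases x)
    case 1: G1
    show ?thesis
      using less_8_cases[OF assms] unfolding 1
      by (elim disjE; hypsubst; intro C) (simp_all add: W gen_scale_def del: One_nat_def)
  next
    case 2: G2
    show ?thesis
      using less_8_cases[OF assms] unfolding 2
      by (elim disjE; hypsubst; intro C) (simp_all add: W gen_scale_def del: One_nat_def)
  next
    case 3: A1
    show ?thesis
      using less_8_cases[OF assms] unfolding 3
      by (elim disjE; hypsubst; intro C) (use a2 in \<open>simp_all add: proj_basis_simps gen_scale_def fscal_simps del: One_nat_def\<close>)
  next
    case 4: A2
    show ?thesis
      using less_8_cases[OF assms] unfolding 4
      by (elim disjE; hypsubst; intro C)
        (use a2 br top in \<open>simp_all add: proj_basis_simps gen_scale_def fscal_simps fscal_minus del: One_nat_def\<close>)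
  qed
qed

lemma proj_elem_add: "dim_vec v = 8 \<Longrightarrow> proj_elem (u + v) = proj_elem u + proj_elem v"
  by (simp add: proj_elem_def fscal_simps(1)[symmetric] distrib_right sum.distrib)

lemma proj_elem_smult: "dim_vec v = 8 \<Longrightarrow> proj_elem (c \<cdot>\<^sub>v v) = fscal c * proj_elem v"
  by (simp add: proj_elem_def fscal_simps(4)[symmetric] sum_distrib_left mult.assoc)

lemma proj_elem_action:
  assumes v: "v \<in> carrier_vec 8"
  shows "proj_elem (ract (int_rep 8 proj_data \<psi>) x *\<^sub>v v) \<asymp> fgen x * proj_elem v"
proof -
  let ?c = "\<lambda>j i. gen_scale \<psi> x * of_int ((proj_data x ! j) ! i)"
  have "fgen x * proj_elem v = (\<Sum>i<8. fscal (v $ i) * (fgen x * proj_basis i))"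
    unfolding proj_elem_def sum_distrib_left by (intro sum.cong refl) (metis fscal_commute mult.assoc)
  also have "\<dots> \<asymp> (\<Sum>i<8. fscal (v $ i) * (\<Sum>j<8. fscal (?c j i) * proj_basis j))"
    by (intro eqv_sum eqv_mult proj_action) simp
  also have "(\<Sum>i<8. fscal (v $ i) * (\<Sum>j<8. fscal (?c j i) * proj_basis j)) =
      (\<Sum>j<8. \<Sum>i<8. fscal (?c j i * v $ i) * proj_basis j)"
    by (subst sum.swap) (simp add: sum_distrib_left fscal_merge mult.commute)
  also have "\<dots> = (\<Sum>j<8. fscal (\<Sum>i<8. ?c j i * v $ i) * proj_basis j)"
  proof (intro sum.cong refl)
    fix j
    have "fscal (sum f S) = (\<Sum>i\<in>S. fscal (f i))" for f :: "nat \<Rightarrow> 'k" and S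
      by (induction S rule: infinite_finite_induct) (simp_all add: fscal_simps(5) fscal_simps(1)[symmetric])
    then show "(\<Sum>i<8. fscal (?c j i * v $ i) * proj_basis j) = fscal (\<Sum>i<8. ?c j i * v $ i) * proj_basis j"
      by (simp add: sum_distrib_right)
  qed
  also have "\<dots> = proj_elem (ract (int_rep 8 proj_data \<psi>) x *\<^sub>v v)"
    unfolding proj_elem_def using v
    by (intro sum.cong refl arg_cong2[of _ _ _ _ "(*)"] arg_cong[of _ _ fscal])
      (simp add: scalar_prod_def list_mat_def lessThan_atLeast0)
  finally show ?thesis by (rule eqv_sym)
qed

text \<open>Modulo the ideal, the span of the eight monomials contains 1 and is stable under every
  generator, so it contains all words.\<close>

lemma proj_elem_surj: "\<exists>v \<in> carrier_vec 8. p \<asymp> proj_elem v"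
proof (induction p rule: free_alg_induct)
  case (single w c)
  have "\<exists>v \<in> carrier_vec 8. Poly_Mapping.single (Word xs) 1 \<asymp> proj_elem v" for xs
  proof (induction xs)
    case Nil
    have 8: "{..<8} = {0, 1, 2, 3, 4, 5, 6, 7::nat}" by auto
    have "proj_elem (unit_vec 8 0) = (1 :: 'k free_alg)"
      by (simp add: proj_elem_def 8 fscal_simps proj_basis_simps)
    moreover have "Poly_Mapping.single (Word []) 1 = (1 :: 'k free_alg)"
      by (simp flip: zero_word_def)
    ultimately show ?case by (intro bexI[of _ "unit_vec 8 0"]) simp_all
  next
    case (Cons x xs)
    then obtain v where v: "v \<in> carrier_vec 8" "Poly_Mapping.single (Word xs) 1 \<asymp> proj_elem v" by blast
    have "Poly_Mapping.single (Word (x # xs)) (1::'k) = fgen x * Poly_Mapping.single (Word xs) 1"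
      by (simp add: fgen_def mult_single plus_word_def)
    also have "\<dots> \<asymp> fgen x * proj_elem v" by (intro eqv_mult v)
    also have "\<dots> \<asymp> proj_elem (ract (int_rep 8 proj_data \<psi>) x *\<^sub>v v)"
      using proj_elem_action[OF v(1)] by (rule eqv_sym)
    finally have "Poly_Mapping.single (Word (x # xs)) 1 \<asymp> proj_elem (ract (int_rep 8 proj_data \<psi>) x *\<^sub>v v)" .
    moreover have "ract (int_rep 8 proj_data \<psi>) x *\<^sub>v v \<in> carrier_vec 8"
      by (rule carrier_vecI) simp
    ultimately show ?case by blast
  qed
  then obtain v where v: "v \<in> carrier_vec 8" "Poly_Mapping.single (Word (letters w)) 1 \<asymp> proj_elem v" by blast
  have "Poly_Mapping.single w c = fscal c * Poly_Mapping.single (Word (letters w)) 1"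
    by (simp add: fscal_def mult_single)
  also have "\<dots> \<asymp> fscal c * proj_elem v" by (intro eqv_mult v)
  also have "fscal c * proj_elem v = proj_elem (c \<cdot>\<^sub>v v)" using v(1) by (simp add: proj_elem_smult)
  finally show ?case using v(1) by (intro bexI[of _ "c \<cdot>\<^sub>v v"]) auto
next
  case (add p q)
  then obtain u v where "u \<in> carrier_vec 8" "p \<asymp> proj_elem u" "v \<in> carrier_vec 8" "q \<asymp> proj_elem v" by blast
  then show ?case
    by (intro bexI[of _ "u + v"]) (auto simp: proj_elem_add intro: eqv_add)
qed

lemmas proj_elem_surj_diff = proj_elem_surj[unfolded eqv_def]
lemmas proj_elem_action_diff = proj_elem_action[unfolded eqv_def]

end

text \<open>The source of linear independence: in the model the \<open>i\<close>-th monomial takes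
  \<open>e_0\<close> to \<open>e_i\<close>, so the coefficients of a combination reappear as the
  coordinates of its value at \<open>e_0\<close>.\<close>

lemma proj_orbit:
  fixes \<psi> :: "'k::field \<times> 'k"
  assumes "v \<in> carrier_vec 8"
  shows "free_act (int_rep 8 proj_data \<psi>) (proj_elem v) *\<^sub>v unit_vec 8 0 = v"
proof -
  let ?U = "int_rep 8 proj_data \<psi>" and ?e = "unit_vec 8 :: nat \<Rightarrow> 'k vec"
  have wf: "wf_rep ?U" by simp
  have fc: "free_act ?U p \<in> carrier_mat 8 8" for p using free_act_carrier[of ?U p] by simp
  have step: "free_act ?U (fgen x * p) *\<^sub>v ?e 0 = ?e k"
    if "free_act ?U p *\<^sub>v ?e 0 = ?e i" "proj_column x i k 1" "gen_scale \<psi> x = 1" "i < 8" "k < 8" for x p i k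
  proof -
    have "free_act ?U (fgen x * p) *\<^sub>v ?e 0 = ract ?U x *\<^sub>v ?e i"
      using that(1) assoc_mult_mat_vec[OF fc fc unit_vec_carrier]
      by (simp add: free_act_mult[OF wf] free_act_fgen[OF wf, symmetric] del: int_rep_simps(2))
    also have "\<dots> = ?e k"
      using that(2-5)
      by (intro eq_vecI) (auto simp: scalar_prod_right_unit list_mat_def proj_column_def list_all_iff)
    finally show ?thesis .
  qed
  have gs: "gen_scale \<psi> A1 = 1" "gen_scale \<psi> A2 = 1" by (simp_all add: gen_scale_def)
  have 0: "free_act ?U 1 *\<^sub>v ?e 0 = ?e 0" by (simp add: free_act_1[OF wf])
  note s1 = step[OF 0 proj_columns(17) gs(1), simplified] and s7 = step[OF 0 proj_columns(25) gs(2), simplified]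
  note s2 = step[OF s1 proj_columns(26)[simplified] gs(2), simplified] and s6 = step[OF s7 proj_columns(24) gs(1), simplified]
  note s3 = step[OF s2 proj_columns(19) gs(1), simplified] and s5 = step[OF s6 proj_columns(31) gs(2), simplified]
  note s4 = step[OF s5 proj_columns(22) gs(1), simplified]
  have basis: "free_act ?U (proj_basis i) *\<^sub>v ?e 0 = ?e i" if "i < 8" for i
    using less_8_cases[OF that] 0 s1 s2 s3 s4 s5 s6 s7
    by (elim disjE) (simp_all add: proj_basis_simps[simplified])
  have sc: "free_act ?U (fscal c * p) *\<^sub>v ?e 0 = c \<cdot>\<^sub>v (free_act ?U p *\<^sub>v ?e 0)" for c p
  proof -
    have "free_act ?U (fscal c) *\<^sub>v ?e 0 = c \<cdot>\<^sub>v ?e 0"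
      by (intro eq_vecI) (auto simp: free_act_fscal[OF wf])
    then show ?thesis
      unfolding fscal_commute free_act_mult[OF wf]
      by (simp add: assoc_mult_mat_vec[OF fc fc unit_vec_carrier] mult_mat_vec[OF fc unit_vec_carrier])
  qed
  have sum: "finite S \<Longrightarrow> (free_act ?U (\<Sum>i\<in>S. fscal (v $ i) * proj_basis i) *\<^sub>v ?e 0) $ j =
      (\<Sum>i\<in>S. v $ i * (?e i $ j))" if "j < 8" "S \<subseteq> {..<8}" for S j
    using that(2)
  proof (induction S rule: infinite_finite_induct)
    case empty
    show ?case using that(1) by (simp add: free_act_0)
  next
    case (insert i S)
    then show ?case using that(1) basis[of i] fc
      by (simp add: free_act_add add_mult_distrib_mat_vec[OF fc fc unit_vec_carrier] sc carrier_matD[OF fc])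
  qed simp
  show ?thesis
  proof (rule eq_vecI)
    fix j assume "j < dim_vec v"
    then have j: "j < 8" using assms by simp
    have "(\<Sum>i<8. v $ i * (?e i $ j)) = (\<Sum>i<8. if i = j then v $ j else 0)"
      using j by (intro sum.cong) auto
    then show "(free_act ?U (proj_elem v) *\<^sub>v ?e 0) $ j = v $ j"
      using sum[OF j, of "{..<8}"] j by (simp add: proj_elem_def)
  qed (use assms fc in auto)
qed

text \<open>The additive map from the free abelian group to the field that extends \<open>f\<close>;
  it serves to separate elements of the tensor product.\<close>

definition frag_eval :: "('a \<Rightarrow> 'k::comm_ring_1) \<Rightarrow> ('a \<Rightarrow>\<^sub>0 int) \<Rightarrow> 'k" where
  "frag_eval f x = (\<Sum>a\<in>Poly_Mapping.keys x. of_int (Poly_Mapping.lookup x a) * f a)"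

lemma frag_eval_superset:
  "finite S \<Longrightarrow> Poly_Mapping.keys x \<subseteq> S \<Longrightarrow> frag_eval f x = (\<Sum>a\<in>S. of_int (Poly_Mapping.lookup x a) * f a)"
  unfolding frag_eval_def by (rule sum.mono_neutral_left) (auto simp: in_keys_iff)

lemma frag_eval_diff: "frag_eval f (x - y) = frag_eval f x - frag_eval f y"
proof -
  let ?S = "Poly_Mapping.keys x \<union> Poly_Mapping.keys y"
  have "Poly_Mapping.keys (x - y) \<subseteq> ?S" by (rule keys_diff)
  then show ?thesis
    by (simp add: frag_eval_superset[of ?S] lookup_minus left_diff_distrib sum_subtractf)
qed

lemma frag_eval_simps: "frag_eval f (frag_of a) = f a" "frag_eval f 0 = 0" "frag_eval f (- x) = - frag_eval f x"
  using frag_eval_diff[of f 0 x] by (simp_all add: frag_eval_def)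

lemma frag_eval_add: "frag_eval f (x + y) = frag_eval f x + frag_eval f y"
  using frag_eval_diff[of f x "- y"] by (simp add: frag_eval_simps)

section \<open>The tensor product as a quotient of a free abelian group\<close>

context
  fixes N M :: nat and l :: "'k::field \<times> 'k \<times> 'k" and \<psi> :: "'k \<times> 'k"
begin

abbreviation (input) "Ksub \<equiv> ind_sub N M l \<psi>"
abbreviation (input) "Ffree \<equiv> ind_free N M l"
abbreviation (input) "cl \<equiv> hcls N M l"

abbreviation (input) "coset x \<equiv> Ksub #>\<^bsub>Ffree\<^esub> x"

text \<open>Every element of the algebra is a class, so the relations can be indexed by
  representatives, on which sums and products compute.\<close>

lemma ind_rels_conv:
  "ind_rels N M l \<psi> =
     {frag_of (cl (p + q), s) - frag_of (cl p, s) - frag_of (cl q, s) | p q s. True}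
   \<union> {frag_of (cl p, s + s') - frag_of (cl p, s) - frag_of (cl p, s') | p s s'. True}
   \<union> {frag_of (cl (p * (fscal c * fgen G1 ^ a * fgen G2 ^ b)), s)
        - frag_of (cl p, c * fst \<psi> ^ a * snd \<psi> ^ b * s) | p c a b s. True}"
proof -
  have "ind_rels N M l \<psi> =
     {frag_of (cl p \<oplus>\<^bsub>H_alg N M l\<^esub> cl q, s) - frag_of (cl p, s) - frag_of (cl q, s) | p q s. True}
   \<union> {frag_of (cl p, s + s') - frag_of (cl p, s) - frag_of (cl p, s') | p s s'. True}
   \<union> {frag_of (cl p \<otimes>\<^bsub>H_alg N M l\<^esub> cl (fscal c * fgen G1 ^ a * fgen G2 ^ b), s)
        - frag_of (cl p, c * fst \<psi> ^ a * snd \<psi> ^ b * s) | p c a b s. True}"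
    unfolding ind_rels_def H_alg_simps(1) by (intro arg_cong2[of _ _ _ _ "(\<union>)"]; blast)
  then show ?thesis by (simp only: H_alg_simps)
qed

lemma Ffree_carrier: "x \<in> carrier Ffree \<longleftrightarrow> Poly_Mapping.keys x \<subseteq> range cl \<times> UNIV"
  by (simp add: ind_free_def H_alg_simps)

lemma Ffree_mult [simp]: "x \<otimes>\<^bsub>Ffree\<^esub> y = x + y"
  by (simp add: ind_free_def)

lemma Ffree_one [simp]: "\<one>\<^bsub>Ffree\<^esub> = 0"
  by (simp add: ind_free_def)

lemma Ffree_group: "group Ffree"
  by (simp add: ind_free_def)

lemma frag_of_carrier: "frag_of (cl p, s) \<in> carrier Ffree"
  by (simp add: Ffree_carrier)

lemma carrier_closed:
  "x \<in> carrier Ffree \<Longrightarrow> y \<in> carrier Ffree \<Longrightarrow> x - y \<in> carrier Ffree"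
  "x \<in> carrier Ffree \<Longrightarrow> y \<in> carrier Ffree \<Longrightarrow> x + y \<in> carrier Ffree"
  using keys_diff[of x y] keys_add[of x y] by (auto simp: Ffree_carrier)

lemma ind_rels_carrier: "ind_rels N M l \<psi> \<subseteq> carrier Ffree"
  unfolding ind_rels_conv by (auto intro!: carrier_closed frag_of_carrier)

lemma K_subgroup: "subgroup Ksub Ffree"
  unfolding ind_sub_def by (rule group.generate_is_subgroup[OF Ffree_group ind_rels_carrier])

lemma K_carrier: "x \<in> Ksub \<Longrightarrow> x \<in> carrier Ffree"
  using subgroup.mem_carrier[OF K_subgroup] .

lemma K_zero: "0 \<in> Ksub"
  using subgroup.one_closed[OF K_subgroup] by simp

lemma K_add: "x \<in> Ksub \<Longrightarrow> y \<in> Ksub \<Longrightarrow> x + y \<in> Ksub"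
  using subgroup.m_closed[OF K_subgroup] by simp

lemma K_uminus: "x \<in> Ksub \<Longrightarrow> - x \<in> Ksub"
  using subgroup.m_inv_closed[OF K_subgroup, of x] K_carrier[of x]
  by (simp add: ind_free_def)

lemma K_diff: "x \<in> Ksub \<Longrightarrow> y \<in> Ksub \<Longrightarrow> x - y \<in> Ksub"
  using K_add[of x "- y"] K_uminus[of y] by simp

lemma K_rel: "x \<in> ind_rels N M l \<psi> \<Longrightarrow> x \<in> Ksub"
  unfolding ind_sub_def by (rule generate.incl)

lemma K_rels:
  "frag_of (cl (p + q), s) - frag_of (cl p, s) - frag_of (cl q, s) \<in> Ksub"
  "frag_of (cl p, s + s') - frag_of (cl p, s) - frag_of (cl p, s') \<in> Ksub"
  "frag_of (cl (p * (fscal c * fgen G1 ^ a * fgen G2 ^ b)), s)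
        - frag_of (cl p, c * fst \<psi> ^ a * snd \<psi> ^ b * s) \<in> Ksub"
  by (rule K_rel; unfold ind_rels_conv; blast)+

lemma K_induct [consumes 1, case_names zero rel minus add]:
  assumes "x \<in> Ksub" "P 0" "\<And>x. x \<in> ind_rels N M l \<psi> \<Longrightarrow> P x"
    "\<And>x. x \<in> ind_rels N M l \<psi> \<Longrightarrow> P (- x)" "\<And>x y. P x \<Longrightarrow> P y \<Longrightarrow> P (x + y)"
  shows "P x"
  using assms(1) unfolding ind_sub_def
proof (induction rule: generate.induct)
  case (inv h)
  then show ?case using assms(4)[OF inv] ind_rels_carrier by (auto simp: ind_free_def)
qed (use assms in auto)

definition h_act :: "'k free_alg \<Rightarrow> ('k free_alg set \<times> 'k \<Rightarrow>\<^sub>0 int) \<Rightarrow> ('k free_alg set \<times> 'k \<Rightarrow>\<^sub>0 int)" where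
  "h_act r = frag_extend (\<lambda>(h', s). frag_of (cl r \<otimes>\<^bsub>H_alg N M l\<^esub> h', s))"

lemma h_act_simps:
  "h_act r (frag_of (cl p, s)) = frag_of (cl (r * p), s)" "h_act r (x - y) = h_act r x - h_act r y"
  "h_act r (x + y) = h_act r x + h_act r y" "h_act r 0 = 0" "h_act r (- x) = - h_act r x"
  by (simp_all add: h_act_def frag_extend_diff frag_extend_add frag_extend_minus H_alg_simps)

text \<open>Balancing multiplies on the right, so by associativity and distributivity left
  multiplication maps each relation to a relation.\<close>

lemma h_act_K: "x \<in> Ksub \<Longrightarrow> h_act r x \<in> Ksub"
proof (induction rule: K_induct)
  case (rel x)
  then show ?case
    using K_rels unfolding ind_rels_conv by (auto simp: h_act_simps distrib_left simp flip: mult.assoc[of r])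
next
  case (minus x)
  then have "h_act r x \<in> Ksub"
    using K_rels unfolding ind_rels_conv by (auto simp: h_act_simps distrib_left simp flip: mult.assoc[of r])
  then show ?case by (simp add: h_act_simps K_uminus)
qed (auto simp: h_act_simps K_zero K_add)

lemma K_class: "frag_of (cl p, 1) - frag_of (cl q, 1) \<in> Ksub \<longleftrightarrow> frag_of (cl (p - q), 1) \<in> Ksub"
proof -
  have e: "frag_of (cl ((p - q) + q), 1) - frag_of (cl (p - q), 1) - frag_of (cl q, 1) \<in> Ksub"
    by (rule K_rels(1))
  show ?thesis
  proof
    assume "frag_of (cl p, 1) - frag_of (cl q, 1) \<in> Ksub"
    from K_diff[OF this e] show "frag_of (cl (p - q), 1) \<in> Ksub" by simp
  next
    assume "frag_of (cl (p - q), 1) \<in> Ksub"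
    from K_add[OF this e] show "frag_of (cl p, 1) - frag_of (cl q, 1) \<in> Ksub" by simp
  qed
qed

text \<open>The set consists of the \<open>p\<close> with \<open>p \<otimes> 1 = 0\<close>.
  Balancing takes both \<open>g_i \<otimes> 1\<close> and \<open>\<psi>_i \<otimes> 1\<close> to
  \<open>1 \<otimes> \<psi>_i\<close>, so their difference vanishes.\<close>

lemma weight_left_ideal_K:
  assumes "l = (l1, l2, l3)" "\<psi> \<in> O1 N M l"
  shows "weight_left_ideal N M l1 l2 l3 \<psi> {p. frag_of (cl p, 1) \<in> Ksub}"
proof
  show "\<psi> \<in> O1 N M (l1, l2, l3)" using assms by simp
  show z: "0 \<in> {p. frag_of (cl p, 1) \<in> Ksub}"
    using K_uminus[OF K_rels(1)[of 0 0 1]] by simp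
  show "p + q \<in> {p. frag_of (cl p, 1) \<in> Ksub}"
    if "p \<in> {p. frag_of (cl p, 1) \<in> Ksub}" "q \<in> {p. frag_of (cl p, 1) \<in> Ksub}" for p q
    using K_add[OF K_add[OF K_rels(1)[of p q 1], of "frag_of (cl p, 1)"], of "frag_of (cl q, 1)"] that by simp
  show "r * p \<in> {p. frag_of (cl p, 1) \<in> Ksub}" if "p \<in> {p. frag_of (cl p, 1) \<in> Ksub}" for r p
    using h_act_K[of "frag_of (cl p, 1)" r] that by (simp add: h_act_simps)
  show "rel_ideal N M (l1, l2, l3) \<subseteq> {p. frag_of (cl p, 1) \<in> Ksub}"
  proof
    fix p assume "p \<in> rel_ideal N M (l1, l2, l3)"
    then have "cl p = cl 0" by (simp add: hcls_eq_iff assms)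
    then show "p \<in> {p. frag_of (cl p, 1) \<in> Ksub}" using z by simp
  qed
  have "frag_of (cl (fgen G1), 1) - frag_of (cl 1, fst \<psi>) \<in> Ksub"
    "frag_of (cl (fgen G2), 1) - frag_of (cl 1, snd \<psi>) \<in> Ksub"
    "frag_of (cl (fscal c), 1) - frag_of (cl 1, c) \<in> Ksub" for c
    using K_rels(3)[of 1 1 1 0 1] K_rels(3)[of 1 1 0 1 1] K_rels(3)[of 1 c 0 0 1]
    by (simp_all add: fscal_simps(6))
  then have "frag_of (cl (fgen G1), 1) - frag_of (cl (fscal (fst \<psi>)), 1) \<in> Ksub"
    "frag_of (cl (fgen G2), 1) - frag_of (cl (fscal (snd \<psi>)), 1) \<in> Ksub"
    by (metis (no_types, lifting) K_diff diff_diff_eq2 diff_add_cancel)+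
  then show "fgen G1 - fscal (fst \<psi>) \<in> {p. frag_of (cl p, 1) \<in> Ksub}"
    "fgen G2 - fscal (snd \<psi>) \<in> {p. frag_of (cl p, 1) \<in> Ksub}"
    by (simp_all add: K_class)
qed

lemma K_coset: "coset x = (\<lambda>k. k + x) ` Ksub"
  by (auto simp: r_coset_def)

lemma K_coset_eq: "coset x = coset y \<longleftrightarrow> x - y \<in> Ksub"
proof
  assume e: "coset x = coset y"
  have "x \<in> coset x" unfolding K_coset using K_zero by (intro image_eqI[of _ _ 0]) simp_all
  then have "x \<in> coset y" by (simp only: e)
  then show "x - y \<in> Ksub" by (auto simp: K_coset)
next
  have *: "coset x \<subseteq> coset y" if "x - y \<in> Ksub" for x y
    unfolding K_coset
  proof (rule image_subsetI)
    fix k assume "k \<in> Ksub"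
    then show "k + x \<in> (\<lambda>k. k + y) ` Ksub"
      using K_add[OF _ that, of k] by (intro image_eqI[of _ _ "k + (x - y)"]) simp_all
  qed
  assume "x - y \<in> Ksub"
  then show "coset x = coset y"
    using *[of x y] *[of y x] K_uminus[of "x - y"] by auto
qed

lemma K_coset_mult:
  "coset x <#>\<^bsub>Ffree\<^esub> coset y = coset (x + y)"
proof
  show "coset x <#>\<^bsub>Ffree\<^esub> coset y \<subseteq> coset (x + y)"
  proof
    fix z assume "z \<in> coset x <#>\<^bsub>Ffree\<^esub> coset y"
    then obtain k k' where "k \<in> Ksub" "k' \<in> Ksub" "z = (k + x) + (k' + y)"
      by (auto simp: set_mult_def K_coset)
    then show "z \<in> coset (x + y)"
      unfolding K_coset by (intro image_eqI[of _ _ "k + k'"]) (simp_all add: K_add)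
  qed
  show "coset (x + y) \<subseteq> coset x <#>\<^bsub>Ffree\<^esub> coset y"
  proof
    fix z assume "z \<in> coset (x + y)"
    then obtain k where "k \<in> Ksub" "z = (k + x) + (0 + y)" by (auto simp: K_coset)
    then show "z \<in> coset x <#>\<^bsub>Ffree\<^esub> coset y"
      using K_zero unfolding set_mult_def K_coset Ffree_mult by blast
  qed
qed

lemma P_mod_simps:
  "carrier (P_mod N M l \<psi>) = (\<lambda>x. coset x) ` carrier Ffree"
  "(coset x) \<oplus>\<^bsub>P_mod N M l \<psi>\<^esub> (coset y) = coset (x + y)"
  "cl r \<odot>\<^bsub>P_mod N M l \<psi>\<^esub> (coset x) = coset (h_act r x)"
proof -
  show "carrier (P_mod N M l \<psi>) = (\<lambda>x. coset x) ` carrier Ffree"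
    by (auto simp: P_mod_def Let_def FactGroup_def RCOSETS_def)
  show "(coset x) \<oplus>\<^bsub>P_mod N M l \<psi>\<^esub> (coset y) = coset (x + y)"
    by (simp add: P_mod_def Let_def FactGroup_def K_coset_mult)
  have "cl r \<odot>\<^bsub>P_mod N M l \<psi>\<^esub> (coset x) =
      (\<Union>c\<in>coset x. coset (h_act r c))"
    by (simp add: P_mod_def Let_def h_act_def)
  also have "\<dots> = (\<Union>c\<in>coset x. coset (h_act r x))"
  proof (intro SUP_cong refl)
    fix c assume "c \<in> coset x"
    then obtain k where "k \<in> Ksub" "c = k + x" by (auto simp: K_coset)
    then show "coset (h_act r c) = coset (h_act r x)"
      by (simp add: K_coset_eq h_act_simps h_act_K)
  qed
  also have "\<dots> = coset (h_act r x)"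
    using K_zero by (auto simp: K_coset)
  finally show "cl r \<odot>\<^bsub>P_mod N M l \<psi>\<^esub> (coset x) = coset (h_act r x)" .
qed

lemma free_act_hcls_cong:
  assumes "U \<in> Rep N M l" "cl p = cl q"
  shows "free_act U p = free_act U q"
proof -
  have "free_act U (p - q) = 0\<^sub>m (rdim U) (rdim U)"
    using assms by (simp add: Rep_iff hcls_eq_iff)
  then have "free_act U ((p - q) + q) = free_act U q"
    unfolding free_act_add by (simp add: left_add_zero_mat[OF free_act_carrier])
  then show ?thesis by simp
qed

text \<open>The functional sends \<open>h \<otimes> s\<close> to \<open>s\<close> times the
  \<open>i\<close>-th coordinate of \<open>h e_0\<close> in the model. It respects balancing because
  \<open>e_0\<close> has type \<open>\<psi>\<close>; the chosen representative does not matter by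
  \<open>free_act_hcls_cong\<close>.\<close>

lemma K_eval:
  assumes U: "int_rep 8 proj_data \<psi> \<in> Rep N M l" and x: "x \<in> Ksub" and i: "i < 8"
  shows "frag_eval (\<lambda>(h, s). s * (free_act (int_rep 8 proj_data \<psi>) (SOME p. cl p = h) *\<^sub>v unit_vec 8 0) $ i) x = 0"
proof -
  let ?U = "int_rep 8 proj_data \<psi>" and ?e = "unit_vec 8 0 :: 'k vec"
  let ?v = "\<lambda>p. (free_act ?U p *\<^sub>v ?e) $ i"
  let ?E = "frag_eval (\<lambda>(h, s). s * ?v (SOME p. cl p = h))"
  have wf: "wf_rep ?U" by simp
  have fc: "free_act ?U p \<in> carrier_mat 8 8" for p using free_act_carrier[of ?U p] by simp
  have E: "?E (frag_of (cl p, s)) = s * ?v p" for p s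
  proof -
    have "cl (SOME q. cl q = cl p) = cl p" by (rule someI) simp
    from free_act_hcls_cong[OF U this] show ?thesis by (simp add: frag_eval_simps)
  qed
  have add: "?v (p + q) = ?v p + ?v q" for p q
    using i by (simp add: free_act_add add_mult_distrib_mat_vec[OF fc fc unit_vec_carrier] carrier_matD[OF fc])
  have eig_mult: "free_act ?U (q * q') *\<^sub>v ?e = (d * d') \<cdot>\<^sub>v ?e"
    if "free_act ?U q *\<^sub>v ?e = d \<cdot>\<^sub>v ?e" "free_act ?U q' *\<^sub>v ?e = d' \<cdot>\<^sub>v ?e" for q q' d d'
    using that by (simp add: free_act_mult[OF wf] assoc_mult_mat_vec[OF fc fc unit_vec_carrier]
      mult_mat_vec[OF fc unit_vec_carrier] smult_smult_assoc mult.commute)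
  have eig1: "free_act ?U 1 *\<^sub>v ?e = 1 \<cdot>\<^sub>v ?e" by (simp add: free_act_1[OF wf])
  have eig_pow: "free_act ?U (q ^ k) *\<^sub>v ?e = d ^ k \<cdot>\<^sub>v ?e" if "free_act ?U q *\<^sub>v ?e = d \<cdot>\<^sub>v ?e" for q d k
    by (induction k) (use eig1 eig_mult[OF that] in simp_all)
  have eigG: "free_act ?U (fgen x) *\<^sub>v ?e = gen_scale \<psi> x \<cdot>\<^sub>v ?e" if "x = G1 \<or> x = G2" for x
    using that proj_columns(1,9) unfolding free_act_fgen[OF wf]
    by (intro eq_vecI) (auto simp: scalar_prod_right_unit list_mat_def proj_column_def list_all_iff)
  have eigS: "free_act ?U (fscal c) *\<^sub>v ?e = c \<cdot>\<^sub>v ?e" for c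
    by (intro eq_vecI) (auto simp: free_act_fscal[OF wf] scalar_prod_right_unit)
  have bal: "?v (p * (fscal c * fgen G1 ^ a * fgen G2 ^ b)) = (c * fst \<psi> ^ a * snd \<psi> ^ b) * ?v p" for p c a b
    using eig_mult[OF eig_mult[OF eigS eig_pow[OF eigG]] eig_pow[OF eigG], of G1 G2 c a b] i fc[of p]
    by (simp add: free_act_mult[OF wf, of p] assoc_mult_mat_vec[OF fc fc unit_vec_carrier]
      mult_mat_vec[OF fc unit_vec_carrier] gen_scale_def)
  have rel0: "?E x = 0" if "x \<in> ind_rels N M l \<psi>" for x
    using that unfolding ind_rels_conv
    by (elim UnE CollectE exE conjE; hypsubst; simp only: frag_eval_diff E add bal; simp add: algebra_simps)
  show ?thesis
    using x by (induction rule: K_induct) (simp_all add: frag_eval_simps frag_eval_add rel0)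
qed

lemma realizes_proj:
  assumes U: "int_rep 8 proj_data \<psi> \<in> Rep N M l" and psi: "\<psi> \<in> O1 N M l"
  shows "realizes N M l (int_rep 8 proj_data \<psi>) (P_mod N M l \<psi>)"
proof -
  obtain l1 l2 l3 where l: "l = (l1, l2, l3)" by (cases l)
  interpret weight_left_ideal N M l1 l2 l3 \<psi> "{p. frag_of (cl p, 1) \<in> Ksub}"
    by (rule weight_left_ideal_K[OF l psi])
  let ?U = "int_rep 8 proj_data \<psi>"
  \<comment> \<open>The map sends \<open>v\<close> to \<open>proj_elem v \<otimes> 1\<close>. The
    functionals of \<open>K_eval\<close> recover the coordinates of \<open>v\<close>, which gives
    injectivity.\<close>
  define f where "f v = coset (frag_of (cl (proj_elem v), 1))" for v
  have inj: "u = v" if u: "u \<in> carrier_vec 8" and v: "v \<in> carrier_vec 8" and e: "f u = f v" for u v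
  proof (rule eq_vecI)
    fix i assume "i < dim_vec v"
    then have i: "i < 8" using v by simp
    let ?E = "frag_eval (\<lambda>(h, s). s * (free_act ?U (SOME p. cl p = h) *\<^sub>v unit_vec 8 0) $ i)"
    have E: "?E (frag_of (cl (proj_elem w), 1)) = w $ i" if "w \<in> carrier_vec 8" for w
    proof -
      have "cl (SOME q. cl q = cl (proj_elem w)) = cl (proj_elem w)" by (rule someI) simp
      from free_act_hcls_cong[OF U this] show ?thesis
        by (simp add: frag_eval_simps proj_orbit[OF that])
    qed
    have "frag_of (cl (proj_elem u), 1) - frag_of (cl (proj_elem v), 1) \<in> Ksub"
      using e by (simp add: f_def K_coset_eq)
    from K_eval[OF U this i] show "u $ i = v $ i" by (simp add: frag_eval_diff E u v)
  qed (use u v in auto)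
  have surj: "\<exists>v \<in> carrier_vec 8. x - frag_of (cl (proj_elem v), 1) \<in> Ksub" if x: "x \<in> carrier Ffree" for x
  proof -
    have "Poly_Mapping.keys x \<subseteq> range cl \<times> UNIV" using x by (simp add: Ffree_carrier)
    then show ?thesis
    proof (induction x rule: frag_induction)
      case zero
      have "proj_elem (0\<^sub>v 8) = (0 :: 'k free_alg)" by (simp add: proj_elem_def fscal_simps)
      then show ?case
        using weight_left_ideal.zero[OF weight_left_ideal_axioms] K_uminus[of "frag_of (cl 0, 1)"]
        by (intro bexI[of _ "0\<^sub>v 8"]) auto
    next
      case (one x)
      then obtain p s where x': "x = (cl p, s)" by auto
      obtain v where v: "v \<in> carrier_vec 8" "p * fscal s - proj_elem v \<in> {p. frag_of (cl p, 1) \<in> Ksub}"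
        using proj_elem_surj_diff by blast
      \<comment> \<open>Balancing with a scalar, \<open>p s \<otimes> 1 = p \<otimes> s\<close>,
        reduces every generator to one with second component 1, where spanning by monomials
        applies.\<close>
      have "frag_of (cl (p * fscal s), 1) - frag_of (cl p, s) \<in> Ksub"
        using K_rels(3)[of p s 0 0 1] by simp
      from K_diff[OF v(2)[unfolded mem_Collect_eq, folded K_class] this] show ?case
        using v(1) by (intro bexI[of _ v]) (simp_all add: x')
    next
      case (diff x y)
      then obtain u v where u: "u \<in> carrier_vec 8" "x - frag_of (cl (proj_elem u), 1) \<in> Ksub"
        and v: "v \<in> carrier_vec 8" "y - frag_of (cl (proj_elem v), 1) \<in> Ksub" by blast
      have "proj_elem u = proj_elem (u - v) + proj_elem v"
        using u v by (subst proj_elem_add[symmetric]) (auto intro!: arg_cong[of _ _ proj_elem])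
      then have "frag_of (cl (proj_elem u), 1) - frag_of (cl (proj_elem (u - v)), 1) - frag_of (cl (proj_elem v), 1) \<in> Ksub"
        using K_rels(1)[of "proj_elem (u - v)" "proj_elem v" 1] by simp
      from K_add[OF K_diff[OF u(2) v(2)] this] show ?case
        using u(1) v(1) by (intro bexI[of _ "u - v"]) auto
    qed
  qed
  have bij: "bij_betw f (carrier_vec 8) (carrier (P_mod N M l \<psi>))"
  proof (rule bij_betw_imageI)
    show "inj_on f (carrier_vec 8)" using inj by (auto simp: inj_on_def)
    show "f ` carrier_vec 8 = carrier (P_mod N M l \<psi>)"
    proof
      show "f ` carrier_vec 8 \<subseteq> carrier (P_mod N M l \<psi>)"
        by (auto simp: f_def P_mod_simps frag_of_carrier)
      show "carrier (P_mod N M l \<psi>) \<subseteq> f ` carrier_vec 8"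
      proof
        fix z assume "z \<in> carrier (P_mod N M l \<psi>)"
        then obtain x where x: "x \<in> carrier Ffree" "z = coset x" by (auto simp: P_mod_simps)
        from surj[OF x(1)] obtain v where "v \<in> carrier_vec 8" "x - frag_of (cl (proj_elem v), 1) \<in> Ksub"
          by blast
        then show "z \<in> f ` carrier_vec 8" by (auto simp: f_def x(2) K_coset_eq)
      qed
    qed
  qed
  have "f (u + v) = f u \<oplus>\<^bsub>P_mod N M l \<psi>\<^esub> f v" if "u \<in> carrier_vec 8" "v \<in> carrier_vec 8" for u v
    using that K_rels(1)[of "proj_elem u" "proj_elem v" 1]
    by (simp add: f_def P_mod_simps K_coset_eq proj_elem_add diff_diff_eq)
  moreover have "f (c \<cdot>\<^sub>v v) = cl (fscal c) \<odot>\<^bsub>P_mod N M l \<psi>\<^esub> f v" if "v \<in> carrier_vec 8" for c v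
    using that by (simp add: f_def P_mod_simps h_act_simps proj_elem_smult)
  moreover have "f (ract ?U x *\<^sub>v v) = cl (fgen x) \<odot>\<^bsub>P_mod N M l \<psi>\<^esub> f v" if "v \<in> carrier_vec 8" for x v
    using proj_elem_action_diff[OF that, of x, unfolded mem_Collect_eq, folded K_class]
    by (simp add: f_def P_mod_simps h_act_simps K_coset_eq)
  ultimately show ?thesis
    unfolding realizes_def using U bij by (intro conjI exI[of _ f]) simp_all
qed

end

section \<open>The decompositions\<close>

text \<open>Transposed pairs share one string, and this is the source of the commutation
  isomorphisms. The last branch is also the default, so the checks hold for every
  \<open>p\<close>.\<close>

definition string_data :: "nat \<times> nat \<Rightarrow> gen \<Rightarrow> int list list" where
  "string_data p =
    (if p = (1, 1) then string_11 else if p \<in> {(1, 2), (2, 1)} then string_12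
     else if p \<in> {(1, 3), (3, 1)} then string_13 else if p = (2, 2) then string_22
     else if p \<in> {(2, 4), (4, 2)} then string_24 else if p = (3, 3) then string_33
     else if p \<in> {(3, 4), (4, 3)} then string_34 else string_44)"

lemma string_data_simps:
  "string_data (1, 1) = string_11" "string_data (1, 2) = string_12" "string_data (1, 3) = string_13"
  "string_data (2, 1) = string_12" "string_data (2, 2) = string_22" "string_data (2, 4) = string_24"
  "string_data (3, 1) = string_13" "string_data (3, 3) = string_33" "string_data (3, 4) = string_34"
  "string_data (4, 2) = string_24" "string_data (4, 3) = string_34" "string_data (4, 4) = string_44"
  by (simp_all add: string_data_def)

lemma string_data_checks: "rep_check 9 (string_data p)" "local_check 9 (string_data p)"
  using string_rep_check string_local_check by (auto simp: string_data_def)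

lemma string_data_noniso:
  fixes \<psi> :: "'k::{field, ring_char_0} \<times> 'k"
  assumes \<psi>: "fst \<psi> \<noteq> 0" "snd \<psi> \<noteq> 0"
    and pq: "p \<in> {(1, 1), (1, 2), (1, 3), (2, 2), (2, 4), (3, 3), (3, 4), (4, 4)}"
      "q \<in> {(1, 1), (1, 2), (1, 3), (2, 2), (2, 4), (3, 3), (3, 4), (4, 4)}" "p \<noteq> q"
  shows "\<not> mat_iso (int_rep 9 (string_data p) \<psi>) (int_rep 9 (string_data q) \<psi>)"
proof -
  have m: "monomial_data 9 (string_data r)" for r
    using string_data_checks(2)[of r] by (simp add: local_check_def)
  note N = string_noniso_check[unfolded all_noniso.simps list.pred_inject simp_thms]
  have "p \<noteq> q \<longrightarrow> noniso_check 9 (string_data p) (string_data q) \<or> noniso_check 9 (string_data q) (string_data p)"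
    using pq(1,2)
    by (elim insertE emptyE; hypsubst; simp only: string_data_simps N simp_thms)
  then show ?thesis
    using noniso_check_not_iso[OF _ m m \<psi>] mat_iso_sym pq(3) by blast
qed

text \<open>The first condition kills the \<open>l1 * l2\<close> term in the third, so each
  condition reads \<open>c * (1 - x) = 0\<close> with \<open>x\<close> multiplicative in the
  character; then \<open>1 - x y = (1 - x) + x (1 - y)\<close>.\<close>

lemma cmul_O1:
  fixes \<chi> \<phi> :: "'k::field \<times> 'k"
  assumes "\<chi> \<in> O1 N M l" "\<phi> \<in> O1 N M l"
  shows "cmul \<chi> \<phi> \<in> O1 N M l"
proof -
  obtain l1 l2 l3 where l: "l = (l1, l2, l3)" by (cases l)
  have *: "l1 * (1 - fst \<eta> ^ 2) = 0" "l2 * (1 - snd \<eta> ^ 2) = 0" "l3 * (1 - fst \<eta> ^ 2 * snd \<eta> ^ 2) = 0"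
    if "\<eta> \<in> O1 N M l" for \<eta>
  proof -
    show 1: "l1 * (1 - fst \<eta> ^ 2) = 0" and "l2 * (1 - snd \<eta> ^ 2) = 0" using that by (auto simp: l)
    have "2 * l1 * l2 * (1 + snd \<eta> ^ 2) * (1 - fst \<eta> ^ 2) = 2 * l2 * (1 + snd \<eta> ^ 2) * (l1 * (1 - fst \<eta> ^ 2))"
      by (simp only: mult_ac)
    also have "\<dots> = 0" unfolding 1 by simp
    finally show "l3 * (1 - fst \<eta> ^ 2 * snd \<eta> ^ 2) = 0" using that by (simp add: l)
  qed
  have m: "c * (1 - x * y) = 0" if "c * (1 - x) = 0" "c * (1 - y) = 0" for c x y :: 'k
  proof -
    have "c * (1 - x * y) = c * (1 - x) + x * (c * (1 - y))" by (simp add: algebra_simps)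
    then show ?thesis using that by simp
  qed
  have 1: "l1 * (1 - (fst \<chi> * fst \<phi>) ^ 2) = 0" and 2: "l2 * (1 - (snd \<chi> * snd \<phi>) ^ 2) = 0"
    using m[OF *(1)[OF assms(1)] *(1)[OF assms(2)]] m[OF *(2)[OF assms(1)] *(2)[OF assms(2)]]
    by (simp_all add: power_mult_distrib)
  have 3: "l3 * (1 - (fst \<chi> * fst \<phi>) ^ 2 * (snd \<chi> * snd \<phi>) ^ 2) = 0"
    using m[OF *(3)[OF assms(1)] *(3)[OF assms(2)]] by (simp add: power_mult_distrib mult_ac)
  have "2 * l1 * l2 * (1 + (snd \<chi> * snd \<phi>) ^ 2) * (1 - (fst \<chi> * fst \<phi>) ^ 2) =
      2 * l2 * (1 + (snd \<chi> * snd \<phi>) ^ 2) * (l1 * (1 - (fst \<chi> * fst \<phi>) ^ 2))"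
    by (simp only: mult_ac)
  also have "\<dots> = 0" unfolding 1 by simp
  finally have 4: "2 * l1 * l2 * (1 + (snd \<chi> * snd \<phi>) ^ 2) * (1 - (fst \<chi> * fst \<phi>) ^ 2) = 0" .
  have "cmul \<chi> \<phi> \<in> chars N M"
    using assms by (simp add: l cmul_def chars_def power_mult_distrib)
  then show ?thesis
    unfolding l O1.simps by (simp only: mem_Collect_eq cmul_def fst_conv snd_conv 1 2 3 4 diff_self simp_thms)
qed

lemma O1_nonzero:
  fixes \<chi> :: "'k::field \<times> 'k"
  assumes "\<chi> \<in> O1 N M l" "N > 0" "M > 0"
  shows "fst \<chi> \<noteq> 0" "snd \<chi> \<noteq> 0"
  using assms by (cases l; auto simp: chars_def power_0_left)+

theorem proposition7p7:
  fixes N M :: nat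
    and l1 l2 l3 :: "'k :: {alg_closed_field, field_char_0}"
    and \<chi> \<phi> :: "'k \<times> 'k"
  assumes "N \<ge> 2" and "M \<ge> 2" and "odd N"
    and "\<chi> \<in> O1 N M (l1, l2, l3)" and "\<phi> \<in> O1 N M (l1, l2, l3)"
  shows
    "let l = (l1, l2, l3);
         T = (\<lambda>(i, j). rep_tensor (M3 i \<chi>) (M3 j \<phi>));
         E = {(1, 1), (1, 2), (1, 3), (2, 2), (2, 4), (3, 3), (3, 4), (4, 4)};
         \<psi> = cmul \<chi> \<phi>
     in
       (\<forall>p \<in> E. indecomposable N M l (T p)) \<and>
       (\<forall>p \<in> E. \<forall>q \<in> E. p \<noteq> q \<longrightarrow> \<not> rep_iso N M l (T p) (T q)) \<and>
       (\<forall>(i, j) \<in> {(2, 1), (3, 1), (3, 4), (4, 2)}. rep_iso N M l (T (i, j)) (T (j, i))) \<and>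
       (\<exists>P. realizes N M l P (P_mod N M l \<psi>) \<and>
          rep_iso N M l (T (1, 4)) (rep_sum P (L1 (cneg (cbar \<psi>)))) \<and>
          rep_iso N M l (T (4, 1)) (rep_sum P (L1 (cneg (cbar \<psi>))))) \<and>
       rep_iso N M l (T (2, 3))
         (rep_sum (rep_sum (C2 (- 1) (cneg (cbar \<psi>))) (C2 1 \<psi>)) (L1 (cbar \<psi>))) \<and>
       rep_iso N M l (T (3, 2))
         (rep_sum (rep_sum (C2 1 (cneg (cbar \<psi>))) (C2 (- 1) \<psi>)) (L1 (cbar \<psi>))) \<and>
       uiso N M l (T (1, 4)) (T (4, 1)) \<and>
       uiso N M l (T (4, 1)) (L1 (cneg (cbar \<psi>))) \<and>
       uiso N M l (T (2, 3)) (T (3, 2)) \<and>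
       uiso N M l (T (3, 2)) (L1 (cbar \<psi>)) \<and>
       (\<forall>i \<in> {1..4}. \<forall>j \<in> {1..4}. (i, j) \<notin> {(1, 4), (4, 1), (2, 3), (3, 2)} \<longrightarrow>
          usimple N M l (T (i, j)) \<and>
          (\<forall>\<eta> \<in> O1 N M l. \<not> uiso N M l (T (i, j)) (L1 \<eta>)) \<and>
          (\<forall>\<eta> \<in> O1 N M l. \<forall>k \<in> {1..4}. \<not> uiso N M l (T (i, j)) (M3 k \<eta>)))"

proof -
  define l where "l = (l1, l2, l3)"
  define \<psi> where "\<psi> = cmul \<chi> \<phi>"
  define T where "T = (\<lambda>(i, j). rep_tensor (M3 i \<chi>) (M3 j \<phi>))"
  define E :: "(nat \<times> nat) set" where "E = {(1, 1), (1, 2), (1, 3), (2, 2), (2, 4), (3, 3), (3, 4), (4, 4)}"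
  \<comment> \<open>The twelve pairs whose tensor product is a string module: \<open>E\<close>
    together with the transposes of its off-diagonal members.\<close>
  define R :: "(nat \<times> nat) set" where "R = E \<union> {(2, 1), (3, 1), (4, 3), (4, 2)}"
  let ?D = "\<lambda>D. int_rep 9 D \<psi>" and ?P = "int_rep 8 proj_data \<psi>"
  have \<chi>: "\<chi> \<in> O1 N M l" and \<phi>: "\<phi> \<in> O1 N M l" using assms by (simp_all add: l_def)
  have \<psi>: "\<psi> \<in> O1 N M l" unfolding \<psi>_def using cmul_O1[OF \<chi> \<phi>] .
  have pos: "N > 0" "M > 0" using assms by auto
  note nz = O1_nonzero[OF \<psi> pos]

  have tensor: "mat_iso (T (i, j)) (?D D)" if "iso_check 9 d A B D (m3_tensor i j)"
    for i j d A B D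
    using mat_iso_trans[OF M3_tensor[OF O1_nonzero[OF \<chi> pos], of i j \<phi>]
        mat_iso_sym[OF iso_check_mat_iso[OF that, of "cmul \<chi> \<phi>"]]]
    by (simp add: T_def \<psi>_def)
  have string: "mat_iso (T p) (?D (string_data p))" if "p \<in> R" for p
    using that unfolding R_def E_def
    by (elim UnE insertE emptyE; hypsubst)
      (simp_all only: string_data_simps,
       (rule tensor_iso_11[THEN tensor] tensor_iso_12[THEN tensor] tensor_iso_13[THEN tensor]
         tensor_iso_21[THEN tensor] tensor_iso_22[THEN tensor] tensor_iso_24[THEN tensor]
         tensor_iso_31[THEN tensor] tensor_iso_33[THEN tensor] tensor_iso_34[THEN tensor]
         tensor_iso_42[THEN tensor] tensor_iso_43[THEN tensor] tensor_iso_44[THEN tensor])+)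
  have string_Rep: "T p \<in> Rep N M l" if "p \<in> R" for p
    using mat_iso_Rep[OF mat_iso_sym[OF string[OF that]] rep_check_Rep[OF string_data_checks(1) \<psi>]] .
  have string_local: "local_rep N (T p)" if "p \<in> R" for p
    using local_rep_iso[OF mat_iso_sym[OF string[OF that]]
        local_check_local_rep[OF string_data_checks(2) \<open>odd N\<close> nz]] .

  have L_Rep: "L1 (cneg (cbar \<psi>)) \<in> Rep N M l" "L1 (cbar \<psi>) \<in> Rep N M l"
    unfolding L1_int_rep(2,3) using summand_rep_checks(5,6)[THEN rep_check_Rep, OF \<psi>] by simp_all
  have P_Rep: "?P \<in> Rep N M l" using rep_check_Rep[OF summand_rep_checks(1) \<psi>] .
  have P_sum: "rep_sum ?P (L1 (cneg (cbar \<psi>))) = ?D proj_sum_data"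
    unfolding L1_int_rep(3) proj_sum_data_def by (simp add: rep_sum_int_rep sq_data_summands del: One_nat_def)
  \<comment> \<open>The band parameter stays a cast integer so that the integral model applies; it
    is specialised to 1 and -1 afterwards.\<close>
  have C_sum: "rep_sum (rep_sum (C2 (of_int b) (cneg (cbar \<psi>))) (C2 (of_int c) \<psi>)) (L1 (cbar \<psi>)) =
      ?D (band_sum_data b c)" for b c
    unfolding L1_int_rep(2) C2_int_rep(2)
    unfolding C2_int_rep(1) band_sum_data_def by (simp add: rep_sum_int_rep sq_data_summands del: One_nat_def)
  have iso14: "mat_iso (T (1, 4)) (rep_sum ?P (L1 (cneg (cbar \<psi>))))"
    and iso41: "mat_iso (T (4, 1)) (rep_sum ?P (L1 (cneg (cbar \<psi>))))"
    unfolding P_sum by (rule tensor[OF tensor_iso_14] tensor[OF tensor_iso_41])+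
  have iso23: "mat_iso (T (2, 3)) (rep_sum (rep_sum (C2 (- 1) (cneg (cbar \<psi>))) (C2 1 \<psi>)) (L1 (cbar \<psi>)))"
    and iso32: "mat_iso (T (3, 2)) (rep_sum (rep_sum (C2 1 (cneg (cbar \<psi>))) (C2 (- 1) \<psi>)) (L1 (cbar \<psi>)))"
    using tensor[OF tensor_iso_23] tensor[OF tensor_iso_32] C_sum[of "- 1" 1] C_sum[of 1 "- 1"] by simp_all
  have Rep4: "T (1, 4) \<in> Rep N M l" "T (4, 1) \<in> Rep N M l" "T (2, 3) \<in> Rep N M l" "T (3, 2) \<in> Rep N M l"
    using mat_iso_Rep[OF mat_iso_sym[OF tensor[OF tensor_iso_14]] rep_check_Rep[OF summand_rep_checks(2) \<psi>]]
      mat_iso_Rep[OF mat_iso_sym[OF tensor[OF tensor_iso_41]] rep_check_Rep[OF summand_rep_checks(2) \<psi>]]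
      mat_iso_Rep[OF mat_iso_sym[OF tensor[OF tensor_iso_23]] rep_check_Rep[OF summand_rep_checks(3) \<psi>]]
      mat_iso_Rep[OF mat_iso_sym[OF tensor[OF tensor_iso_32]] rep_check_Rep[OF summand_rep_checks(4) \<psi>]] .
  have C_null': "qtr_null N (rep_sum (C2 (- 1) (cneg (cbar \<psi>))) (C2 1 \<psi>))"
    using qtr_null_sum[OF null_check_qtr_null[OF null_checks(5) \<open>odd N\<close>, of \<psi>]
        null_check_qtr_null[OF null_checks(2) \<open>odd N\<close>, of \<psi>]]
      C2_int_rep(2)[of "- 1" \<psi>] C2_int_rep(1)[of 1 \<psi>] by simp
  have C_null: "qtr_null N (rep_sum (C2 1 (cneg (cbar \<psi>))) (C2 (- 1) \<psi>))"
    using qtr_null_sum[OF null_check_qtr_null[OF null_checks(3) \<open>odd N\<close>, of \<psi>]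
        null_check_qtr_null[OF null_checks(4) \<open>odd N\<close>, of \<psi>]]
      C2_int_rep(2)[of 1 \<psi>] C2_int_rep(1)[of "- 1" \<psi>] by simp

  have c1: "\<forall>p \<in> E. indecomposable N M l (T p)"
    using local_rep_indecomposable[OF string_local string_Rep] by (simp add: R_def)
  have c2: "\<forall>p \<in> E. \<forall>q \<in> E. p \<noteq> q \<longrightarrow> \<not> rep_iso N M l (T p) (T q)"
  proof (intro ballI impI notI)
    fix p q assume pq: "p \<in> E" "q \<in> E" "p \<noteq> q" and "rep_iso N M l (T p) (T q)"
    then have "mat_iso (?D (string_data p)) (?D (string_data q))"
      using mat_iso_trans[OF mat_iso_sym[OF string] mat_iso_trans[OF _ string]] by (simp add: rep_iso_iff R_def)
    then show False using string_data_noniso[OF nz pq[unfolded E_def]] by blast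
  qed
  have c3: "\<forall>(i, j) \<in> {(2, 1), (3, 1), (3, 4), (4, 2)}. rep_iso N M l (T (i, j)) (T (j, i))"
  proof -
    have "rep_iso N M l (T (i, j)) (T (j, i))" if "(i, j) \<in> R" "(j, i) \<in> R" "string_data (i, j) = string_data (j, i)" for i j
      using mat_iso_trans[OF string[OF that(1)], unfolded that(3), OF mat_iso_sym[OF string[OF that(2)]]]
        string_Rep[OF that(1)] by (simp add: rep_iso_iff)
    then show ?thesis by (simp add: R_def E_def string_data_def)
  qed
  have c4: "\<exists>P. realizes N M l P (P_mod N M l \<psi>) \<and>
      rep_iso N M l (T (1, 4)) (rep_sum P (L1 (cneg (cbar \<psi>)))) \<and>
      rep_iso N M l (T (4, 1)) (rep_sum P (L1 (cneg (cbar \<psi>))))"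
    using realizes_proj[OF P_Rep \<psi>] iso14 iso41 Rep4 by (auto simp: rep_iso_iff)
  have c5: "rep_iso N M l (T (2, 3)) (rep_sum (rep_sum (C2 (- 1) (cneg (cbar \<psi>))) (C2 1 \<psi>)) (L1 (cbar \<psi>)))"
    "rep_iso N M l (T (3, 2)) (rep_sum (rep_sum (C2 1 (cneg (cbar \<psi>))) (C2 (- 1) \<psi>)) (L1 (cbar \<psi>)))"
    using iso23 iso32 Rep4 by (simp_all add: rep_iso_iff)
  have u14: "uiso N M l (T (1, 4)) (T (4, 1))"
    using mat_iso_uiso[OF mat_iso_trans[OF iso14 mat_iso_sym[OF iso41]] Rep4(1)] .
  have u41: "uiso N M l (T (4, 1)) (L1 (cneg (cbar \<psi>)))"
    using uiso_sum_null[OF iso41 Rep4(2) L_Rep(1) null_check_qtr_null[OF null_checks(1) \<open>odd N\<close>]] .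
  have u32: "uiso N M l (T (3, 2)) (L1 (cbar \<psi>))"
    using uiso_sum_null[OF iso32 Rep4(4) L_Rep(2) C_null] .
  have simple: "usimple N M l (T (i, j)) \<and>
      (\<forall>\<eta> \<in> O1 N M l. \<not> uiso N M l (T (i, j)) (L1 \<eta>)) \<and>
      (\<forall>\<eta> \<in> O1 N M l. \<forall>k \<in> {1..4}. \<not> uiso N M l (T (i, j)) (M3 k \<eta>))"
    if "i \<in> {1..4}" "j \<in> {1..4}" "(i, j) \<notin> {(1, 4), (4, 1), (2, 3), (3, 2)}" for i j
  proof -
    have "i = 1 \<or> i = 2 \<or> i = 3 \<or> i = 4" "j = 1 \<or> j = 2 \<or> j = 3 \<or> j = 4" using that by auto
    then have R: "(i, j) \<in> R" using that(3) by (auto simp: R_def E_def)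
    \<comment> \<open>Dimension 9 exceeds the dimensions 1 and 3 of the modules to be excluded, so
      \<open>local_rep_not_uiso\<close> applies.\<close>
    have "rdim (T (i, j)) = 9" by (simp add: T_def rep_tensor_def M3_int_rep)
    then show ?thesis
      using local_rep_usimple[OF string_local[OF R] string_Rep[OF R]] local_rep_not_uiso[OF string_local[OF R]]
      by (simp add: L1_int_rep(1) M3_int_rep)
  qed
  \<comment> \<open>The two products are decomposed with different bands, so they are compared in
    the quotient through the common summand \<open>L1 (cbar \<psi>)\<close>.\<close>
  have u23: "uiso N M l (T (2, 3)) (T (3, 2))"
    using uiso_trans[OF uiso_sum_null[OF iso23 Rep4(3) L_Rep(2) C_null'] uiso_sym[OF u32]] .
  show ?thesis
    unfolding Let_def l_def[symmetric] \<psi>_def[symmetric] T_def[symmetric] E_def[symmetric]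
    by (intro conjI c1 c2 c3 c4 c5 u14 u41 u23 u32 ballI impI)
      (use simple in blast)+
qed

end
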